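(* Let $(M,g)$ be a constant curvature pseudo-Riemannian manifold, and let $\Sigma$ be a co-oriented immersed hypersurface in $M$ such that $\Sigma$ is nondegenerate with respect to the Levi-Civita connection $\hat\nabla$ of $g$ and the restriction of $g$ to $\Sigma$ is a pseudo-Riemannian metric. Then the co-oriented equiaffine normal $\mathsf W$ of $\Sigma$ determined by $\hat\nabla$ and the volume form $\mathrm{vol}_g$ of $g$ and the co-oriented unimodular orthogonal vector field $E$ are proportional if and only if $\Sigma$ has constant Gauss-Kronecker curvature, in which case $\mathsf W$ is a constant multiple of $E$ and the equiaffine mean curvature of $\Sigma$ is a constant multiple of the pseudo-Riemannian mean curvature.
   Context: Write $n+1$ for the dimension of $M$. A vector field $T$ transverse to $\Sigma$ determines on $\Sigma$ an induced connection $\nabla$, a symmetric two-tensor $h$, a shape operator $S$ and a one-form $\tau$ by $\hat\nabla_XY=\nabla_XY+h(X,Y)T$ and $\hat\nabla_XT=-S(X)+\tau(X)T$ for $X,Y$ tangent to $\Sigma$. $\Sigma$ is nondegenerate with respect to $\hat\nabla$ if $h$ is nondegenerate (independent of $T$). The mean curvature with respect to $T$ is $\tfrac1n\operatorname{tr}S$. A torsion-free connection $\nabla$ on an $n$-manifold is aligned with respect to a pseudo-Riemannian metric $h$ if $n\,h^{PQ}\nabla_Ph_{QI}=h^{PQ}\nabla_Ih_{PQ}$, where $h^{IJ}$ is the inverse of $h_{IJ}$. For a nondegenerate co-oriented hypersurface, the equiaffine normal $\mathsf W$ determined by $\hat\nabla$ and $\mathrm{vol}_g$ is the unique co-oriented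 transversal such that the induced connection is aligned with respect to the induced tensor $k$ (the $h$ for $T=\mathsf W$) and $|\iota(\mathsf W)\mathrm{vol}_g|=|\mathrm{vol}_k|$. The equiaffine mean curvature is the mean curvature with respect to $\mathsf W$. The co-oriented unimodular orthogonal vector field $E$ is the co-oriented vector field along $\Sigma$ that is $g$-orthogonal to $\Sigma$ with $|g(E,E)|=1$. The pseudo-Riemannian mean curvature is the mean curvature with respect to $E$, and the Gauss-Kronecker curvature is the determinant of the shape operator determined by $\hat\nabla$ and $E$.
   Formalization: Σ is assumed connected (two concentric spheres of different radii have W proportional to E but nonconstant Gauss-Kronecker curvature), and dim Σ = n is at least 2 (for n = 1 alignment is vacuous, so the equiaffine normal is not determined). *)

theory Defs
  imports "HOL-Analysis.Analysis"
begin

section \<open>Smooth maps and smooth manifolds\<close>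

text \<open>The class \<open>C\<^sup>k\<close> on an open set.\<close>

fun Ck_on :: "nat \<Rightarrow> 'v::euclidean_space set \<Rightarrow> ('v \<Rightarrow> 'w::real_normed_vector) \<Rightarrow> bool" where
  "Ck_on 0 U f \<longleftrightarrow> continuous_on U f"
| "Ck_on (Suc k) U f \<longleftrightarrow>
     (\<forall>x\<in>U. f differentiable (at x)) \<and> (\<forall>v. Ck_on k U (\<lambda>x. frechet_derivative f (at x) v))"

definition smooth_on :: "'v::euclidean_space set \<Rightarrow> ('v \<Rightarrow> 'w::real_normed_vector) \<Rightarrow> bool" where
  "smooth_on U f \<longleftrightarrow> (\<forall>k. Ck_on k U f)"

text \<open>A chart is a domain together with a coordinate map, whose values off the domain are irrelevant.\<close>

type_synonym ('a, 'k) chart = "'a set \<times> ('a \<Rightarrow> real ^ 'k)"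

definition chart_inv :: "('a, 'k::finite) chart \<Rightarrow> real ^ 'k \<Rightarrow> 'a" where
  "chart_inv c = inv_into (fst c) (snd c)"

definition chart_on :: "'a topology \<Rightarrow> ('a, 'k::finite) chart \<Rightarrow> bool" where
  "chart_on X c \<longleftrightarrow> openin X (fst c) \<and> open (snd c ` fst c) \<and>
     homeomorphic_map (subtopology X (fst c)) (top_of_set (snd c ` fst c)) (snd c)"

record ('a, 'k) manifold =
  mtop :: "'a topology"
  atlas :: "('a, 'k) chart set"

abbreviation points :: "('a, 'k) manifold \<Rightarrow> 'a set" where
  "points M \<equiv> topspace (mtop M)"

text \<open>The atlas need not be maximal.\<close>

definition smooth_manifold :: "('a, 'k::finite) manifold \<Rightarrow> bool" where
  "smooth_manifold M \<longleftrightarrow>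
     Hausdorff_space (mtop M) \<and> second_countable (mtop M) \<and>
     (\<forall>c\<in>atlas M. chart_on (mtop M) c) \<and> (\<Union>c\<in>atlas M. fst c) = points M \<and>
     (\<forall>c\<in>atlas M. \<forall>d\<in>atlas M. smooth_on (snd c ` (fst c \<inter> fst d)) (snd d \<circ> chart_inv c))"

definition chart_at :: "('a, 'k::finite) manifold \<Rightarrow> 'a \<Rightarrow> ('a, 'k) chart" where
  "chart_at M p = (SOME c. c \<in> atlas M \<and> p \<in> fst c)"

text \<open>The tangent map of \<open>F\<close> at \<open>p\<close> in the charts \<open>c\<close> (around \<open>p\<close>) and \<open>d\<close> (around \<open>F p\<close>).
  For \<open>F = id\<close> it is the Jacobian of the change of coordinates from \<open>c\<close> to \<open>d\<close>.\<close>

definition tangent_map ::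
    "('b, 'k::finite) chart \<Rightarrow> ('a, 'l::finite) chart \<Rightarrow> ('b \<Rightarrow> 'a) \<Rightarrow> 'b \<Rightarrow> real ^ 'k \<Rightarrow> real ^ 'l" where
  "tangent_map c d F p = frechet_derivative (snd d \<circ> F \<circ> chart_inv c) (at (snd c p))"

definition smooth_map :: "('b, 'k::finite) manifold \<Rightarrow> ('a, 'l::finite) manifold \<Rightarrow> ('b \<Rightarrow> 'a) \<Rightarrow> bool" where
  "smooth_map N M F \<longleftrightarrow> continuous_map (mtop N) (mtop M) F \<and>
     (\<forall>c\<in>atlas N. \<forall>d\<in>atlas M. smooth_on (snd c ` (fst c \<inter> F -` fst d)) (snd d \<circ> F \<circ> chart_inv c))"

definition immersion :: "('b, 'k::finite) manifold \<Rightarrow> ('a, 'l::finite) manifold \<Rightarrow> ('b \<Rightarrow> 'a) \<Rightarrow> bool" where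
  "immersion N M F \<longleftrightarrow> smooth_map N M F \<and>
     (\<forall>c\<in>atlas N. \<forall>d\<in>atlas M. \<forall>p\<in>fst c \<inter> F -` fst d. inj (tangent_map c d F p))"


section \<open>Tensors, metrics and connections\<close>

text \<open>A tensor field is given classically, by its components \<open>t c p\<close> at each point \<open>p\<close> in each
  chart \<open>c\<close> around \<open>p\<close>, subject to the transformation law under changes of charts. Components
  are presented as multilinear maps on the coordinate space.\<close>

type_synonym ('a, 'k) form2 = "('a, 'k) chart \<Rightarrow> 'a \<Rightarrow> real ^ 'k \<Rightarrow> real ^ 'k \<Rightarrow> real"

definition nondegenerate_form :: "('v::zero \<Rightarrow> 'v \<Rightarrow> real) \<Rightarrow> bool" where
  "nondegenerate_form b \<longleftrightarrow> (\<forall>x. (\<forall>y. b x y = 0) \<longrightarrow> x = 0)"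

definition gram :: "(real ^ 'k \<Rightarrow> real ^ 'k \<Rightarrow> real) \<Rightarrow> real ^ 'k ^ 'k::finite" where
  "gram b = (\<chi> i j. b (axis i 1) (axis j 1))"

definition pseudo_riemannian_metric :: "('a, 'k::finite) manifold \<Rightarrow> ('a, 'k) form2 \<Rightarrow> bool" where
  "pseudo_riemannian_metric M g \<longleftrightarrow>
     (\<forall>c\<in>atlas M. \<forall>v w. smooth_on (snd c ` fst c) (\<lambda>u. g c (chart_inv c u) v w)) \<and>
     (\<forall>c\<in>atlas M. \<forall>p\<in>fst c. bilinear (g c p) \<and> (\<forall>v w. g c p v w = g c p w v) \<and>
        nondegenerate_form (g c p)) \<and>
     (\<forall>c\<in>atlas M. \<forall>d\<in>atlas M. \<forall>p\<in>fst c \<inter> fst d. \<forall>v w.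
        g c p v w = g d p (tangent_map c d id p v) (tangent_map c d id p w))"

text \<open>An affine connection is given by its Christoffel symbols, as bilinear maps: in the chart \<open>c\<close>
  the covariant derivative of \<open>Y\<close> along \<open>X\<close> is \<open>D Y(X) + \<Gamma> c p X Y\<close>.\<close>

type_synonym ('a, 'k) christoffel = "('a, 'k) chart \<Rightarrow> 'a \<Rightarrow> real ^ 'k \<Rightarrow> real ^ 'k \<Rightarrow> real ^ 'k"

definition affine_connection :: "('a, 'k::finite) manifold \<Rightarrow> ('a, 'k) christoffel \<Rightarrow> bool" where
  "affine_connection M \<Gamma> \<longleftrightarrow>
     (\<forall>c\<in>atlas M. \<forall>v w. smooth_on (snd c ` fst c) (\<lambda>u. \<Gamma> c (chart_inv c u) v w)) \<and>
     (\<forall>c\<in>atlas M. \<forall>p\<in>fst c. bilinear (\<Gamma> c p)) \<and>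
     (\<forall>c\<in>atlas M. \<forall>d\<in>atlas M. \<forall>p\<in>fst c \<inter> fst d. \<forall>v w.
        \<Gamma> d p (tangent_map c d id p v) (tangent_map c d id p w) =
          tangent_map c d id p (\<Gamma> c p v w)
          - frechet_derivative (\<lambda>u. tangent_map c d id (chart_inv c u) w) (at (snd c p)) v)"

definition torsion_free :: "('a, 'k::finite) manifold \<Rightarrow> ('a, 'k) christoffel \<Rightarrow> bool" where
  "torsion_free M \<Gamma> \<longleftrightarrow> (\<forall>c\<in>atlas M. \<forall>p\<in>fst c. \<forall>v w. \<Gamma> c p v w = \<Gamma> c p w v)"

text \<open>The components \<open>(\<nabla>\<^sub>x h)(y, z)\<close> of the covariant derivative of a two-tensor.\<close>

definition cov_deriv_form ::
    "('a, 'k::finite) christoffel \<Rightarrow> ('a, 'k) form2 \<Rightarrow> ('a, 'k) chart \<Rightarrow> 'a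
      \<Rightarrow> real ^ 'k \<Rightarrow> real ^ 'k \<Rightarrow> real ^ 'k \<Rightarrow> real" where
  "cov_deriv_form \<Gamma> h c p x y z =
     frechet_derivative (\<lambda>u. h c (chart_inv c u) y z) (at (snd c p)) x
     - h c p (\<Gamma> c p x y) z - h c p y (\<Gamma> c p x z)"

definition levi_civita :: "('a, 'k::finite) manifold \<Rightarrow> ('a, 'k) form2 \<Rightarrow> ('a, 'k) christoffel \<Rightarrow> bool" where
  "levi_civita M g \<Gamma> \<longleftrightarrow> affine_connection M \<Gamma> \<and> torsion_free M \<Gamma> \<and>
     (\<forall>c\<in>atlas M. \<forall>p\<in>fst c. \<forall>x y z. cov_deriv_form \<Gamma> g c p x y z = 0)"

text \<open>\<open>R(x, y)z = \<nabla>\<^sub>x\<nabla>\<^sub>y z - \<nabla>\<^sub>y\<nabla>\<^sub>x z\<close> for fields with constant components, which commute.\<close>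

definition curvature ::
    "('a, 'k::finite) christoffel \<Rightarrow> ('a, 'k) chart \<Rightarrow> 'a
      \<Rightarrow> real ^ 'k \<Rightarrow> real ^ 'k \<Rightarrow> real ^ 'k \<Rightarrow> real ^ 'k" where
  "curvature \<Gamma> c p x y z =
     frechet_derivative (\<lambda>u. \<Gamma> c (chart_inv c u) y z) (at (snd c p)) x + \<Gamma> c p x (\<Gamma> c p y z)
     - (frechet_derivative (\<lambda>u. \<Gamma> c (chart_inv c u) x z) (at (snd c p)) y + \<Gamma> c p y (\<Gamma> c p x z))"

definition constant_curvature ::
    "('a, 'k::finite) manifold \<Rightarrow> ('a, 'k) form2 \<Rightarrow> ('a, 'k) christoffel \<Rightarrow> bool" where
  "constant_curvature M g \<Gamma> \<longleftrightarrow> (\<exists>\<kappa>. \<forall>c\<in>atlas M. \<forall>p\<in>fst c. \<forall>x y z.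
     curvature \<Gamma> c p x y z = \<kappa> *\<^sub>R (g c p y z *\<^sub>R x - g c p x z *\<^sub>R y))"

text \<open>Alignment: \<open>k h\<^sup>P\<^sup>Q \<nabla>\<^sub>P h\<^sub>Q\<^sub>I = h\<^sup>P\<^sup>Q \<nabla>\<^sub>I h\<^sub>P\<^sub>Q\<close> on a manifold of dimension \<open>k\<close>.\<close>

definition aligned :: "('a, 'k::finite) manifold \<Rightarrow> ('a, 'k) christoffel \<Rightarrow> ('a, 'k) form2 \<Rightarrow> bool" where
  "aligned M \<Gamma> h \<longleftrightarrow> (\<forall>c\<in>atlas M. \<forall>p\<in>fst c. \<forall>i::'k.
     real CARD('k) * (\<Sum>r\<in>UNIV. \<Sum>s\<in>UNIV. matrix_inv (gram (h c p)) $ r $ s *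
         cov_deriv_form \<Gamma> h c p (axis r 1) (axis s 1) (axis i 1))
     = (\<Sum>r\<in>UNIV. \<Sum>s\<in>UNIV. matrix_inv (gram (h c p)) $ r $ s *
         cov_deriv_form \<Gamma> h c p (axis i 1) (axis r 1) (axis s 1)))"

text \<open>\<open>\<bar>vol\<^sub>g(v\<^sub>1, v\<^sub>2, \<dots>)\<bar>\<close>, where \<open>vol\<^sub>g = \<plusminus>\<bar>det g\<bar>\<^bsup>1/2\<^esup> dx\<^sup>1 \<and> dx\<^sup>2 \<and> \<dots>\<close> in coordinates.
  The absolute value does not require an orientation.\<close>

definition abs_vol ::
    "('a, 'k::finite) form2 \<Rightarrow> ('a, 'k) chart \<Rightarrow> 'a \<Rightarrow> ('k \<Rightarrow> real ^ 'k) \<Rightarrow> real" where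
  "abs_vol g c p v = sqrt \<bar>det (gram (g c p))\<bar> * \<bar>det (\<chi> i j. v j $ i)\<bar>"


section \<open>Co-oriented immersed hypersurfaces\<close>

text \<open>The hypersurface is an immersion \<open>F\<close> of \<open>\<Sigma>\<close>, modelled on \<open>real ^ 'n\<close>, into \<open>M\<close>, modelled on
  \<open>real ^ 'n option\<close>; thus \<open>dim M = dim \<Sigma> + 1\<close>. Throughout \<open>c\<close> is a chart of \<open>\<Sigma>\<close> and \<open>d\<close> a
  chart of \<open>M\<close>. A vector field \<open>T\<close> along \<open>F\<close> has components \<open>T d p\<close> at the point \<open>p\<close> of \<open>\<Sigma>\<close>.\<close>

type_synonym ('b, 'a, 'k) along = "('a, 'k) chart \<Rightarrow> 'b \<Rightarrow> real ^ 'k"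

definition field_along ::
    "('b, 'n::finite) manifold \<Rightarrow> ('a, 'n option) manifold \<Rightarrow> ('b \<Rightarrow> 'a)
      \<Rightarrow> ('b, 'a, 'n option) along \<Rightarrow> bool" where
  "field_along \<Sigma> M F T \<longleftrightarrow>
     (\<forall>c\<in>atlas \<Sigma>. \<forall>d\<in>atlas M. smooth_on (snd c ` (fst c \<inter> F -` fst d)) (\<lambda>u. T d (chart_inv c u))) \<and>
     (\<forall>d\<in>atlas M. \<forall>e\<in>atlas M. \<forall>p\<in>points \<Sigma> \<inter> F -` (fst d \<inter> fst e).
        T e p = tangent_map d e id (F p) (T d p))"

definition transverse ::
    "('b, 'n::finite) manifold \<Rightarrow> ('a, 'n option) manifold \<Rightarrow> ('b \<Rightarrow> 'a)
      \<Rightarrow> ('b, 'a, 'n option) along \<Rightarrow> bool" where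
  "transverse \<Sigma> M F T \<longleftrightarrow> (\<forall>c\<in>atlas \<Sigma>. \<forall>d\<in>atlas M. \<forall>p\<in>fst c \<inter> F -` fst d.
     T d p \<notin> range (tangent_map c d F p))"

text \<open>A co-orientation (an orientation of the normal line bundle \<open>F\<^sup>*TM / T\<Sigma>\<close>) is represented by
  a nowhere vanishing conormal \<open>\<nu>\<close>; only the sign of \<open>\<nu>\<close> on transverse vectors is used.\<close>

definition coorientation ::
    "('b, 'n::finite) manifold \<Rightarrow> ('a, 'n option) manifold \<Rightarrow> ('b \<Rightarrow> 'a)
      \<Rightarrow> (('a, 'n option) chart \<Rightarrow> 'b \<Rightarrow> real ^ 'n option \<Rightarrow> real) \<Rightarrow> bool" where
  "coorientation \<Sigma> M F \<nu> \<longleftrightarrow>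
     (\<forall>c\<in>atlas \<Sigma>. \<forall>d\<in>atlas M. \<forall>v.
        smooth_on (snd c ` (fst c \<inter> F -` fst d)) (\<lambda>u. \<nu> d (chart_inv c u) v)) \<and>
     (\<forall>d\<in>atlas M. \<forall>e\<in>atlas M. \<forall>p\<in>points \<Sigma> \<inter> F -` (fst d \<inter> fst e). \<forall>v.
        \<nu> d p v = \<nu> e p (tangent_map d e id (F p) v)) \<and>
     (\<forall>d\<in>atlas M. \<forall>p\<in>points \<Sigma> \<inter> F -` fst d. linear (\<nu> d p) \<and> (\<exists>v. \<nu> d p v \<noteq> 0)) \<and>
     (\<forall>c\<in>atlas \<Sigma>. \<forall>d\<in>atlas M. \<forall>p\<in>fst c \<inter> F -` fst d. \<forall>x. \<nu> d p (tangent_map c d F p x) = 0)"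

definition cooriented ::
    "('b, 'n::finite) manifold \<Rightarrow> ('a, 'n option) manifold \<Rightarrow> ('b \<Rightarrow> 'a)
      \<Rightarrow> (('a, 'n option) chart \<Rightarrow> 'b \<Rightarrow> real ^ 'n option \<Rightarrow> real)
      \<Rightarrow> ('b, 'a, 'n option) along \<Rightarrow> bool" where
  "cooriented \<Sigma> M F \<nu> T \<longleftrightarrow> (\<forall>d\<in>atlas M. \<forall>p\<in>points \<Sigma> \<inter> F -` fst d. 0 < \<nu> d p (T d p))"

text \<open>The restriction of \<open>g\<close> to the hypersurface. Here and below the components with respect to a
  chart of \<open>\<Sigma>\<close> do not depend on the chart of \<open>M\<close> in which they are computed.\<close>

definition induced_metric ::
    "('a, 'n option) manifold \<Rightarrow> ('a, 'n option) form2 \<Rightarrow> ('b \<Rightarrow> 'a) \<Rightarrow> ('b, 'n::finite) form2" where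
  "induced_metric M g F c p x y = (let d = chart_at M (F p) in
     g d (F p) (tangent_map c d F p x) (tangent_map c d F p y))"

text \<open>The covariant derivative at \<open>p\<close> in the direction \<open>x\<close> tangent to \<open>\<Sigma>\<close> of a field along \<open>F\<close>
  with components \<open>Z\<close> in the chart \<open>d\<close>.\<close>

definition cov_along ::
    "('a, 'n option) christoffel \<Rightarrow> ('b \<Rightarrow> 'a) \<Rightarrow> ('b, 'n::finite) chart \<Rightarrow> ('a, 'n option) chart
      \<Rightarrow> 'b \<Rightarrow> real ^ 'n \<Rightarrow> ('b \<Rightarrow> real ^ 'n option) \<Rightarrow> real ^ 'n option" where
  "cov_along \<Gamma> F c d p x Z =
     frechet_derivative (\<lambda>u. Z (chart_inv c u)) (at (snd c p)) x
     + \<Gamma> d (F p) (tangent_map c d F p x) (Z p)"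

text \<open>The coefficients \<open>y\<close>, \<open>r\<close> of \<open>v = L y + r t\<close>, unique if \<open>L\<close> is linear, injective and its
  range does not contain \<open>t\<close>.\<close>

definition tang_coeff :: "('v \<Rightarrow> 'w::real_vector) \<Rightarrow> 'w \<Rightarrow> 'w \<Rightarrow> 'v" where
  "tang_coeff L t v = (THE y. \<exists>r. v = L y + r *\<^sub>R t)"

definition transv_coeff :: "('v \<Rightarrow> 'w::real_vector) \<Rightarrow> 'w \<Rightarrow> 'w \<Rightarrow> real" where
  "transv_coeff L t v = (THE r. \<exists>y. v = L y + r *\<^sub>R t)"

text \<open>The induced connection \<open>\<nabla>\<close>, the tensor \<open>h\<close> and the shape operator \<open>S\<close> determined by \<open>T\<close>
  through \<open>\<nabla>\<^sub>X Y + h(X, Y) T\<close> and \<open>- S(X) + \<tau>(X) T\<close> being the ambient derivatives of \<open>Y\<close> and \<open>T\<close>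
  along \<open>X\<close>. For \<open>\<nabla>\<close> and \<open>h\<close> the field \<open>Y\<close> is taken with constant components \<open>y\<close> in the chart
  \<open>c\<close>: its covariant derivative is then the value of the Christoffel symbol.\<close>

definition induced_connection ::
    "('a, 'n option) manifold \<Rightarrow> ('a, 'n option) christoffel \<Rightarrow> ('b \<Rightarrow> 'a)
      \<Rightarrow> ('b, 'a, 'n option) along \<Rightarrow> ('b, 'n::finite) christoffel" where
  "induced_connection M \<Gamma> F T c p x y = (let d = chart_at M (F p) in
     tang_coeff (tangent_map c d F p) (T d p) (cov_along \<Gamma> F c d p x (\<lambda>q. tangent_map c d F q y)))"

definition induced_tensor ::
    "('a, 'n option) manifold \<Rightarrow> ('a, 'n option) christoffel \<Rightarrow> ('b \<Rightarrow> 'a)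
      \<Rightarrow> ('b, 'a, 'n option) along \<Rightarrow> ('b, 'n::finite) form2" where
  "induced_tensor M \<Gamma> F T c p x y = (let d = chart_at M (F p) in
     transv_coeff (tangent_map c d F p) (T d p) (cov_along \<Gamma> F c d p x (\<lambda>q. tangent_map c d F q y)))"

definition shape_operator ::
    "('a, 'n option) manifold \<Rightarrow> ('a, 'n option) christoffel \<Rightarrow> ('b \<Rightarrow> 'a)
      \<Rightarrow> ('b, 'a, 'n option) along \<Rightarrow> ('b, 'n::finite) chart \<Rightarrow> 'b \<Rightarrow> real ^ 'n \<Rightarrow> real ^ 'n" where
  "shape_operator M \<Gamma> F T c p x = (let d = chart_at M (F p) in
     - tang_coeff (tangent_map c d F p) (T d p) (cov_along \<Gamma> F c d p x (T d)))"

text \<open>Nondegeneracy of \<open>h\<close> with respect to whatever transverse direction. The value of \<open>h\<close> at \<open>p\<close>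
  depends only on that of \<open>T\<close> at \<open>p\<close>, so no globally defined transverse field is needed.\<close>

definition nondegenerate_hypersurface ::
    "('b, 'n::finite) manifold \<Rightarrow> ('a, 'n option) manifold \<Rightarrow> ('a, 'n option) christoffel
      \<Rightarrow> ('b \<Rightarrow> 'a) \<Rightarrow> bool" where
  "nondegenerate_hypersurface \<Sigma> M \<Gamma> F \<longleftrightarrow> (\<forall>c\<in>atlas \<Sigma>. \<forall>p\<in>fst c. \<forall>T.
     T (chart_at M (F p)) p \<notin> range (tangent_map c (chart_at M (F p)) F p) \<longrightarrow>
     nondegenerate_form (induced_tensor M \<Gamma> F T c p))"

text \<open>The trace and the determinant of \<open>S\<close> do not depend on the chart.\<close>

definition mean_curvature ::
    "('b, 'n::finite) manifold \<Rightarrow> ('a, 'n option) manifold \<Rightarrow> ('a, 'n option) christoffel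
      \<Rightarrow> ('b \<Rightarrow> 'a) \<Rightarrow> ('b, 'a, 'n option) along \<Rightarrow> 'b \<Rightarrow> real" where
  "mean_curvature \<Sigma> M \<Gamma> F T p =
     trace (matrix (shape_operator M \<Gamma> F T (chart_at \<Sigma> p) p)) / real CARD('n)"

definition gauss_kronecker ::
    "('b, 'n::finite) manifold \<Rightarrow> ('a, 'n option) manifold \<Rightarrow> ('a, 'n option) christoffel
      \<Rightarrow> ('b \<Rightarrow> 'a) \<Rightarrow> ('b, 'a, 'n option) along \<Rightarrow> 'b \<Rightarrow> real" where
  "gauss_kronecker \<Sigma> M \<Gamma> F E p = det (matrix (shape_operator M \<Gamma> F E (chart_at \<Sigma> p) p))"

text \<open>The last clause is \<open>\<bar>\<iota>(W) vol\<^sub>g\<bar> = \<bar>vol\<^sub>k\<bar>\<close>, evaluated on arbitrary vectors \<open>y\<close> tangent to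
  \<open>\<Sigma>\<close>; the index \<open>None\<close> carries the transversal.\<close>

definition equiaffine_normal ::
    "('b, 'n::finite) manifold \<Rightarrow> ('a, 'n option) manifold \<Rightarrow> ('a, 'n option) form2
      \<Rightarrow> ('a, 'n option) christoffel \<Rightarrow> ('b \<Rightarrow> 'a)
      \<Rightarrow> (('a, 'n option) chart \<Rightarrow> 'b \<Rightarrow> real ^ 'n option \<Rightarrow> real)
      \<Rightarrow> ('b, 'a, 'n option) along \<Rightarrow> bool" where
  "equiaffine_normal \<Sigma> M g \<Gamma> F \<nu> W \<longleftrightarrow>
     field_along \<Sigma> M F W \<and> transverse \<Sigma> M F W \<and> cooriented \<Sigma> M F \<nu> W \<and>
     aligned \<Sigma> (induced_connection M \<Gamma> F W) (induced_tensor M \<Gamma> F W) \<and>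
     (\<forall>c\<in>atlas \<Sigma>. \<forall>d\<in>atlas M. \<forall>p\<in>fst c \<inter> F -` fst d. \<forall>y.
        abs_vol g d (F p) (case_option (W d p) (\<lambda>k. tangent_map c d F p (y k)))
        = abs_vol (induced_tensor M \<Gamma> F W) c p y)"

definition unimodular_orthogonal ::
    "('b, 'n::finite) manifold \<Rightarrow> ('a, 'n option) manifold \<Rightarrow> ('a, 'n option) form2 \<Rightarrow> ('b \<Rightarrow> 'a)
      \<Rightarrow> (('a, 'n option) chart \<Rightarrow> 'b \<Rightarrow> real ^ 'n option \<Rightarrow> real)
      \<Rightarrow> ('b, 'a, 'n option) along \<Rightarrow> bool" where
  "unimodular_orthogonal \<Sigma> M g F \<nu> E \<longleftrightarrow>
     field_along \<Sigma> M F E \<and> cooriented \<Sigma> M F \<nu> E \<and>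
     (\<forall>c\<in>atlas \<Sigma>. \<forall>d\<in>atlas M. \<forall>p\<in>fst c \<inter> F -` fst d.
        (\<forall>x. g d (F p) (E d p) (tangent_map c d F p x) = 0) \<and> \<bar>g d (F p) (E d p) (E d p)\<bar> = 1)"

end

theory Submission
  imports Defs
begin

text \<open>
  Let \<open>m\<close> be the induced metric and \<open>h\<close>, \<open>\<nabla>\<close>, \<open>S\<close> the data induced by \<open>E\<close>, so that
  \<open>h(X, Y) = \<epsilon> m(S X, Y)\<close> with \<open>\<epsilon> = g(E, E)\<close>, and \<open>\<nabla>\<close> is the Levi-Civita connection of \<open>m\<close>.
  In constant curvature the Codazzi equation makes \<open>\<nabla>h\<close> totally symmetric. Writing
  \<open>W = a E + Z\<close> with \<open>Z\<close> tangent, the tensor induced by \<open>W\<close> is \<open>k = h / a\<close> and its connection is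
  \<open>\<nabla> - k Z\<close>; for \<open>n \<ge> 2\<close> alignment becomes \<open>tr\<^sub>h(\<nabla>\<^sub>X h) = -(n + 2) k(Z, X)\<close>. By Jacobi's formula and
  \<open>\<nabla>m = 0\<close> the left-hand side is the logarithmic derivative of \<open>det S\<close> along \<open>X\<close>. Hence \<open>Z = 0\<close>
  exactly where \<open>d(det S) = 0\<close>, and connectedness gives the equivalence. The volume condition amounts to
  \<open>a^(n+2) = \<bar>det S\<bar>\<close>, so \<open>a\<close> is constant when \<open>det S\<close> is.
\<close>

section \<open>Differential calculus on open sets\<close>

text \<open>The two conditions defining \<open>W\<close> decouple. For a fixed connection, alignment
  does not change when the tensor is multiplied by a function, since both sides gain the same
  multiple of its differential. Hence da drops out and alignment sees only the ratio Z / a, while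
  the volume condition sees only a. Before division the alignment identity is (n - 1)(a
  tr_h(\<nabla>_X h) + (n + 2) h(Z, X)) = 0; for n = 1 alignment holds identically, which is the
  reason for 2 \<le> n. The exponent n + 2 in the volume condition has two sources: 2 from squaring
  the volume, n from the determinant of k = h / a. What shapes the formal argument is that the
  induced objects are defined in a chart chosen separately at each point, so they cannot be
  differentiated as they stand. They are therefore rewritten in one fixed pair of charts, and the
  geometry is done on open subsets of coordinate space.\<close>

lemma smooth_on_differentiable:
  assumes "smooth_on U f" and "u \<in> U"
  shows "f differentiable (at u)"
  using assms by (auto simp: smooth_on_def dest: spec[of _ "Suc 0"])

lemma smooth_on_has_derivative:
  assumes "smooth_on U f" and "u \<in> U"
  shows "(f has_derivative frechet_derivative f (at u)) (at u)"
  using smooth_on_differentiable[OF assms] by (simp add: frechet_derivative_works)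

lemma smooth_on_frechet_derivative:
  assumes "smooth_on U f"
  shows "smooth_on U (\<lambda>u. frechet_derivative f (at u) v)"
  using assms unfolding smooth_on_def by (metis Ck_on.simps(2))

lemma smooth_on_continuous_on:
  assumes "smooth_on U f"
  shows "continuous_on U f"
  using assms unfolding smooth_on_def by (metis Ck_on.simps(1))

lemma linear_expansion:
  fixes L :: "'v::euclidean_space \<Rightarrow> 'w::real_vector"
  assumes "linear L"
  shows "L v = (\<Sum>b\<in>Basis. (v \<bullet> b) *\<^sub>R L b)"
  by (metis (mono_tags, lifting) assms euclidean_representation linear_scale linear_sum sum.cong)

text \<open>Smoothness of \<open>\<Gamma>\<close>, of \<open>g\<close> and of Jacobians is known
  only for fixed arguments, so the product rule is drawn from linearity: over a basis,
  \<open>A (\<phi> t) (Y t)\<close> is a finite sum of scalar functions times differentiable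
  vectors. The expansion is valid only where \<open>A\<close> is linear, hence only for t near
  u.\<close>

lemma has_derivative_linear_family:
  fixes A :: "'v::real_normed_vector \<Rightarrow> 'w::euclidean_space \<Rightarrow> 'z::real_normed_vector"
    and \<phi> :: "'u::real_normed_vector \<Rightarrow> 'v"
  assumes V: "open V" "\<phi> u \<in> V" and lin: "\<And>v. v \<in> V \<Longrightarrow> linear (A v)"
    and diff: "\<And>w. (\<lambda>v. A v w) differentiable (at (\<phi> u))"
    and \<phi>: "(\<phi> has_derivative \<phi>') (at u)" and Y: "(Y has_derivative Y') (at u)"
  shows "((\<lambda>t. A (\<phi> t) (Y t)) has_derivative
           (\<lambda>h. frechet_derivative (\<lambda>v. A v (Y u)) (at (\<phi> u)) (\<phi>' h) + A (\<phi> u) (Y' h))) (at u)"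
proof -
  define D where "D w = frechet_derivative (\<lambda>v. A v w) (at (\<phi> u))" for w
  have D: "((\<lambda>v. A v w) has_derivative D w) (at (\<phi> u))" for w
    using diff[of w] by (simp add: D_def frechet_derivative_works)
  have "((\<lambda>v. \<Sum>b\<in>Basis. (Y u \<bullet> b) *\<^sub>R A v b) has_derivative (\<lambda>h. \<Sum>b\<in>Basis. (Y u \<bullet> b) *\<^sub>R D b h)) (at (\<phi> u))"
    by (auto intro!: derivative_eq_intros D)
  then have "((\<lambda>v. A v (Y u)) has_derivative (\<lambda>h. \<Sum>b\<in>Basis. (Y u \<bullet> b) *\<^sub>R D b h)) (at (\<phi> u))"
    by (rule has_derivative_transform_within_open[OF _ V]) (simp add: linear_expansion[OF lin, symmetric])
  \<comment> \<open>Here \<open>Y u\<close> is a constant vector, and uniqueness of the derivative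
    makes \<open>D\<close> additive over its expansion.\<close>
  then have DY: "D (Y u) h = (\<Sum>b\<in>Basis. (Y u \<bullet> b) *\<^sub>R D b h)" for h
    using has_derivative_unique[OF D[of "Y u"]] by metis
  have AY: "A (\<phi> u) (Y' h) = (\<Sum>b\<in>Basis. (Y' h \<bullet> b) *\<^sub>R A (\<phi> u) b)" for h
    by (rule linear_expansion[OF lin[OF V(2)]])
  have A\<phi>: "((\<lambda>t. A (\<phi> t) b) has_derivative (\<lambda>h. D b (\<phi>' h))) (at u)" for b
    using diff_chain_at[OF \<phi> D[of b]] by (simp add: o_def)
  have "((\<lambda>t. \<Sum>b\<in>Basis. (Y t \<bullet> b) *\<^sub>R A (\<phi> t) b) has_derivative
         (\<lambda>h. \<Sum>b\<in>Basis. (Y u \<bullet> b) *\<^sub>R D b (\<phi>' h) + (Y' h \<bullet> b) *\<^sub>R A (\<phi> u) b)) (at u)"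
    by (auto intro!: derivative_eq_intros A\<phi> Y)
  then have "((\<lambda>t. \<Sum>b\<in>Basis. (Y t \<bullet> b) *\<^sub>R A (\<phi> t) b) has_derivative
              (\<lambda>h. D (Y u) (\<phi>' h) + A (\<phi> u) (Y' h))) (at u)"
    by (simp add: DY AY sum.distrib)
  moreover have "\<forall>\<^sub>F t in nhds u. \<phi> t \<in> V"
    using has_derivative_continuous[OF \<phi>] V unfolding continuous_at_open
    by (metis eventually_nhds)
  then have "\<forall>\<^sub>F t in at u. (\<Sum>b\<in>Basis. (Y t \<bullet> b) *\<^sub>R A (\<phi> t) b) = A (\<phi> t) (Y t)"
    unfolding eventually_at_filter by eventually_elim (simp add: linear_expansion[OF lin, symmetric])
  ultimately show ?thesis
    unfolding D_def
    by (rule has_derivative_transform_eventually)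
       (simp_all add: linear_expansion[OF lin[OF V(2)], symmetric])
qed

text \<open>The linear rule is used twice: in the first argument with the second frozen, then in the
  second argument with \<open>B (\<phi> t) (X t)\<close> as the family. The latter is a family over
  \<open>U\<close> itself, which is why all of \<open>U\<close> has to be mapped into
  \<open>V\<close>.\<close>

lemma has_derivative_bilinear_family:
  fixes B :: "'v::euclidean_space \<Rightarrow> 'x::euclidean_space \<Rightarrow> 'y::euclidean_space \<Rightarrow> 'z::real_normed_vector"
    and \<phi> :: "'u::real_normed_vector \<Rightarrow> 'v"
  assumes U: "open U" "u \<in> U" and V: "open V" "\<phi> ` U \<subseteq> V"
    and bil: "\<And>v. v \<in> V \<Longrightarrow> bilinear (B v)"
    and diff: "\<And>x y. (\<lambda>v. B v x y) differentiable (at (\<phi> u))"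
    and \<phi>: "(\<phi> has_derivative \<phi>') (at u)"
    and X: "(X has_derivative X') (at u)" and Y: "(Y has_derivative Y') (at u)"
  shows "((\<lambda>t. B (\<phi> t) (X t) (Y t)) has_derivative
           (\<lambda>h. frechet_derivative (\<lambda>v. B v (X u) (Y u)) (at (\<phi> u)) (\<phi>' h)
              + B (\<phi> u) (X' h) (Y u) + B (\<phi> u) (X u) (Y' h))) (at u)"
proof -
  have \<phi>u: "\<phi> u \<in> V" using U V by auto
  have *: "((\<lambda>t. B (\<phi> t) (X t) y) has_derivative
           (\<lambda>h. frechet_derivative (\<lambda>v. B v (X u) y) (at (\<phi> u)) (\<phi>' h) + B (\<phi> u) (X' h) y)) (at u)" for y
    using bil by (intro has_derivative_linear_family[OF V(1) \<phi>u _ diff \<phi> X]) (simp add: bilinear_def)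
  have "((\<lambda>t. B (\<phi> t) (X t) (Y t)) has_derivative
           (\<lambda>h. frechet_derivative (\<lambda>t. B (\<phi> t) (X t) (Y u)) (at u) h + B (\<phi> u) (X u) (Y' h))) (at u)"
    using has_derivative_linear_family[of U "\<lambda>t. t" u "\<lambda>t. B (\<phi> t) (X t)" "\<lambda>h. h" Y Y'] U V bil * Y
    by (simp add: bilinear_def image_subset_iff differentiable_def) blast
  then show ?thesis
    by (simp add: frechet_derivative_at[OF *, symmetric])
qed

section \<open>Symmetry of second derivatives\<close>

text \<open>The second difference over the parallelogram with sides s x and s y. The mean value
  theorem in direction x, applied to the difference of f along two parallel edges, leaves a
  difference of first derivatives in direction y; a second application turns it into a mixed
  derivative.\<close>

lemma mean_value_second_difference:
  fixes f :: "'v::euclidean_space \<Rightarrow> real"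
  assumes "0 < s" and U: "\<And>a b. 0 \<le> a \<Longrightarrow> a \<le> s \<Longrightarrow> 0 \<le> b \<Longrightarrow> b \<le> s \<Longrightarrow> u + a *\<^sub>R x + b *\<^sub>R y \<in> U"
    and f: "\<And>u. u \<in> U \<Longrightarrow> f differentiable (at u)"
    and f': "\<And>u. u \<in> U \<Longrightarrow> (\<lambda>u. frechet_derivative f (at u) x) differentiable (at u)"
  shows "\<exists>a b. 0 < a \<and> a < s \<and> 0 < b \<and> b < s \<and>
     f (u + s *\<^sub>R x + s *\<^sub>R y) - f (u + s *\<^sub>R x) - f (u + s *\<^sub>R y) + f u =
     s * s * frechet_derivative (\<lambda>u. frechet_derivative f (at u) x) (at (u + a *\<^sub>R x + b *\<^sub>R y)) y"
proof -
  let ?D = "\<lambda>u. frechet_derivative f (at u) x"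
  let ?DD = "\<lambda>u. frechet_derivative ?D (at u) y"
  have dir: "((\<lambda>a. \<psi> (p + a *\<^sub>R z)) has_real_derivative frechet_derivative \<psi> (at (p + a *\<^sub>R z)) z) (at a)"
    if "\<psi> differentiable (at (p + a *\<^sub>R z))" for \<psi> :: "'v \<Rightarrow> real" and p a z
  proof -
    have \<psi>: "(\<psi> has_derivative frechet_derivative \<psi> (at (p + a *\<^sub>R z))) (at (p + a *\<^sub>R z))"
      using that by (simp add: frechet_derivative_works)
    have "((\<lambda>a. p + a *\<^sub>R z) has_derivative (\<lambda>h. h *\<^sub>R z)) (at a)"
      by (auto intro!: derivative_eq_intros)
    from has_derivative_imp_has_field_derivative[OF diff_chain_at[OF this \<psi>, unfolded o_def]]
    show ?thesis by (simp add: linear_scale[OF has_derivative_linear[OF \<psi>]])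
  qed
  have "\<exists>a. 0 < a \<and> a < s \<and> (f (u + s *\<^sub>R y + s *\<^sub>R x) - f (u + s *\<^sub>R x)) - (f (u + s *\<^sub>R y + 0 *\<^sub>R x) - f (u + 0 *\<^sub>R x))
      = (s - 0) * (?D (u + s *\<^sub>R y + a *\<^sub>R x) - ?D (u + a *\<^sub>R x))"
  proof (rule MVT2[OF \<open>0 < s\<close>])
    fix a assume "0 \<le> a" "a \<le> s"
    then have "f differentiable (at (u + s *\<^sub>R y + a *\<^sub>R x))" "f differentiable (at (u + a *\<^sub>R x))"
      using U[of a s] U[of a 0] \<open>0 < s\<close> by (auto intro!: f simp: algebra_simps)
    then show "((\<lambda>a. f (u + s *\<^sub>R y + a *\<^sub>R x) - f (u + a *\<^sub>R x)) has_real_derivative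
        ?D (u + s *\<^sub>R y + a *\<^sub>R x) - ?D (u + a *\<^sub>R x)) (at a)"
      by (intro DERIV_diff dir)
  qed
  then obtain a where a: "0 < a" "a < s"
    and 1: "f (u + s *\<^sub>R x + s *\<^sub>R y) - f (u + s *\<^sub>R x) - f (u + s *\<^sub>R y) + f u
      = s * (?D (u + a *\<^sub>R x + s *\<^sub>R y) - ?D (u + a *\<^sub>R x))"
    by (auto simp: algebra_simps)
  have "\<exists>b. 0 < b \<and> b < s \<and> ?D (u + a *\<^sub>R x + s *\<^sub>R y) - ?D (u + a *\<^sub>R x + 0 *\<^sub>R y)
     = (s - 0) * ?DD (u + a *\<^sub>R x + b *\<^sub>R y)"
  proof (rule MVT2[OF \<open>0 < s\<close>])
    fix b assume "0 \<le> b" "b \<le> s"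
    then have "?D differentiable (at (u + a *\<^sub>R x + b *\<^sub>R y))"
      using U[of a b] a by (auto intro!: f')
    then show "((\<lambda>b. ?D (u + a *\<^sub>R x + b *\<^sub>R y)) has_real_derivative ?DD (u + a *\<^sub>R x + b *\<^sub>R y)) (at b)"
      by (rule dir)
  qed
  then obtain b where b: "0 < b" "b < s"
    and 2: "?D (u + a *\<^sub>R x + s *\<^sub>R y) - ?D (u + a *\<^sub>R x) = s * ?DD (u + a *\<^sub>R x + b *\<^sub>R y)"
    by auto
  show ?thesis using a b 1 unfolding 2 by (auto simp: mult.assoc)
qed

text \<open>The second difference is unchanged when x and y are exchanged, so the two mixed
  derivatives take a common value at points arbitrarily close to u. With e half of the supposed gap,
  this contradicts their continuity.\<close>

lemma second_derivative_symmetric_real: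
  fixes f :: "'v::euclidean_space \<Rightarrow> real"
  assumes "open U" "u \<in> U" "smooth_on U f"
  shows "frechet_derivative (\<lambda>u. frechet_derivative f (at u) x) (at u) y
       = frechet_derivative (\<lambda>u. frechet_derivative f (at u) y) (at u) x"
proof (rule ccontr)
  let ?D = "\<lambda>x y u. frechet_derivative (\<lambda>u. frechet_derivative f (at u) x) (at u) y"
  assume ne: "?D x y u \<noteq> ?D y x u"
  define e where "e = \<bar>?D x y u - ?D y x u\<bar> / 2"
  have e: "e > 0" using ne by (simp add: e_def)
  have cont: "continuous (at u) (?D x y)" for x y
    using smooth_on_frechet_derivative[OF smooth_on_frechet_derivative[OF assms(3)], THEN smooth_on_continuous_on]
      assms(1,2) continuous_on_eq_continuous_at by blast
  obtain d1 where d1: "d1 > 0" "\<And>v. dist v u < d1 \<Longrightarrow> dist (?D x y v) (?D x y u) < e"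
    using cont[of x y] e unfolding continuous_at_eps_delta by metis
  obtain d2 where d2: "d2 > 0" "\<And>v. dist v u < d2 \<Longrightarrow> dist (?D y x v) (?D y x u) < e"
    using cont[of y x] e unfolding continuous_at_eps_delta by metis
  obtain d3 where d3: "d3 > 0" "ball u d3 \<subseteq> U"
    using assms open_contains_ball by blast
  define d where "d = min d1 (min d2 d3)"
  \<comment> \<open>The summand 1 keeps the denominator positive when x = y = 0 and makes the bound
    in \<open>small\<close> strict.\<close>
  define s where "s = d / (norm x + norm y + 1)"
  have d: "d > 0" using d1 d2 d3 by (simp add: d_def)
  have s: "s > 0" unfolding s_def using d by (simp add: add_nonneg_pos)
  have small: "dist (u + a *\<^sub>R x + b *\<^sub>R y) u < d" if "0 \<le> a" "a \<le> s" "0 \<le> b" "b \<le> s" for a b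
  proof -
    have "dist (u + a *\<^sub>R x + b *\<^sub>R y) u = norm (a *\<^sub>R x + b *\<^sub>R y)" by (simp add: dist_norm algebra_simps)
    also have "\<dots> \<le> a * norm x + b * norm y" using that norm_triangle_ineq[of "a *\<^sub>R x" "b *\<^sub>R y"] by simp
    also have "\<dots> \<le> s * norm x + s * norm y" using that by (intro add_mono mult_right_mono) auto
    also have "\<dots> < s * (norm x + norm y + 1)" using s by (simp add: algebra_simps)
    also have "\<dots> = d" unfolding s_def by (simp add: add_nonneg_pos less_imp_neq[symmetric])
    finally show ?thesis .
  qed
  have inU: "u + a *\<^sub>R x + b *\<^sub>R y \<in> U" if "0 \<le> a" "a \<le> s" "0 \<le> b" "b \<le> s" for a b
    using small[OF that] d3 by (auto simp: d_def dist_commute subset_iff)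
  have inU': "u + a *\<^sub>R y + b *\<^sub>R x \<in> U" if "0 \<le> a" "a \<le> s" "0 \<le> b" "b \<le> s" for a b
    using inU[of b a] that by (simp add: algebra_simps)
  note diff = smooth_on_differentiable[OF assms(3)]
    smooth_on_differentiable[OF smooth_on_frechet_derivative[OF assms(3)]]
  obtain a b where ab: "0 < a" "a < s" "0 < b" "b < s" and 1:
    "f (u + s *\<^sub>R x + s *\<^sub>R y) - f (u + s *\<^sub>R x) - f (u + s *\<^sub>R y) + f u = s * s * ?D x y (u + a *\<^sub>R x + b *\<^sub>R y)"
    using mean_value_second_difference[OF s inU diff] by blast
  obtain a' b' where ab': "0 < a'" "a' < s" "0 < b'" "b' < s" and 2:
    "f (u + s *\<^sub>R y + s *\<^sub>R x) - f (u + s *\<^sub>R y) - f (u + s *\<^sub>R x) + f u = s * s * ?D y x (u + a' *\<^sub>R y + b' *\<^sub>R x)"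
    using mean_value_second_difference[OF s inU' diff] by blast
  have "s * s * ?D x y (u + a *\<^sub>R x + b *\<^sub>R y) = s * s * ?D y x (u + a' *\<^sub>R y + b' *\<^sub>R x)"
    using 1 2 by (simp add: algebra_simps)
  then have eq: "?D x y (u + a *\<^sub>R x + b *\<^sub>R y) = ?D y x (u + b' *\<^sub>R x + a' *\<^sub>R y)"
    using s by (simp add: algebra_simps)
  have "dist (?D x y (u + a *\<^sub>R x + b *\<^sub>R y)) (?D x y u) < e"
    using small[of a b] ab by (intro d1) (auto simp: d_def)
  moreover have "dist (?D y x (u + b' *\<^sub>R x + a' *\<^sub>R y)) (?D y x u) < e"
    using small[of b' a'] ab' by (intro d2) (auto simp: d_def)
  ultimately show False unfolding eq e_def dist_real_def by argo
qed

lemma second_derivative_symmetric: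
  fixes f :: "'v::euclidean_space \<Rightarrow> 'w::euclidean_space"
  assumes "open U" "u \<in> U" "smooth_on U f"
  shows "frechet_derivative (\<lambda>u. frechet_derivative f (at u) x) (at u) y
       = frechet_derivative (\<lambda>u. frechet_derivative f (at u) y) (at u) x"
proof (rule euclidean_eqI)
  fix b :: 'w assume "b \<in> Basis"
  have *: "frechet_derivative (\<lambda>u. \<phi> u \<bullet> b) (at u) x = frechet_derivative \<phi> (at u) x \<bullet> b"
    if "\<phi> differentiable (at u)" for \<phi> :: "'v \<Rightarrow> 'w" and u x
  proof -
    have "((\<lambda>u. \<phi> u \<bullet> b) has_derivative (\<lambda>x. frechet_derivative \<phi> (at u) x \<bullet> b)) (at u)"
      using that by (auto intro!: derivative_eq_intros simp: frechet_derivative_works)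
    then show ?thesis by (simp add: frechet_derivative_at[symmetric])
  qed
  \<comment> \<open>The formula for the derivative of a component is available only on
    \<open>U\<close>, where the function is differentiable. The induction therefore needs that
    \<open>Ck_on\<close> depends only on values on the open set.\<close>
  have cong: "Ck_on k U \<phi> = Ck_on k U \<psi>" if "\<And>u. u \<in> U \<Longrightarrow> \<phi> u = \<psi> u" for k and \<phi> \<psi> :: "'v \<Rightarrow> real"
    using that
  proof (induction k arbitrary: \<phi> \<psi>)
    case 0 then show ?case by (simp cong: continuous_on_cong)
  next
    case (Suc k)
    have d: "(\<phi> has_derivative D) (at x) \<longleftrightarrow> (\<psi> has_derivative D) (at x)" if "x \<in> U" for x D
      using has_derivative_transform_within_open[OF _ assms(1) that] Suc.prems by metis
    then have "frechet_derivative \<phi> (at x) = frechet_derivative \<psi> (at x)" if "x \<in> U" for x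
      using that by (simp add: frechet_derivative_def)
    then have "Ck_on k U (\<lambda>x. frechet_derivative \<phi> (at x) v) = Ck_on k U (\<lambda>x. frechet_derivative \<psi> (at x) v)" for v
      by (intro Suc.IH) simp
    then show ?case using d by (simp add: differentiable_def)
  qed
  have "Ck_on k U (\<lambda>u. \<phi> u \<bullet> b)" if "Ck_on k U \<phi>" for k and \<phi> :: "'v \<Rightarrow> 'w"
    using that
  proof (induction k arbitrary: \<phi>)
    case 0 then show ?case by (auto intro: continuous_intros)
  next
    case (Suc k)
    have "Ck_on k U (\<lambda>x. frechet_derivative (\<lambda>u. \<phi> u \<bullet> b) (at x) v)" for v
      using Suc by (subst cong[where \<psi>="\<lambda>x. frechet_derivative \<phi> (at x) v \<bullet> b"]) (auto intro!: *)
    then show ?case using Suc.prems by simp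
  qed
  then have sm: "smooth_on U (\<lambda>u. f u \<bullet> b)" using assms(3) by (simp add: smooth_on_def)
  have "frechet_derivative (\<lambda>u. frechet_derivative f (at u) x) (at u) y \<bullet> b
      = frechet_derivative (\<lambda>u. frechet_derivative (\<lambda>u. f u \<bullet> b) (at u) x) (at u) y" for x y
  proof -
    have "frechet_derivative (\<lambda>u. frechet_derivative f (at u) x) (at u) y \<bullet> b
      = frechet_derivative (\<lambda>u. frechet_derivative f (at u) x \<bullet> b) (at u) y"
      using * smooth_on_differentiable[OF smooth_on_frechet_derivative[OF assms(3)] assms(2)] by metis
    also have "\<dots> = frechet_derivative (\<lambda>u. frechet_derivative (\<lambda>u. f u \<bullet> b) (at u) x) (at u) y"
    proof (rule arg_cong[where f="\<lambda>D. D y"], rule frechet_derivative_transform_within_open[OF _ assms(1,2)])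
      have "(\<lambda>u. frechet_derivative f (at u) x) differentiable at u"
        by (rule smooth_on_differentiable[OF smooth_on_frechet_derivative[OF assms(3)] assms(2)])
      then show "(\<lambda>u. frechet_derivative f (at u) x \<bullet> b) differentiable at u" by simp
    qed (simp add: * smooth_on_differentiable[OF assms(3)])
    finally show ?thesis .
  qed
  then show "frechet_derivative (\<lambda>u. frechet_derivative f (at u) x) (at u) y \<bullet> b
       = frechet_derivative (\<lambda>u. frechet_derivative f (at u) y) (at u) x \<bullet> b"
    using second_derivative_symmetric_real[OF assms(1,2) sm] by simp
qed

section \<open>Linear algebra of bilinear forms and determinants\<close>

text \<open>The contraction \<open>b^PQ t_PQ\<close>, with the sums arranged as in
  \<open>aligned\<close>.\<close>

definition metric_trace :: "(real ^ 'k \<Rightarrow> real ^ 'k \<Rightarrow> real) \<Rightarrow> (real ^ 'k \<Rightarrow> real ^ 'k \<Rightarrow> real) \<Rightarrow> real" where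
  "metric_trace b t = (\<Sum>r\<in>UNIV. \<Sum>s\<in>UNIV. matrix_inv (gram b) $ r $ s * t (axis r 1) (axis s 1))"

lemma matrix_inv_eqI:
  fixes A :: "real ^ 'k::finite ^ 'k"
  assumes "A ** B = mat 1"
  shows "matrix_inv A = B"
proof -
  have BA: "B ** A = mat 1" using assms by (simp add: matrix_left_right_inverse)
  have "matrix_inv A ** A = mat 1"
    unfolding matrix_inv_def by (rule someI2[of _ B]) (simp_all add: assms BA)
  then have "matrix_inv A ** (A ** B) = B" by (simp add: matrix_mul_assoc)
  then show ?thesis by (simp add: assms)
qed

lemma matrix_inv_mult:
  fixes A :: "real ^ 'k::finite ^ 'k"
  assumes "invertible A"
  shows "matrix_inv A ** A = mat 1" and "A ** matrix_inv A = mat 1"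
proof -
  obtain B where B: "A ** B = mat 1" using assms by (auto simp: invertible_def)
  then show "matrix_inv A ** A = mat 1" "A ** matrix_inv A = mat 1"
    by (auto simp: matrix_inv_eqI[OF B] matrix_left_right_inverse)
qed

lemma bilinear_gram_right:
  assumes "bilinear b"
  shows "b (x :: real ^ 'k::finite) (axis s 1) = (\<Sum>k\<in>UNIV. x $ k * gram b $ k $ s)"
proof -
  have "linear (\<lambda>x. b x (axis s 1))" using assms by (simp add: bilinear_def)
  then have "b (\<Sum>k\<in>UNIV. x $ k *\<^sub>R axis k 1) (axis s 1) = (\<Sum>k\<in>UNIV. x $ k *\<^sub>R b (axis k 1) (axis s 1))"
    by (simp add: linear_sum[of "\<lambda>x. b x (axis s 1)"] linear_scale[of "\<lambda>x. b x (axis s 1)"])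
  then show ?thesis
    by (simp add: gram_def basis_expansion[of x, unfolded scalar_mult_eq_scaleR])
qed

lemma gram_symmetric:
  assumes "\<And>x y. b x y = b y x"
  shows "transpose (gram b) = gram b"
  by (simp add: gram_def transpose_def vec_eq_iff assms)

lemma invertible_gram:
  fixes b :: "real ^ 'k::finite \<Rightarrow> real ^ 'k \<Rightarrow> real"
  assumes b: "bilinear b" and nd: "nondegenerate_form b"
  shows "invertible (gram b)"
proof -
  have "x = 0" if "transpose (gram b) *v x = 0" for x
  proof -
    have "b x (axis s 1) = 0" for s
      using that by (simp add: bilinear_gram_right[OF b] vec_eq_iff matrix_vector_mult_def transpose_def mult.commute)
    moreover have "linear (b x)" using b by (simp add: bilinear_def)
    ultimately have "b x y = 0" for y
      by (subst linear_expansion[OF \<open>linear (b x)\<close>, of y]) (auto simp: Basis_vec_def intro!: sum.neutral)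
    then show ?thesis using nd by (simp add: nondegenerate_form_def)
  qed
  then have "invertible (transpose (gram b))"
    by (simp add: invertible_left_inverse matrix_left_invertible_ker)
  then show ?thesis using transpose_invertible transpose_transpose by metis
qed

text \<open>Lowering an index with \<open>b\<close> and contracting with its inverse cancel, leaving
  an ordinary trace. The maps used later are the identity, \<open>con u x\<close> and maps of rank
  one.\<close>

lemma metric_trace_left:
  fixes b :: "real ^ 'k::finite \<Rightarrow> real ^ 'k \<Rightarrow> real"
  assumes b: "bilinear b" and inv: "invertible (gram b)" and sym: "\<And>x y. b x y = b y x"
  shows "metric_trace b (\<lambda>x y. b (A x) y) = (\<Sum>i\<in>UNIV. A (axis i 1) $ i)"
proof -
  let ?G = "gram b" and ?I = "matrix_inv (gram b)"
  have "(\<Sum>s\<in>UNIV. ?I $ r $ s * b (A (axis r 1)) (axis s 1)) = A (axis r 1) $ r" for r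
  proof -
    have "(\<Sum>s\<in>UNIV. ?I $ r $ s * b (A (axis r 1)) (axis s 1))
        = (\<Sum>k\<in>UNIV. A (axis r 1) $ k * (\<Sum>s\<in>UNIV. ?I $ r $ s * ?G $ s $ k))"
      unfolding bilinear_gram_right[OF b] sum_distrib_left
      by (subst sum.swap) (simp add: gram_def sym mult.left_commute)
    also have "\<dots> = (\<Sum>k\<in>UNIV. A (axis r 1) $ k * (mat 1 :: real^'k^'k) $ r $ k)"
      unfolding matrix_inv_mult(1)[OF inv, symmetric] by (simp add: matrix_matrix_mult_def)
    also have "\<dots> = A (axis r 1) $ r" by (simp add: mat_def if_distrib sum.delta' cong: if_cong)
    finally show ?thesis .
  qed
  then show ?thesis by (simp add: metric_trace_def)
qed

text \<open>The inverse of a symmetric Gram matrix is symmetric.\<close>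

lemma metric_trace_swap:
  fixes b :: "real ^ 'k::finite \<Rightarrow> real ^ 'k \<Rightarrow> real"
  assumes inv: "invertible (gram b)" and sym: "\<And>x y. b x y = b y x"
  shows "metric_trace b (\<lambda>x y. t y x) = metric_trace b t"
proof -
  have "gram b ** transpose (matrix_inv (gram b)) = transpose (matrix_inv (gram b) ** gram b)"
    by (simp add: matrix_transpose_mul gram_symmetric[OF sym])
  also have "\<dots> = mat 1" by (simp add: matrix_inv_mult(1)[OF inv] transpose_mat)
  finally have "matrix_inv (gram b) = transpose (matrix_inv (gram b))" by (rule matrix_inv_eqI)
  from arg_cong[OF this, of "\<lambda>A. A $ r $ s" for r s]
  have "matrix_inv (gram b) $ r $ s = matrix_inv (gram b) $ s $ r" for r s
    by (simp add: transpose_def)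
  then show ?thesis
    unfolding metric_trace_def by (subst sum.swap) simp
qed

lemma metric_trace_right:
  fixes b :: "real ^ 'k::finite \<Rightarrow> real ^ 'k \<Rightarrow> real"
  assumes "bilinear b" and "invertible (gram b)" and sym: "\<And>x y. b x y = b y x"
  shows "metric_trace b (\<lambda>x y. b x (A y)) = (\<Sum>i\<in>UNIV. A (axis i 1) $ i)"
  using metric_trace_swap[of b "\<lambda>x y. b x (A y)"] metric_trace_left[of b A] assms by simp

lemma metric_trace_add: "metric_trace b (\<lambda>x y. s x y + t x y) = metric_trace b s + metric_trace b t"
  by (simp add: metric_trace_def algebra_simps sum.distrib)

lemma metric_trace_diff: "metric_trace b (\<lambda>x y. s x y - t x y) = metric_trace b s - metric_trace b t"
  by (simp add: metric_trace_def algebra_simps sum_subtractf)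

lemma metric_trace_scale: "metric_trace b (\<lambda>x y. c * t x y) = c * metric_trace b t"
  by (simp add: metric_trace_def sum_distrib_left mult.left_commute)

lemma metric_trace_cong:
  assumes "\<And>x y. s x y = t x y"
  shows "metric_trace b s = metric_trace b t"
  by (simp add: metric_trace_def assms)

lemma metric_trace_scale_metric:
  assumes inv: "invertible (gram b)" and "c \<noteq> 0"
  shows "metric_trace (\<lambda>x y. b x y / c) t = c * metric_trace b t"
proof -
  have "gram (\<lambda>x y. b x y / c) ** (c *\<^sub>R matrix_inv (gram b)) = gram b ** matrix_inv (gram b)"
    using \<open>c \<noteq> 0\<close> by (simp add: gram_def matrix_matrix_mult_def vec_eq_iff)
  then have "matrix_inv (gram (\<lambda>x y. b x y / c)) = c *\<^sub>R matrix_inv (gram b)"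
    by (intro matrix_inv_eqI) (simp add: matrix_inv_mult(2)[OF inv])
  then show ?thesis by (simp add: metric_trace_def sum_distrib_left mult.assoc)
qed

section \<open>Determinants and their derivatives\<close>

text \<open>Cramer's rule for rows: expand w in the rows of A. Only the coefficient of row k
  survives in the determinant, and it is the k-th entry of w times the inverse.\<close>

lemma det_replace_row:
  fixes A :: "real ^ 'k::finite ^ 'k"
  assumes "invertible A"
  shows "det (\<chi> i. if i = k then w else A $ i) = (\<Sum>j\<in>UNIV. w $ j * matrix_inv A $ j $ k) * det A"
proof -
  have "w = (w v* matrix_inv A) v* A"
    by (simp add: vector_matrix_mul_assoc matrix_inv_mult[OF assms])
  also have "\<dots> = (\<Sum>i\<in>UNIV. (w v* matrix_inv A) $ i *s row i A)"
    by (simp add: vec_eq_iff vector_matrix_mult_def row_def mult.commute)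
  finally have w: "w = (\<Sum>i\<in>UNIV. (w v* matrix_inv A) $ i *s row i A)" .
  have rows: "row i A = A $ i" for i by (simp add: row_def)
  have "det (\<chi> i. if i = k then w else A $ i)
      = det (\<chi> i. if i = k then (\<Sum>i\<in>UNIV. (w v* matrix_inv A) $ i *s row i A) else row i A)"
    by (subst w) (simp add: rows cong: if_cong)
  also have "\<dots> = (w v* matrix_inv A) $ k * det A" by (rule cramer_lemma_transpose)
  finally show ?thesis by (simp add: vector_matrix_mult_def mult.commute)
qed

text \<open>Jacobi's formula. Differentiating the Leibniz expansion hits one row at a time, and each
  resulting determinant is evaluated by \<open>det_replace_row\<close>.\<close>

lemma has_derivative_det:
  fixes A :: "'u::real_normed_vector \<Rightarrow> real ^ 'k::finite ^ 'k"
  assumes A: "\<And>i j. ((\<lambda>u. A u $ i $ j) has_derivative A' i j) (at u)" and inv: "invertible (A u)"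
  shows "((\<lambda>u. det (A u)) has_derivative
          (\<lambda>h. det (A u) * (\<Sum>i\<in>UNIV. \<Sum>j\<in>UNIV. matrix_inv (A u) $ i $ j * A' j i h))) (at u)"
proof -
  have deriv: "((\<lambda>u. det (A u)) has_derivative
    (\<lambda>h. \<Sum>p | p permutes UNIV. of_int (sign p) * (\<Sum>i\<in>UNIV. A' i (p i) h * (\<Prod>j\<in>UNIV - {i}. A u $ j $ p j)))) (at u)"
    unfolding det_def by (intro has_derivative_sum has_derivative_mult_right has_derivative_prod A)
  have "(\<lambda>h. \<Sum>p | p permutes UNIV. of_int (sign p) * (\<Sum>i\<in>UNIV. A' i (p i) h * (\<Prod>j\<in>UNIV - {i}. A u $ j $ p j)))
     = (\<lambda>h. \<Sum>i\<in>UNIV. det (\<chi> k. if k = i then (\<chi> l. A' i l h) else A u $ k))"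
  proof
    fix h
    have "A' i (p i) h * (\<Prod>j\<in>UNIV - {i}. A u $ j $ p j)
        = (\<Prod>k\<in>UNIV. (\<chi> k. if k = i then (\<chi> l. A' i l h) else A u $ k) $ k $ p k)" for i and p :: "'k \<Rightarrow> 'k"
      by (subst prod.remove[of UNIV i]) (auto intro!: prod.cong)
    then show "(\<Sum>p | p permutes UNIV. of_int (sign p) * (\<Sum>i\<in>UNIV. A' i (p i) h * (\<Prod>j\<in>UNIV - {i}. A u $ j $ p j)))
      = (\<Sum>i\<in>UNIV. det (\<chi> k. if k = i then (\<chi> l. A' i l h) else A u $ k))"
      unfolding det_def sum_distrib_left by (subst sum.swap) simp
  qed
  also have "\<dots> = (\<lambda>h. det (A u) * (\<Sum>i\<in>UNIV. \<Sum>j\<in>UNIV. matrix_inv (A u) $ i $ j * A' j i h))"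
    unfolding det_replace_row[OF inv]
    by (rule ext, simp only: sum_distrib_left sum_distrib_right, subst sum.swap) (simp add: mult_ac)
  finally show ?thesis by (rule has_derivative_eq_rhs[OF deriv])
qed

text \<open>Expansion along the row \<open>None\<close>: permutations that move \<open>None\<close>
  meet a zero entry, and those that fix it are the permutations of the other indices. It serves for
  the Gram matrix of a frame in which \<open>None\<close> labels the normal.\<close>

lemma det_option:
  fixes B :: "real ^ 'k::finite option ^ 'k option"
  assumes B: "\<And>j. B $ None $ Some j = 0"
  shows "det B = B $ None $ None * det (\<chi> i j. B $ Some i $ Some j)"
proof -
  let ?P = "{p. p permutes (UNIV :: 'k option set)}"
  let ?t = "\<lambda>p. of_int (sign p) * (\<Prod>i\<in>UNIV. B $ i $ p i)"
  have split: "(\<Prod>i\<in>UNIV. B $ i $ p i) = B $ None $ p None * (\<Prod>i\<in>UNIV. B $ Some i $ p (Some i))" for p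
    unfolding UNIV_option_conv by (subst prod.insert) (auto simp: prod.reindex)
  have "det B = (\<Sum>p\<in>{p \<in> ?P. p None = None}. ?t p)"
    unfolding det_def
  proof (rule sum.mono_neutral_right)
    show "\<forall>p\<in>?P - {p \<in> ?P. p None = None}. ?t p = 0"
    proof
      fix p assume "p \<in> ?P - {p \<in> ?P. p None = None}"
      then obtain j where "p None = Some j" by auto
      then show "?t p = 0" by (simp add: split B)
    qed
  qed auto
  also have "\<dots> = (\<Sum>q | q permutes (UNIV :: 'k set). B $ None $ None * (of_int (sign q) * (\<Prod>i\<in>UNIV. B $ Some i $ Some (q i))))"
  proof (rule sum.reindex_bij_witness[where i = map_option and j = "\<lambda>p i. the (p (Some i))"])
    fix p assume p: "p \<in> {p \<in> ?P. p None = None}"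
    then have bij: "bij p" and N: "p None = None" by (auto simp: permutes_bij)
    have S: "Some (the (p (Some i))) = p (Some i)" for i
    proof -
      have "p (Some i) \<noteq> p None" using bij_is_inj[OF bij] by (simp add: inj_eq)
      then show ?thesis using N by auto
    qed
    then show "map_option (\<lambda>i. the (p (Some i))) = p"
      using N by (intro ext) (case_tac x; simp)
    have "bij (\<lambda>i. the (p (Some i)))"
    proof (rule bijI')
      show "the (p (Some x)) = the (p (Some y)) \<longleftrightarrow> x = y" for x y
        using inj_eq[OF bij_is_inj[OF bij], of "Some x" "Some y"] S[of x] S[of y] by (metis option.inject)
      show "\<exists>x. y = the (p (Some x))" for y
      proof -
        obtain z where "Some y = p z" using bij_is_surj[OF bij] by (meson surjD)
        then show ?thesis using N by (cases z) (auto intro!: exI[of _ "the z"] dest: sym)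
      qed
    qed
    then show q: "(\<lambda>i. the (p (Some i))) \<in> {q. q permutes UNIV}" by (auto intro: bij_imp_permutes)
    \<comment> \<open>Recognising p as the transport of its restriction along the injection
      \<open>Some\<close> gives the equality of signs.\<close>
    have "map_permutation UNIV Some (\<lambda>i. the (p (Some i))) = p"
    proof
      fix x show "map_permutation UNIV Some (\<lambda>i. the (p (Some i))) x = p x"
        using S N by (cases x) (auto simp: map_permutation_def restrict_id_def)
    qed
    then have "sign p = sign (\<lambda>i. the (p (Some i)))"
      using sign_map_permutation[of Some UNIV "\<lambda>i. the (p (Some i))"] q by simp
    then show "B $ None $ None * (of_int (sign (\<lambda>i. the (p (Some i)))) * (\<Prod>i\<in>UNIV. B $ Some i $ Some (the (p (Some i))))) = ?t p"
      by (simp add: split S N)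
  next
    fix q :: "'k \<Rightarrow> 'k" assume "q \<in> {q. q permutes UNIV}"
    then have "bij q" by (simp add: permutes_bij)
    then have "q (inv q x) = x" "inv q (q x) = x" for x
      by (simp_all add: bij_is_surj surj_f_inv_f bij_is_inj)
    then have "bij (map_option q)"
      by (intro o_bij[of "map_option (inv q)"]) (simp_all add: fun_eq_iff option.map_comp o_def option.map_ident)
    then show "map_option q \<in> {p \<in> ?P. p None = None}" by (auto intro: bij_imp_permutes)
  qed simp
  finally show ?thesis by (simp add: det_def sum_distrib_left)
qed

section \<open>Geometry of a hypersurface in coordinates\<close>

text \<open>Charts are eliminated here: \<open>f\<close> stands for the immersion in coordinates,
  \<open>g\<close> and \<open>\<Gamma>\<close> for coordinate expressions on an open set. The locale
  holds the calculus of vector fields along a map; the hypersurface is added afterwards.\<close>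

locale metric_patch =
  fixes U :: "'u::euclidean_space set" and V :: "'v::euclidean_space set"
    and f :: "'u \<Rightarrow> 'v" and g :: "'v \<Rightarrow> 'v \<Rightarrow> 'v \<Rightarrow> real" and \<Gamma> :: "'v \<Rightarrow> 'v \<Rightarrow> 'v \<Rightarrow> 'v"
  assumes open_U: "open U" and open_V: "open V" and f_in: "f ` U \<subseteq> V" and smooth_f: "smooth_on U f"
    and smooth_\<Gamma>: "\<And>x y. smooth_on V (\<lambda>v. \<Gamma> v x y)"
    and bilinear_\<Gamma>: "\<And>v. v \<in> V \<Longrightarrow> bilinear (\<Gamma> v)"
    and sym_\<Gamma>: "\<And>v x y. v \<in> V \<Longrightarrow> \<Gamma> v x y = \<Gamma> v y x"
    and smooth_g: "\<And>x y. smooth_on V (\<lambda>v. g v x y)"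
    and bilinear_g: "\<And>v. v \<in> V \<Longrightarrow> bilinear (g v)"
    and sym_g: "\<And>v x y. v \<in> V \<Longrightarrow> g v x y = g v y x"
    and parallel_g: "\<And>v x y z. v \<in> V \<Longrightarrow>
      frechet_derivative (\<lambda>v. g v y z) (at v) x = g v (\<Gamma> v x y) z + g v y (\<Gamma> v x z)"
begin

abbreviation L :: "'u \<Rightarrow> 'u \<Rightarrow> 'v" where
  "L u \<equiv> frechet_derivative f (at u)"

text \<open>The connection pulled back along \<open>f\<close>, acting on vector fields along
  \<open>f\<close>.\<close>

definition D :: "('u \<Rightarrow> 'v) \<Rightarrow> 'u \<Rightarrow> 'u \<Rightarrow> 'v" where
  "D Z u x = frechet_derivative Z (at u) x + \<Gamma> (f u) (L u x) (Z u)"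

definition R :: "'v \<Rightarrow> 'v \<Rightarrow> 'v \<Rightarrow> 'v \<Rightarrow> 'v" where
  "R v x y z = frechet_derivative (\<lambda>v. \<Gamma> v y z) (at v) x + \<Gamma> v x (\<Gamma> v y z)
     - (frechet_derivative (\<lambda>v. \<Gamma> v x z) (at v) y + \<Gamma> v y (\<Gamma> v x z))"

lemma f_V: "u \<in> U \<Longrightarrow> f u \<in> V"
  using f_in by auto

lemma has_derivative_f: "u \<in> U \<Longrightarrow> (f has_derivative L u) (at u)"
  by (rule smooth_on_has_derivative[OF smooth_f])

lemma linear_L: "u \<in> U \<Longrightarrow> linear (L u)"
  using has_derivative_f has_derivative_linear by blast

lemma smooth_L: "smooth_on U (\<lambda>u. L u y)"
  by (rule smooth_on_frechet_derivative[OF smooth_f])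

lemma g_add: "v \<in> V \<Longrightarrow> g v (x + y) z = g v x z + g v y z" "v \<in> V \<Longrightarrow> g v z (x + y) = g v z x + g v z y"
  using bilinear_g by (auto simp: bilinear_ladd bilinear_radd)

lemma g_scale: "v \<in> V \<Longrightarrow> g v (c *\<^sub>R x) z = c * g v x z" "v \<in> V \<Longrightarrow> g v z (c *\<^sub>R x) = c * g v z x"
  using bilinear_g by (auto simp: bilinear_lmul bilinear_rmul)

lemma g_minus: "v \<in> V \<Longrightarrow> g v (- x) z = - g v x z" "v \<in> V \<Longrightarrow> g v z (- x) = - g v z x"
  using bilinear_g by (auto simp: bilinear_lneg bilinear_rneg)

lemma linear_D: "u \<in> U \<Longrightarrow> Z differentiable (at u) \<Longrightarrow> linear (D Z u)"
proof -
  assume u: "u \<in> U" and Z: "Z differentiable (at u)"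
  have "linear (frechet_derivative Z (at u))"
    using Z has_derivative_linear frechet_derivative_works by blast
  moreover have "linear (\<lambda>x. \<Gamma> (f u) x (Z u))"
    using bilinear_\<Gamma>[OF f_V[OF u]] by (simp add: bilinear_def)
  then have "linear (\<lambda>x. \<Gamma> (f u) (L u x) (Z u))"
    using linear_compose[OF linear_L[OF u]] by (simp add: o_def)
  ultimately show ?thesis
    unfolding D_def[abs_def] by (rule linear_compose_add)
qed

lemma has_derivative_D:
  assumes u: "u \<in> U" and Z: "smooth_on U Z"
  shows "((\<lambda>u. D Z u y) has_derivative
    (\<lambda>x. frechet_derivative (\<lambda>u. frechet_derivative Z (at u) y) (at u) x
       + (frechet_derivative (\<lambda>v. \<Gamma> v (L u y) (Z u)) (at (f u)) (L u x)
       + \<Gamma> (f u) (frechet_derivative (\<lambda>u. L u y) (at u) x) (Z u)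
       + \<Gamma> (f u) (L u y) (frechet_derivative Z (at u) x)))) (at u)"
  unfolding D_def
proof (rule has_derivative_add)
  show "((\<lambda>u. frechet_derivative Z (at u) y) has_derivative
      frechet_derivative (\<lambda>u. frechet_derivative Z (at u) y) (at u)) (at u)"
    by (rule smooth_on_has_derivative[OF smooth_on_frechet_derivative[OF Z] u])
  show "((\<lambda>u. \<Gamma> (f u) (L u y) (Z u)) has_derivative
      (\<lambda>x. frechet_derivative (\<lambda>v. \<Gamma> v (L u y) (Z u)) (at (f u)) (L u x)
       + \<Gamma> (f u) (frechet_derivative (\<lambda>u. L u y) (at u) x) (Z u)
       + \<Gamma> (f u) (L u y) (frechet_derivative Z (at u) x))) (at u)"
    by (rule has_derivative_bilinear_family[OF open_U u open_V f_in bilinear_\<Gamma>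
          smooth_on_differentiable[OF smooth_\<Gamma> f_V[OF u]] has_derivative_f[OF u]
          smooth_on_has_derivative[OF smooth_L u] smooth_on_has_derivative[OF Z u]])
qed

lemma differentiable_D: "u \<in> U \<Longrightarrow> smooth_on U Z \<Longrightarrow> (\<lambda>u. D Z u y) differentiable (at u)"
  using has_derivative_D differentiableI by blast

text \<open>The pulled-back connection has no torsion: the derivative part is symmetric by equality
  of mixed derivatives, the Christoffel part by \<open>sym_\<Gamma>\<close>. This is the source of
  the symmetry of \<open>h\<close> and \<open>con\<close>.\<close>

lemma D_L_sym: "u \<in> U \<Longrightarrow> D (\<lambda>u. L u y) u x = D (\<lambda>u. L u x) u y"
  unfolding D_def using second_derivative_symmetric[OF open_U _ smooth_f] sym_\<Gamma>[OF f_V] by simp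

text \<open>\<open>parallel_g\<close> trades the derivative of the coefficients of \<open>g\<close>
  for Christoffel terms, which complete the derivatives of X and Y to \<open>D X\<close> and
  \<open>D Y\<close>. The derivatives of \<open>\<epsilon>\<close>, \<open>m\<close>,
  \<open>h\<close> and \<open>a\<close> all come from this rule.\<close>

lemma has_derivative_g:
  assumes u: "u \<in> U" and X: "X differentiable (at u)" and Y: "Y differentiable (at u)"
  shows "((\<lambda>u. g (f u) (X u) (Y u)) has_derivative
           (\<lambda>x. g (f u) (D X u x) (Y u) + g (f u) (X u) (D Y u x))) (at u)"
proof (rule has_derivative_eq_rhs)
  show "((\<lambda>u. g (f u) (X u) (Y u)) has_derivative
      (\<lambda>x. frechet_derivative (\<lambda>v. g v (X u) (Y u)) (at (f u)) (L u x)
       + g (f u) (frechet_derivative X (at u) x) (Y u)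
       + g (f u) (X u) (frechet_derivative Y (at u) x))) (at u)"
    using X Y by (intro has_derivative_bilinear_family[OF open_U u open_V f_in bilinear_g
          smooth_on_differentiable[OF smooth_g f_V[OF u]] has_derivative_f[OF u]])
      (auto simp: frechet_derivative_works)
qed (simp add: D_def parallel_g f_V u g_add algebra_simps)

text \<open>The Ricci identity; the second derivatives of \<open>f\<close> and \<open>Z\<close> cancel by symmetry.\<close>

lemma D_commute:
  assumes u: "u \<in> U" and Z: "smooth_on U Z"
  shows "D (\<lambda>u. D Z u y) u x - D (\<lambda>u. D Z u x) u y = R (f u) (L u x) (L u y) (Z u)"
proof -
  have dd: "frechet_derivative (\<lambda>u. D Z u y) (at u) x =
      frechet_derivative (\<lambda>u. frechet_derivative Z (at u) y) (at u) x
       + (frechet_derivative (\<lambda>v. \<Gamma> v (L u y) (Z u)) (at (f u)) (L u x)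
       + \<Gamma> (f u) (frechet_derivative (\<lambda>u. L u y) (at u) x) (Z u)
       + \<Gamma> (f u) (L u y) (frechet_derivative Z (at u) x))" for x y
    by (simp add: frechet_derivative_at[OF has_derivative_D[OF u Z], symmetric])
  have ex: "D (\<lambda>u. D Z u y) u x = frechet_derivative (\<lambda>u. D Z u y) (at u) x
      + (\<Gamma> (f u) (L u x) (frechet_derivative Z (at u) y) + \<Gamma> (f u) (L u x) (\<Gamma> (f u) (L u y) (Z u)))" for x y
    by (simp add: D_def[of "\<lambda>u. D Z u y" u x] D_def[of Z u y] bilinear_radd[OF bilinear_\<Gamma>[OF f_V[OF u]]])
  show ?thesis
    unfolding ex dd R_def
    using second_derivative_symmetric[OF open_U u Z, of x y] second_derivative_symmetric[OF open_U u smooth_f, of x y]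
    by (simp add: algebra_simps)
qed

end

section \<open>Splitting along a transversal\<close>

lemma decomposition_unique:
  assumes L: "linear L" "inj L" and t: "t \<notin> range L" and v: "v = L y + r *\<^sub>R t"
  shows "tang_coeff L t v = y" and "transv_coeff L t v = r"
proof -
  have *: "y' = y \<and> r' = r" if "v = L y' + r' *\<^sub>R t" for y' r'
  proof -
    have e: "(r' - r) *\<^sub>R t = L (y - y')"
      using v that by (simp add: linear_diff[OF L(1)] algebra_simps)
    have "r' = r"
    proof (rule ccontr)
      assume "r' \<noteq> r"
      then have "t = L ((1 / (r' - r)) *\<^sub>R (y - y'))"
        using e by (simp add: linear_scale[OF L(1)] flip: e)
      then show False using t by auto
    qed
    then show ?thesis using that v L(2) by (auto dest: injD)
  qed
  show "tang_coeff L t v = y" unfolding tang_coeff_def using v * by blast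
  show "transv_coeff L t v = r" unfolding transv_coeff_def using v * by blast
qed

text \<open>A dimension count: the range of L has codimension one, so together with a vector outside
  it spans the whole space.\<close>

lemma decomposition_exists:
  fixes L :: "'u::euclidean_space \<Rightarrow> 'v::euclidean_space"
  assumes L: "linear L" "inj L" and t: "t \<notin> range L" and dim: "DIM('v) = Suc DIM('u)"
  shows "v = L (tang_coeff L t v) + transv_coeff L t v *\<^sub>R t"
proof -
  have "subspace (range L)" using L by (simp add: linear_subspace_image)
  then have sp: "span (range L) = range L" by (simp add: span_eq_iff)
  have "dim (range L) = DIM('u)" using L dim_image_eq[of L UNIV] by (simp add: inj_on_subset)
  then have "dim (insert t (range L)) = DIM('v)" using t dim by (simp add: dim_insert sp)
  then have "v \<in> span (insert t (range L))" by (metis UNIV_I dim_eq_full)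
  then obtain r where "v - r *\<^sub>R t \<in> range L" by (auto simp: span_insert sp)
  then obtain y where "v = L y + r *\<^sub>R t" by (auto simp: algebra_simps)
  then show ?thesis using decomposition_unique[OF L t] by metis
qed

section \<open>Gauss, Weingarten and Codazzi equations\<close>

locale hypersurface_patch = metric_patch U V f g \<Gamma>
  for U :: "'u::euclidean_space set" and V :: "'v::euclidean_space set" and f g \<Gamma> +
  fixes E :: "'u \<Rightarrow> 'v" and \<kappa> :: real
  assumes dim: "DIM('v) = Suc DIM('u)" and inj_L: "\<And>u. u \<in> U \<Longrightarrow> inj (L u)"
    and curv: "\<And>v x y z. v \<in> V \<Longrightarrow> R v x y z = \<kappa> *\<^sub>R (g v y z *\<^sub>R x - g v x z *\<^sub>R y)"
    and smooth_E: "smooth_on U E"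
    and E_orth: "\<And>u x. u \<in> U \<Longrightarrow> g (f u) (E u) (L u x) = 0"
    and E_unit: "\<And>u. u \<in> U \<Longrightarrow> \<bar>g (f u) (E u) (E u)\<bar> = 1"
begin

definition m :: "'u \<Rightarrow> 'u \<Rightarrow> 'u \<Rightarrow> real" where
  "m u x y = g (f u) (L u x) (L u y)"

text \<open>The sign of the normal, kept as a function of the point because \<open>U\<close> may be
  disconnected.\<close>

definition \<epsilon> :: "'u \<Rightarrow> real" where
  "\<epsilon> u = g (f u) (E u) (E u)"

definition con :: "'u \<Rightarrow> 'u \<Rightarrow> 'u \<Rightarrow> 'u" where
  "con u x y = tang_coeff (L u) (E u) (D (\<lambda>u. L u y) u x)"

definition h :: "'u \<Rightarrow> 'u \<Rightarrow> 'u \<Rightarrow> real" where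
  "h u x y = transv_coeff (L u) (E u) (D (\<lambda>u. L u y) u x)"

definition S :: "'u \<Rightarrow> 'u \<Rightarrow> 'u" where
  "S u x = - tang_coeff (L u) (E u) (D E u x)"

lemma \<epsilon>_sq: "u \<in> U \<Longrightarrow> \<epsilon> u * \<epsilon> u = 1"
  using E_unit[of u] unfolding \<epsilon>_def by (metis abs_mult_self_eq mult_1)

lemma E_transverse: "u \<in> U \<Longrightarrow> E u \<notin> range (L u)"
  using E_orth[of u] E_unit[of u] by fastforce

lemma decomp: "u \<in> U \<Longrightarrow> v = L u (tang_coeff (L u) (E u) v) + transv_coeff (L u) (E u) v *\<^sub>R E u"
  by (rule decomposition_exists[OF linear_L inj_L E_transverse dim])

text \<open>Pairing with \<open>E\<close> kills the tangential part, and \<open>\<epsilon> u\<close>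
  is its own inverse. A coefficient given by a definite description thereby becomes an expression
  that can be differentiated.\<close>

lemma transv_E: "u \<in> U \<Longrightarrow> transv_coeff (L u) (E u) v = \<epsilon> u * g (f u) (E u) v"
proof -
  assume u: "u \<in> U"
  have "g (f u) (E u) v = g (f u) (E u) (L u (tang_coeff (L u) (E u) v) + transv_coeff (L u) (E u) v *\<^sub>R E u)"
    using decomp[OF u] by simp
  then show ?thesis
    using \<epsilon>_sq[OF u] by (simp add: g_add g_scale f_V[OF u] E_orth[OF u] \<epsilon>_def[symmetric] mult.left_commute)
qed

lemma gauss: "u \<in> U \<Longrightarrow> D (\<lambda>u. L u y) u x = L u (con u x y) + h u x y *\<^sub>R E u"
  unfolding con_def h_def by (rule decomp)

lemma h_eq: "u \<in> U \<Longrightarrow> h u x y = \<epsilon> u * g (f u) (E u) (D (\<lambda>u. L u y) u x)"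
  unfolding h_def by (rule transv_E)

lemma differentiable_E: "u \<in> U \<Longrightarrow> E differentiable (at u)"
  by (rule smooth_on_differentiable[OF smooth_E])

lemma differentiable_L: "u \<in> U \<Longrightarrow> (\<lambda>u. L u y) differentiable (at u)"
  by (rule smooth_on_differentiable[OF smooth_L])

text \<open>Differentiating \<open>\<epsilon> u * \<epsilon> u = 1\<close> gives 2 \<epsilon>
  d\<epsilon> = 0, and metric compatibility computes d\<epsilon> as 2 g(D E, E).\<close>

lemma has_derivative_\<epsilon>: assumes u: "u \<in> U" shows "(\<epsilon> has_derivative (\<lambda>x. 0)) (at u)"
  and g_DE_E: "g (f u) (D E u x) (E u) = 0"
proof -
  define d where "d x = g (f u) (D E u x) (E u) + g (f u) (E u) (D E u x)" for x
  have d: "(\<epsilon> has_derivative d) (at u)"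
    unfolding \<epsilon>_def[abs_def] d_def by (rule has_derivative_g[OF u differentiable_E[OF u] differentiable_E[OF u]])
  have 1: "((\<lambda>u. \<epsilon> u * \<epsilon> u) has_derivative (\<lambda>x. \<epsilon> u * d x + d x * \<epsilon> u)) (at u)"
    by (rule has_derivative_mult[OF d d])
  have 2: "((\<lambda>u. \<epsilon> u * \<epsilon> u) has_derivative (\<lambda>x. 0)) (at u)"
    by (rule has_derivative_transform_within_open[OF has_derivative_const[of 1] open_U u]) (simp add: \<epsilon>_sq)
  have "\<epsilon> u * d x = 0" for x using fun_cong[OF has_derivative_unique[OF 1 2], of x] by auto
  moreover have "\<epsilon> u \<noteq> 0" using \<epsilon>_sq[OF u] by auto
  ultimately have d0: "d x = 0" for x by simp
  then show "(\<epsilon> has_derivative (\<lambda>x. 0)) (at u)" using d by (simp add: ext[of d "\<lambda>x. 0"])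
  show "g (f u) (D E u x) (E u) = 0" using d0[of x] sym_g[OF f_V[OF u]] by (simp add: d_def)
qed

text \<open>A field of constant length has derivative orthogonal to itself; in other words the
  one-form \<tau> of \<open>E\<close> vanishes.\<close>

lemma weingarten: assumes u: "u \<in> U" shows "D E u x = - L u (S u x)"
proof -
  have "transv_coeff (L u) (E u) (D E u x) = 0"
    using g_DE_E[OF u] by (simp add: transv_E[OF u] sym_g[OF f_V[OF u], of "E u"])
  then show ?thesis using decomp[OF u, of "D E u x"] by (simp add: S_def linear_neg[OF linear_L[OF u]])
qed

text \<open>Obtained by differentiating the orthogonality g(E, L y) = 0. It trades second
  derivatives of \<open>f\<close> for first derivatives of \<open>E\<close>.\<close>

lemma h_eq_DE: assumes u: "u \<in> U" shows "h u x y = - \<epsilon> u * g (f u) (D E u x) (L u y)"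
proof -
  have "((\<lambda>u. g (f u) (E u) (L u y)) has_derivative
      (\<lambda>x. g (f u) (D E u x) (L u y) + g (f u) (E u) (D (\<lambda>u. L u y) u x))) (at u)"
    by (rule has_derivative_g[OF u differentiable_E[OF u] differentiable_L[OF u]])
  moreover have "((\<lambda>u. g (f u) (E u) (L u y)) has_derivative (\<lambda>x. 0)) (at u)"
    by (rule has_derivative_transform_within_open[OF has_derivative_const[of 0] open_U u]) (simp add: E_orth)
  ultimately have "(\<lambda>x. g (f u) (D E u x) (L u y) + g (f u) (E u) (D (\<lambda>u. L u y) u x)) = (\<lambda>x. 0)"
    by (rule has_derivative_unique)
  from fun_cong[OF this, of x] show ?thesis by (simp add: h_eq[OF u] add_eq_0_iff)
qed

lemma h_eq_S: assumes u: "u \<in> U" shows "h u x y = \<epsilon> u * m u (S u x) y"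
  by (simp add: h_eq_DE[OF u] weingarten[OF u] m_def g_minus f_V[OF u])

lemma h_sym: "u \<in> U \<Longrightarrow> h u x y = h u y x"
  by (simp add: h_def D_L_sym[of u x y])

lemma con_sym: "u \<in> U \<Longrightarrow> con u x y = con u y x"
  by (simp add: con_def D_L_sym[of u x y])

lemma bilinear_m: assumes u: "u \<in> U" shows "bilinear (m u)"
  unfolding bilinear_def m_def
  using linear_L[OF u] by (auto intro!: linearI simp: linear_add linear_scale g_add g_scale f_V[OF u])

lemma bilinear_h: assumes u: "u \<in> U" shows "bilinear (h u)"
proof -
  have "linear (\<lambda>x. h u x y)" for y
    using linear_D[OF u differentiable_L[OF u]]
    by (auto intro!: linearI simp: h_eq[OF u] linear_add linear_scale g_add g_scale f_V[OF u] algebra_simps)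
  then show ?thesis by (simp add: bilinear_def h_sym[OF u])
qed

text \<open>Linearity is tested after applying the injective \<open>L u\<close>, where
  \<open>S u\<close> turns into \<open>- D E u\<close>.\<close>

lemma linear_S: assumes u: "u \<in> U" shows "linear (S u)"
proof -
  note lin = linear_D[OF u differentiable_E[OF u]]
  have L: "L u (S u x) = - D E u x" for x using weingarten[OF u] by simp
  have "L u (S u (x + x')) = L u (S u x + S u x')" and "L u (S u (c *\<^sub>R x)) = L u (c *\<^sub>R S u x)" for x x' c
    unfolding linear_add[OF linear_L[OF u]] linear_scale[OF linear_L[OF u]]
    by (simp_all add: L linear_add[OF lin] linear_scale[OF lin])
  then show ?thesis unfolding inj_eq[OF inj_L[OF u]] by (rule linearI)
qed

text \<open>The normal parts in the Gauss formula are orthogonal to tangent vectors, so only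
  \<open>con\<close> survives: this is \<nabla>m = 0.\<close>

lemma has_derivative_m:
  assumes u: "u \<in> U"
  shows "((\<lambda>u. m u y z) has_derivative (\<lambda>x. m u (con u x y) z + m u y (con u x z))) (at u)"
proof (rule has_derivative_eq_rhs)
  show "((\<lambda>u. m u y z) has_derivative
     (\<lambda>x. g (f u) (D (\<lambda>u. L u y) u x) (L u z) + g (f u) (L u y) (D (\<lambda>u. L u z) u x))) (at u)"
    unfolding m_def by (rule has_derivative_g[OF u differentiable_L[OF u] differentiable_L[OF u]])
  show "(\<lambda>x. g (f u) (D (\<lambda>u. L u y) u x) (L u z) + g (f u) (L u y) (D (\<lambda>u. L u z) u x))
    = (\<lambda>x. m u (con u x y) z + m u y (con u x z))"
    by (simp add: gauss[OF u] g_add g_scale f_V[OF u] m_def E_orth[OF u] sym_g[OF f_V[OF u], of _ "E u"])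
qed

definition nabla_h :: "'u \<Rightarrow> 'u \<Rightarrow> 'u \<Rightarrow> 'u \<Rightarrow> real" where
  "nabla_h u x y z = frechet_derivative (\<lambda>u. h u y z) (at u) x - h u (con u x y) z - h u y (con u x z)"

text \<open>Starting from \<open>h_eq_DE\<close> rather than from the definition of \<open>h\<close>
  brings in second covariant derivatives of \<open>E\<close>, to which the Ricci identity
  applies.\<close>

lemma has_derivative_h:
  assumes u: "u \<in> U"
  shows "((\<lambda>u. h u y z) has_derivative
     (\<lambda>x. - \<epsilon> u * (g (f u) (D (\<lambda>u. D E u y) u x) (L u z) + g (f u) (D E u y) (D (\<lambda>u. L u z) u x)))) (at u)"
proof -
  have "((\<lambda>u. - \<epsilon> u * g (f u) (D E u y) (L u z)) has_derivative
     (\<lambda>x. - \<epsilon> u * (g (f u) (D (\<lambda>u. D E u y) u x) (L u z) + g (f u) (D E u y) (D (\<lambda>u. L u z) u x))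
        + - 0 * g (f u) (D E u y) (L u z))) (at u)"
    by (intro has_derivative_mult has_derivative_minus has_derivative_\<epsilon> has_derivative_g
        differentiable_D differentiable_L smooth_E u)
  then have "((\<lambda>u. - \<epsilon> u * g (f u) (D E u y) (L u z)) has_derivative
     (\<lambda>x. - \<epsilon> u * (g (f u) (D (\<lambda>u. D E u y) u x) (L u z) + g (f u) (D E u y) (D (\<lambda>u. L u z) u x)))) (at u)"
    by simp
  then show ?thesis
    by (rule has_derivative_transform_within_open[OF _ open_U u]) (simp add: h_eq_DE)
qed

text \<open>\<open>D E\<close> is tangent, so it sees only the tangential part of the derivative of
  \<open>L z\<close>, and that contribution cancels the term with \<open>con u x z\<close>. What
  remains is symmetric in x and y up to the commutator of second derivatives of
  \<open>E\<close>.\<close>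

lemma nabla_h_eq:
  assumes u: "u \<in> U"
  shows "nabla_h u x y z = - \<epsilon> u * g (f u) (D (\<lambda>u. D E u y) u x) (L u z) - h u (con u x y) z"
proof -
  have "g (f u) (D E u y) (D (\<lambda>u. L u z) u x) = g (f u) (D E u y) (L u (con u x z))"
    by (simp add: gauss[OF u, of z x] g_add g_scale f_V[OF u] g_DE_E[OF u])
  then show ?thesis
    unfolding nabla_h_def frechet_derivative_at[OF has_derivative_h[OF u], symmetric]
    by (simp add: h_eq_DE[OF u, of y] algebra_simps)
qed

text \<open>The Codazzi equation: in constant curvature \<open>R(x, y)E\<close> vanishes for tangent \<open>x\<close>, \<open>y\<close>.\<close>

lemma codazzi: assumes u: "u \<in> U" shows "nabla_h u x y z = nabla_h u y x z"
proof -
  have "R (f u) (L u x) (L u y) (E u) = 0"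
    using sym_g[OF f_V[OF u], of _ "E u"] by (simp add: curv[OF f_V[OF u]] E_orth[OF u])
  then have "D (\<lambda>u. D E u y) u x = D (\<lambda>u. D E u x) u y"
    using D_commute[OF u smooth_E, of y x] by simp
  then show ?thesis by (simp add: nabla_h_eq[OF u] con_sym[OF u, of x y])
qed

lemma nabla_h_sym: assumes u: "u \<in> U" shows "nabla_h u x y z = nabla_h u x z y"
proof -
  have "frechet_derivative (\<lambda>u. h u y z) (at u) = frechet_derivative (\<lambda>u. h u z y) (at u)"
    by (rule frechet_derivative_transform_within_open[OF _ open_U u])
       (use has_derivative_h[OF u] differentiableI h_sym in blast)+
  then show ?thesis unfolding nabla_h_def using h_sym[OF u] by simp
qed

end

text \<open>The left-hand side is the trace of the rank-one map sending x to
  \<open>\<phi> x *\<^sub>R z\<close>.\<close>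

lemma sum_axis_linear:
  fixes \<phi> :: "real ^ 'n::finite \<Rightarrow> real"
  assumes "linear \<phi>"
  shows "(\<Sum>i\<in>UNIV. \<phi> (axis i 1) * z $ i) = \<phi> z"
proof -
  have "\<phi> z = \<phi> (\<Sum>i\<in>UNIV. z $ i *\<^sub>R axis i 1)"
    by (simp add: basis_expansion[of z, unfolded scalar_mult_eq_scaleR])
  also have "\<dots> = (\<Sum>i\<in>UNIV. \<phi> (axis i 1) * z $ i)"
    by (simp add: linear_sum[OF assms] linear_scale[OF assms] mult.commute)
  finally show ?thesis by simp
qed

lemma linear_vector_expansion:
  fixes L :: "real ^ 'n::finite \<Rightarrow> 'w::real_vector"
  assumes "linear L"
  shows "L z = (\<Sum>i\<in>UNIV. z $ i *\<^sub>R L (axis i 1))"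
proof -
  have "L z = L (\<Sum>i\<in>UNIV. z $ i *\<^sub>R axis i 1)"
    by (simp add: basis_expansion[of z, unfolded scalar_mult_eq_scaleR])
  also have "\<dots> = (\<Sum>i\<in>UNIV. z $ i *\<^sub>R L (axis i 1))"
    by (simp add: linear_sum[OF assms] linear_scale[OF assms])
  finally show ?thesis .
qed

lemma bilinear_gram:
  assumes "bilinear b"
  shows "b (x :: real ^ 'k::finite) y = (\<Sum>i\<in>UNIV. \<Sum>j\<in>UNIV. x $ i * gram b $ i $ j * y $ j)"
proof -
  have "linear (b x)" using assms by (simp add: bilinear_def)
  from linear_vector_expansion[OF this, of y] show ?thesis
    by (simp add: bilinear_gram_right[OF assms] sum_distrib_left mult.commute, subst sum.swap) (rule refl)
qed

lemma gram_pullback: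
  fixes A :: "real ^ 'k::finite ^ 'k"
  assumes "bilinear b"
  shows "gram (\<lambda>x y. b (A *v x) (A *v y)) = transpose A ** gram b ** A"
proof -
  have "b (A *v axis i 1) (A *v axis j 1) = (transpose A ** gram b ** A) $ i $ j" for i j
    by (subst bilinear_gram[OF assms], subst sum.swap)
       (simp add: matrix_vector_mult_basis matrix_matrix_mult_def transpose_def column_def sum_distrib_right)
  then show ?thesis by (simp add: gram_def[of "\<lambda>x y. b (A *v x) (A *v y)"] vec_eq_iff)
qed

section \<open>Logarithmic derivative of the Gauss-Kronecker curvature\<close>

locale hypersurface_coords = hypersurface_patch U V f g \<Gamma> E \<kappa>
  for U :: "(real ^ 'n::finite) set" and V :: "(real ^ 'n option) set" and f g \<Gamma> E \<kappa> +
  assumes nondeg_h: "\<And>u. u \<in> U \<Longrightarrow> nondegenerate_form (h u)"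
    and nondeg_m: "\<And>u. u \<in> U \<Longrightarrow> nondegenerate_form (m u)"
begin

definition gk :: "real ^ 'n \<Rightarrow> real" where
  "gk u = det (matrix (S u))"

lemma m_sym: "u \<in> U \<Longrightarrow> m u x y = m u y x"
  by (simp add: m_def sym_g f_V)

lemma inv_h: "u \<in> U \<Longrightarrow> invertible (gram (h u))"
  by (rule invertible_gram[OF bilinear_h nondeg_h])

lemma inv_m: "u \<in> U \<Longrightarrow> invertible (gram (m u))"
  by (rule invertible_gram[OF bilinear_m nondeg_m])

text \<open>In matrices, \<open>h_eq_S\<close> reads Gram(h) = \<epsilon> S^T Gram(m); the sign
  comes out of each of the n rows.\<close>

lemma det_gram_h: assumes u: "u \<in> U"
  shows "det (gram (h u)) = \<epsilon> u ^ CARD('n) * (gk u * det (gram (m u)))"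
proof -
  have "gram (h u) $ i $ j = ((\<chi> i j. \<epsilon> u * (transpose (matrix (S u)) ** gram (m u)) $ i $ j) :: real^'n^'n) $ i $ j" for i j
    using bilinear_gram_right[OF bilinear_m[OF u], of "S u (axis i 1)" j]
    by (simp add: gram_def[of "h u"] h_eq_S[OF u] matrix_matrix_mult_def transpose_def matrix_def)
  then have "gram (h u) = (\<chi> i. \<epsilon> u *s (transpose (matrix (S u)) ** gram (m u)) $ i)"
    by (simp add: vec_eq_iff)
  then show ?thesis
    using det_rows_mul[of "\<lambda>_. \<epsilon> u" "\<lambda>i. (transpose (matrix (S u)) ** gram (m u)) $ i"]
    by (simp add: det_mul gk_def)
qed

text \<open>This form involves only Gram determinants, so the shape operator itself never has to be
  differentiated.\<close>

lemma gk_eq: assumes u: "u \<in> U"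
  shows "gk u = \<epsilon> u ^ CARD('n) * (det (gram (h u)) / det (gram (m u)))"
proof -
  have "\<epsilon> u ^ CARD('n) * \<epsilon> u ^ CARD('n) = 1"
    by (simp add: \<epsilon>_sq[OF u] flip: power_mult_distrib)
  then show ?thesis
    using inv_m[OF u] by (simp add: det_gram_h[OF u] invertible_det_nz mult.assoc[symmetric])
qed

lemma gk_nonzero: "u \<in> U \<Longrightarrow> gk u \<noteq> 0"
  using det_gram_h[of u] inv_h[of u] by (auto simp: invertible_det_nz)

lemma abs_det_gram_h: assumes u: "u \<in> U" shows "\<bar>det (gram (h u))\<bar> = \<bar>gk u\<bar> * \<bar>det (gram (m u))\<bar>"
  using E_unit[OF u] by (simp add: det_gram_h[OF u] abs_mult power_abs \<epsilon>_def)

text \<open>Jacobi's formula, with the plain derivative of \<open>h\<close> rewritten through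
  \<open>nabla_h\<close>. Each of the two connection terms contracts to the trace of
  \<open>con u x\<close>.\<close>

lemma has_derivative_det_gram_h: assumes u: "u \<in> U"
  shows "((\<lambda>u. det (gram (h u))) has_derivative
    (\<lambda>x. det (gram (h u)) * (metric_trace (h u) (nabla_h u x) + 2 * (\<Sum>i\<in>UNIV. con u x (axis i 1) $ i)))) (at u)"
proof -
  have "((\<lambda>u. h u y z) has_derivative frechet_derivative (\<lambda>u. h u y z) (at u)) (at u)" for y z
    using has_derivative_h[OF u] differentiableI frechet_derivative_works by blast
  then have "((\<lambda>u. gram (h u) $ i $ j) has_derivative frechet_derivative (\<lambda>u. h u (axis i 1) (axis j 1)) (at u)) (at u)" for i j
    by (simp add: gram_def)
  from has_derivative_det[of "\<lambda>u. gram (h u)", OF this inv_h[OF u]]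
  have 1: "((\<lambda>u. det (gram (h u))) has_derivative
    (\<lambda>x. det (gram (h u)) * metric_trace (h u) (\<lambda>y z. frechet_derivative (\<lambda>u. h u z y) (at u) x))) (at u)"
    by (simp add: metric_trace_def)
  have 2: "metric_trace (h u) (\<lambda>y z. frechet_derivative (\<lambda>u. h u z y) (at u) x)
      = metric_trace (h u) (nabla_h u x) + 2 * (\<Sum>i\<in>UNIV. con u x (axis i 1) $ i)" for x
  proof -
    have "metric_trace (h u) (\<lambda>y z. frechet_derivative (\<lambda>u. h u z y) (at u) x)
      = metric_trace (h u) (\<lambda>y z. frechet_derivative (\<lambda>u. h u y z) (at u) x)"
      by (rule metric_trace_swap[OF inv_h[OF u] h_sym[OF u]])
    also have "\<dots> = metric_trace (h u) (\<lambda>y z. (nabla_h u x y z + h u (con u x y) z) + h u y (con u x z))"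
      by (rule metric_trace_cong) (simp add: nabla_h_def)
    also have "\<dots> = metric_trace (h u) (nabla_h u x) + 2 * (\<Sum>i\<in>UNIV. con u x (axis i 1) $ i)"
      by (simp add: metric_trace_add metric_trace_left[OF bilinear_h[OF u] inv_h[OF u] h_sym[OF u]]
          metric_trace_right[OF bilinear_h[OF u] inv_h[OF u] h_sym[OF u]])
    finally show ?thesis .
  qed
  show ?thesis using 1 unfolding 2 .
qed

lemma has_derivative_det_gram_m: assumes u: "u \<in> U"
  shows "((\<lambda>u. det (gram (m u))) has_derivative
    (\<lambda>x. det (gram (m u)) * (2 * (\<Sum>i\<in>UNIV. con u x (axis i 1) $ i)))) (at u)"
proof -
  have "((\<lambda>u. gram (m u) $ i $ j) has_derivative
      (\<lambda>x. m u (con u x (axis i 1)) (axis j 1) + m u (axis i 1) (con u x (axis j 1)))) (at u)" for i j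
    using has_derivative_m[OF u] by (simp add: gram_def)
  from has_derivative_det[of "\<lambda>u. gram (m u)", OF this inv_m[OF u]]
  have "((\<lambda>u. det (gram (m u))) has_derivative
    (\<lambda>x. det (gram (m u)) * metric_trace (m u) (\<lambda>y z. m u (con u x z) y + m u z (con u x y)))) (at u)"
    by (simp add: metric_trace_def)
  moreover have "metric_trace (m u) (\<lambda>y z. m u (con u x z) y + m u z (con u x y))
     = 2 * (\<Sum>i\<in>UNIV. con u x (axis i 1) $ i)" for x
  proof -
    have "metric_trace (m u) (\<lambda>y z. m u (con u x z) y + m u z (con u x y))
      = metric_trace (m u) (\<lambda>y z. m u y (con u x z) + m u (con u x y) z)"
      by (rule metric_trace_cong) (simp add: m_sym[OF u])
    then show ?thesis
      by (simp add: metric_trace_add metric_trace_left[OF bilinear_m[OF u] inv_m[OF u] m_sym[OF u]]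
          metric_trace_right[OF bilinear_m[OF u] inv_m[OF u] m_sym[OF u]])
  qed
  ultimately show ?thesis by simp
qed

text \<open>In the quotient of the two Gram determinants the traces of the connection cancel, and
  only the trace of \<open>nabla_h\<close> is left.\<close>

lemma has_derivative_gk: assumes u: "u \<in> U"
  shows "(gk has_derivative (\<lambda>x. gk u * metric_trace (h u) (nabla_h u x))) (at u)"
proof -
  have M: "det (gram (m u)) \<noteq> 0" using inv_m[OF u] by (simp add: invertible_det_nz)
  have "((\<lambda>u. \<epsilon> u ^ CARD('n)) has_derivative (\<lambda>x. 0)) (at u)"
    using has_derivative_power[OF has_derivative_\<epsilon>(1)[OF u], of "CARD('n)"] by simp
  from has_derivative_mult[OF this has_derivative_divide[OF has_derivative_det_gram_h[OF u] has_derivative_det_gram_m[OF u] M]]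
  have "((\<lambda>u. \<epsilon> u ^ CARD('n) * (det (gram (h u)) / det (gram (m u)))) has_derivative
     (\<lambda>x. gk u * metric_trace (h u) (nabla_h u x))) (at u)"
    by (rule has_derivative_eq_rhs) (use M in \<open>simp add: gk_eq[OF u] field_simps fun_eq_iff\<close>)
  then show ?thesis
    by (rule has_derivative_transform_within_open[OF _ open_U u]) (simp add: gk_eq)
qed

text \<open>Linearity in x is inherited from the derivative of \<open>gk\<close> after division by
  the nonzero number \<open>gk u\<close>.\<close>

lemma linear_nabla_h_trace: "u \<in> U \<Longrightarrow> linear (\<lambda>x. metric_trace (h u) (nabla_h u x))"
  using linear_compose_scale_right[OF has_derivative_linear[OF has_derivative_gk, of u], of "inverse (gk u)"]
    gk_nonzero[of u] by (simp add: mult.assoc[symmetric])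

end

section \<open>The equiaffine normal in coordinates\<close>

text \<open>\<open>W_pos\<close> is what the common co-orientation of \<open>W\<close> and
  \<open>E\<close> amounts to. Alignment and the volume condition appear as hypotheses of the lemmas
  that use them.\<close>

locale equiaffine_coords = hypersurface_coords U V f g \<Gamma> E \<kappa>
  for U :: "(real ^ 'n::finite) set" and V :: "(real ^ 'n option) set" and f g \<Gamma> E \<kappa> +
  fixes W :: "real ^ 'n \<Rightarrow> real ^ 'n option"
  assumes card: "2 \<le> CARD('n)" and smooth_W: "smooth_on U W"
    and W_pos: "\<And>u. u \<in> U \<Longrightarrow> 0 < transv_coeff (L u) (E u) (W u)"
begin

definition a :: "real ^ 'n \<Rightarrow> real" where "a u = transv_coeff (L u) (E u) (W u)"

definition Z :: "real ^ 'n \<Rightarrow> real ^ 'n" where "Z u = tang_coeff (L u) (E u) (W u)"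

definition conW :: "real ^ 'n \<Rightarrow> real ^ 'n \<Rightarrow> real ^ 'n \<Rightarrow> real ^ 'n" where
  "conW u x y = tang_coeff (L u) (W u) (D (\<lambda>u. L u y) u x)"

definition k :: "real ^ 'n \<Rightarrow> real ^ 'n \<Rightarrow> real ^ 'n \<Rightarrow> real" where
  "k u x y = transv_coeff (L u) (W u) (D (\<lambda>u. L u y) u x)"

lemma a_pos: "u \<in> U \<Longrightarrow> 0 < a u"
  using W_pos by (simp add: a_def)

lemma W_eq: "u \<in> U \<Longrightarrow> W u = L u (Z u) + a u *\<^sub>R E u"
  unfolding a_def Z_def by (rule decomp)

lemma W_transverse: assumes u: "u \<in> U" shows "W u \<notin> range (L u)"
proof
  assume "W u \<in> range (L u)"
  then obtain y where "W u = L u y + 0 *\<^sub>R E u" by auto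
  then have "a u = 0"
    unfolding a_def by (rule decomposition_unique(2)[OF linear_L[OF u] inj_L[OF u] E_transverse[OF u]])
  then show False using a_pos[OF u] by simp
qed

text \<open>Solve \<open>W = L Z + a E\<close> for \<open>E\<close> and insert the result in the
  Gauss formula; the splitting along \<open>W\<close> is unique.\<close>

lemma k_conW:
  assumes u: "u \<in> U"
  shows "k u x y = h u x y / a u" and "conW u x y = con u x y - (h u x y / a u) *\<^sub>R Z u"
proof -
  have "D (\<lambda>u. L u y) u x = L u (con u x y - (h u x y / a u) *\<^sub>R Z u) + (h u x y / a u) *\<^sub>R W u"
    using a_pos[OF u]
    by (simp add: gauss[OF u] W_eq[OF u] linear_diff[OF linear_L[OF u]] linear_scale[OF linear_L[OF u]] algebra_simps)
  note * = decomposition_unique[OF linear_L[OF u] inj_L[OF u] W_transverse[OF u] this]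
  show "k u x y = h u x y / a u" and "conW u x y = con u x y - (h u x y / a u) *\<^sub>R Z u"
    unfolding k_def conW_def by (rule *)+
qed

lemma differentiable_a: assumes u: "u \<in> U" shows "a differentiable (at u)"
proof -
  have "((\<lambda>u. \<epsilon> u * g (f u) (E u) (W u)) has_derivative
     (\<lambda>x. \<epsilon> u * (g (f u) (D E u x) (W u) + g (f u) (E u) (D W u x)) + 0 * g (f u) (E u) (W u))) (at u)"
    by (intro has_derivative_mult has_derivative_\<epsilon>(1) has_derivative_g differentiable_E
        smooth_on_differentiable[OF smooth_W] u)
  then have "(a has_derivative
     (\<lambda>x. \<epsilon> u * (g (f u) (D E u x) (W u) + g (f u) (E u) (D W u x)) + 0 * g (f u) (E u) (W u))) (at u)"
    by (rule has_derivative_transform_within_open[OF _ open_U u]) (simp add: a_def transv_E)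
  then show ?thesis by (rule differentiableI)
qed

definition nabla_k :: "real ^ 'n \<Rightarrow> real ^ 'n \<Rightarrow> real ^ 'n \<Rightarrow> real ^ 'n \<Rightarrow> real" where
  "nabla_k u x y z = frechet_derivative (\<lambda>u. k u y z) (at u) x - k u (conW u x y) z - k u y (conW u x z)"

lemma has_derivative_k:
  assumes u: "u \<in> U"
  shows "((\<lambda>u. k u y z) has_derivative
      (\<lambda>x. (1 / a u) * frechet_derivative (\<lambda>u. h u y z) (at u) x - (1 / (a u)\<^sup>2) * (frechet_derivative a (at u) x * h u y z))) (at u)"
proof -
  have h: "((\<lambda>u. h u y z) has_derivative frechet_derivative (\<lambda>u. h u y z) (at u)) (at u)"
    using has_derivative_h[OF u] differentiableI frechet_derivative_works by blast
  have a: "(a has_derivative frechet_derivative a (at u)) (at u)"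
    using differentiable_a[OF u] by (simp add: frechet_derivative_works)
  have a0: "a u \<noteq> 0" using a_pos[OF u] by simp
  have "((\<lambda>u. h u y z / a u) has_derivative
      (\<lambda>x. (1 / a u) * frechet_derivative (\<lambda>u. h u y z) (at u) x - (1 / (a u)\<^sup>2) * (frechet_derivative a (at u) x * h u y z))) (at u)"
    by (rule has_derivative_eq_rhs[OF has_derivative_divide[OF h a a0]])
       (use a0 in \<open>simp add: fun_eq_iff field_simps power2_eq_square\<close>)
  then show ?thesis
    by (rule has_derivative_transform_within_open[OF _ open_U u]) (simp add: k_conW)
qed

text \<open>The term with the derivative of \<open>a\<close> is the quotient rule; the last two
  terms come from the correction of the connection by a multiple of \<open>Z\<close>.
  \<open>Z\<close> is never differentiated.\<close>

lemma nabla_k_eq: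
  assumes u: "u \<in> U"
  shows "nabla_k u x y z = (1 / a u) * nabla_h u x y z
    - (1 / (a u)\<^sup>2) * (frechet_derivative a (at u) x * h u y z)
    + (1 / (a u)\<^sup>2) * (h u x y * h u (Z u) z + h u x z * h u (Z u) y)"
proof -
  have a0: "a u \<noteq> 0" using a_pos[OF u] by simp
  have fd: "frechet_derivative (\<lambda>u. k u y z) (at u) x
     = (1 / a u) * frechet_derivative (\<lambda>u. h u y z) (at u) x - (1 / (a u)\<^sup>2) * (frechet_derivative a (at u) x * h u y z)"
    by (simp add: frechet_derivative_at[OF has_derivative_k[OF u], symmetric])
  note bil = bilinear_lsub[OF bilinear_h[OF u]] bilinear_rsub[OF bilinear_h[OF u]]
    bilinear_lmul[OF bilinear_h[OF u]] bilinear_rmul[OF bilinear_h[OF u]]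
  show ?thesis
    unfolding nabla_k_def fd nabla_h_def k_conW[OF u] bil
    using a0 by (simp add: h_sym[OF u, of y "Z u"] field_simps power2_eq_square)
qed

text \<open>By total symmetry both sides of the alignment condition involve the same trace of
  \<open>nabla_h\<close>, with weights n and 1. The differential of \<open>a\<close> occurs n times
  on each side and drops out, so the trace is determined by \<open>Z\<close> alone once
  \<open>a\<close> is given.\<close>

lemma nabla_h_trace_axis:
  assumes u: "u \<in> U"
    and aligned: "real CARD('n) * metric_trace (k u) (\<lambda>x y. nabla_k u x y (axis i 1))
      = metric_trace (k u) (nabla_k u (axis i 1))"
  shows "metric_trace (h u) (nabla_h u (axis i 1)) = - (real CARD('n) + 2) * h u (Z u) (axis i 1) / a u"
proof -
  define z where "z = (axis i 1 :: real ^ 'n)"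
  define n where "n = real CARD('n)"
  let ?T = "metric_trace (h u)" and ?da = "frechet_derivative a (at u)"
  note tl = metric_trace_left[OF bilinear_h[OF u] inv_h[OF u] h_sym[OF u]]
  note bil = bilinear_lmul[OF bilinear_h[OF u]]
  have a0: "a u \<noteq> 0" using a_pos[OF u] by simp
  have lin_da: "linear ?da"
    using differentiable_a[OF u] has_derivative_linear frechet_derivative_works by blast
  have lin_h: "linear (\<lambda>x. h u x y)" for y
    using bilinear_h[OF u] by (simp add: bilinear_def)
  have t_h: "?T (\<lambda>x y. h u x y) = n"
    using tl[of "\<lambda>x. x"] by (simp add: n_def)
  have t1: "?T (\<lambda>x y. \<phi> x * h u v y) = \<phi> v" if "linear \<phi>" for \<phi> v
    using tl[of "\<lambda>x. \<phi> x *\<^sub>R v"] sum_axis_linear[OF that, of v] by (simp add: bil)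
  have tk: "metric_trace (k u) t = a u * ?T t" for t
    using metric_trace_scale_metric[OF inv_h[OF u] a0] by (simp add: k_conW(1)[OF u, abs_def])
  \<comment> \<open>Symmetry of \<open>h\<close> and Codazzi move the free vector z into the
    differentiation slot.\<close>
  have nab: "nabla_h u x y z = nabla_h u z x y" for x y
    using nabla_h_sym[OF u, of x y z] codazzi[OF u, of x z y] by simp
  have "?T (\<lambda>x y. nabla_k u x y z) = ?T (\<lambda>x y. ((1 / a u) * nabla_h u z x y
    - (1 / (a u)\<^sup>2) * (?da x * h u z y))
    + (1 / (a u)\<^sup>2) * (h u (Z u) z * h u x y + h u x z * h u (Z u) y))"
    by (rule metric_trace_cong) (simp add: nabla_k_eq[OF u] nab h_sym[OF u, of _ z] mult.commute)
  also have "\<dots> = (1 / a u) * ?T (nabla_h u z) - (1 / (a u)\<^sup>2) * ?da z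
     + (1 / (a u)\<^sup>2) * (h u (Z u) z * n + h u (Z u) z)"
    by (simp only: metric_trace_add metric_trace_diff metric_trace_scale t_h t1[OF lin_da] t1[OF lin_h])
  finally have l: "?T (\<lambda>x y. nabla_k u x y z) = (1 / a u) * ?T (nabla_h u z) - (1 / (a u)\<^sup>2) * ?da z
     + (1 / (a u)\<^sup>2) * (h u (Z u) z * n + h u (Z u) z)" .
  have "?T (nabla_k u z) = ?T (\<lambda>x y. ((1 / a u) * nabla_h u z x y
    - (1 / (a u)\<^sup>2) * (?da z * h u x y))
    + (1 / (a u)\<^sup>2) * (h u x z * h u (Z u) y + h u x (Z u) * h u z y))"
    by (rule metric_trace_cong) (simp add: nabla_k_eq[OF u] h_sym[OF u, of _ z] h_sym[OF u, of _ "Z u"] mult.commute)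
  also have "\<dots> = (1 / a u) * ?T (nabla_h u z) - (1 / (a u)\<^sup>2) * (?da z * n)
     + (1 / (a u)\<^sup>2) * (h u (Z u) z + h u z (Z u))"
    by (simp only: metric_trace_add metric_trace_diff metric_trace_scale t_h t1[OF lin_h])
  finally have r: "?T (nabla_k u z) = (1 / a u) * ?T (nabla_h u z) - (1 / (a u)\<^sup>2) * (?da z * n)
     + (1 / (a u)\<^sup>2) * (2 * h u (Z u) z)" by (simp add: h_sym[OF u, of z])
  have eq: "n * ?T (\<lambda>x y. nabla_k u x y z) = ?T (nabla_k u z)"
    using aligned a0 unfolding tk z_def n_def by simp
  \<comment> \<open>The terms in \<open>Z\<close> have weights n(n + 1) and 2, and n(n + 1) - 2 = (n
    - 1)(n + 2). Division by n - 1 is where n \<ge> 2 enters.\<close>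
  have alg: "(n - 1) * (A * T + (n + 2) * H) = A\<^sup>2 * (n * (1 / A * T - 1 / A\<^sup>2 * d + 1 / A\<^sup>2 * (H * n + H))
      - (1 / A * T - 1 / A\<^sup>2 * (d * n) + 1 / A\<^sup>2 * (2 * H)))" if "A \<noteq> 0" for A T H d :: real
    using that by (simp add: field_simps power2_eq_square)
  have "(n - 1) * (a u * ?T (nabla_h u z) + (n + 2) * h u (Z u) z) = 0"
    unfolding alg[OF a0, of "?T (nabla_h u z)" "h u (Z u) z" "?da z"] using eq[unfolded l r] by simp
  moreover have "n - 1 \<noteq> 0" using card by (simp add: n_def)
  ultimately have "a u * ?T (nabla_h u z) + (n + 2) * h u (Z u) z = 0" by simp
  then show ?thesis using a0 unfolding z_def n_def by (simp add: field_simps add_eq_0_iff)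
qed

lemma has_derivative_gk_Z:
  assumes u: "u \<in> U"
    and aligned: "\<And>i. real CARD('n) * metric_trace (k u) (\<lambda>x y. nabla_k u x y (axis i 1))
      = metric_trace (k u) (nabla_k u (axis i 1))"
  shows "(gk has_derivative (\<lambda>x. - (real CARD('n) + 2) * gk u * h u (Z u) x / a u)) (at u)"
proof -
  have 1: "linear (\<lambda>x. - (real CARD('n) + 2) * h u (Z u) x / a u)"
    using bilinear_radd[OF bilinear_h[OF u]] bilinear_rmul[OF bilinear_h[OF u]]
    by (auto intro!: linearI simp: algebra_simps add_divide_distrib diff_divide_distrib)
  have "metric_trace (h u) (nabla_h u x) = - (real CARD('n) + 2) * h u (Z u) x / a u" for x
    using linear_vector_expansion[OF linear_nabla_h_trace[OF u], of x] linear_vector_expansion[OF 1, of x]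
      nabla_h_trace_axis[OF u aligned] by simp
  then show ?thesis
    by (intro has_derivative_eq_rhs[OF has_derivative_gk[OF u]]) (simp add: algebra_simps)
qed

text \<open>The volume condition is evaluated on the coordinate frame and squared. On the left, the
  tangential part of \<open>W\<close> does not affect the determinant and the frame has Gram
  determinant \<epsilon> det(m), giving a^2 |det m|. On the right, det(k) = det(h) / a^n, giving |K|
  |det m| / a^n.\<close>

lemma a_power:
  assumes u: "u \<in> U"
    and vol: "\<And>y. sqrt \<bar>det (gram (g (f u)))\<bar> * \<bar>det (\<chi> i j. case_option (W u) (\<lambda>k. L u (y k)) j $ i)\<bar>
      = sqrt \<bar>det (gram (k u))\<bar> * \<bar>det (\<chi> i j. y j $ i)\<bar>"
  shows "a u ^ (CARD('n) + 2) = \<bar>gk u\<bar>"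
proof -
  \<comment> \<open>The adapted frame is stored by rows, with \<open>E\<close> in row
    \<open>None\<close>; \<open>x\<close> below lists the coefficients of \<open>W\<close> in it.
    This is the shape required by Cramer's rule for rows.\<close>
  define A where "A = (\<chi> j. case j of None \<Rightarrow> E u | Some l \<Rightarrow> L u (axis l 1))"
  have A_nth: "A $ None = E u" "A $ Some l = L u (axis l 1)" for l by (simp_all add: A_def)
  define x where "x = (\<chi> j. case j of None \<Rightarrow> a u | Some l \<Rightarrow> Z u $ l)"
  have sumW: "(\<Sum>i\<in>UNIV. x $ i *s row i A) = W u"
  proof -
    have "(\<Sum>i\<in>UNIV. x $ i *s row i A) = a u *\<^sub>R E u + (\<Sum>l\<in>UNIV. Z u $ l *\<^sub>R L u (axis l 1))"
      unfolding UNIV_option_conv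
      by (subst sum.insert) (auto simp: sum.reindex A_def x_def row_def scalar_mult_eq_scaleR)
    then show ?thesis using linear_vector_expansion[OF linear_L[OF u], of "Z u"] by (simp add: W_eq[OF u])
  qed
  have "det (\<chi> j. if j = None then W u else row j A) = a u * det A"
    using cramer_lemma_transpose[of None x A] unfolding sumW by (simp add: x_def)
  also have "(\<chi> j. if j = None then W u else row j A)
      = transpose (\<chi> i j. case_option (W u) (\<lambda>k. L u (axis k 1)) j $ i)"
    by (simp add: vec_eq_iff transpose_def row_def A_def split: option.split)
  finally have dW: "det (\<chi> i j. case_option (W u) (\<lambda>k. L u (axis k 1)) j $ i) = a u * det A"
    by simp
  have pb: "gram (\<lambda>x y. g (f u) (transpose A *v x) (transpose A *v y)) = A ** gram (g (f u)) ** transpose A"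
    using gram_pullback[OF bilinear_g[OF f_V[OF u]], of "transpose A"] by simp
  have ax: "transpose A *v axis j 1 = A $ j" for j
    by (simp add: matrix_vector_mult_basis column_transpose) (simp add: row_def)
  have "gram (\<lambda>x y. g (f u) (transpose A *v x) (transpose A *v y)) $ i $ j
      = g (f u) (transpose A *v axis i 1) (transpose A *v axis j 1)" for i j
    by (simp only: gram_def vec_lambda_beta)
  then have gr: "(A ** gram (g (f u)) ** transpose A) $ i $ j = g (f u) (A $ i) (A $ j)" for i j
    unfolding pb ax .
  \<comment> \<open>Orthogonality of \<open>E\<close> makes the row \<open>None\<close> of the Gram
    matrix vanish off the diagonal.\<close>
  have "det (A ** gram (g (f u)) ** transpose A) = \<epsilon> u * det (\<chi> i j. m u (axis i 1) (axis j 1))"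
    by (subst det_option) (simp_all add: gr A_nth E_orth[OF u] \<epsilon>_def m_def)
  then have "(det A)\<^sup>2 * det (gram (g (f u))) = \<epsilon> u * det (gram (m u))"
    by (simp add: det_mul gram_def[of "m u"] power2_eq_square mult.commute mult.left_commute)
  then have M: "(det A)\<^sup>2 * \<bar>det (gram (g (f u)))\<bar> = \<bar>det (gram (m u))\<bar>"
    using E_unit[OF u] by (metis \<epsilon>_def abs_mult abs_power2 mult_1)
  have "k u = (\<lambda>x y. h u x y / a u)" by (simp add: k_conW(1)[OF u, abs_def])
  then have "gram (k u) = (\<chi> i. (1 / a u) *s gram (h u) $ i)"
    by (simp add: gram_def vec_eq_iff)
  then have K: "det (gram (k u)) = det (gram (h u)) / a u ^ CARD('n)"
    using det_rows_mul[of "\<lambda>_. 1 / a u" "\<lambda>i. gram (h u) $ i"] by (simp add: divide_inverse mult.commute power_inverse)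
  have "(\<chi> i j. axis j 1 $ i) = (mat 1 :: real ^ 'n ^ 'n)"
    by (simp add: vec_eq_iff mat_def axis_def)
  then have "sqrt \<bar>det (gram (g (f u)))\<bar> * (a u * \<bar>det A\<bar>) = sqrt \<bar>det (gram (k u))\<bar>"
    using vol[of "\<lambda>k. axis k 1"] a_pos[OF u] by (simp add: dW abs_mult)
  then have "(sqrt \<bar>det (gram (g (f u)))\<bar> * (a u * \<bar>det A\<bar>))\<^sup>2 = (sqrt \<bar>det (gram (k u))\<bar>)\<^sup>2" by simp
  then have "(a u)\<^sup>2 * ((det A)\<^sup>2 * \<bar>det (gram (g (f u)))\<bar>) = \<bar>det (gram (k u))\<bar>"
    by (simp add: power_mult_distrib mult_ac)
  then have "(a u)\<^sup>2 * \<bar>det (gram (m u))\<bar> = \<bar>gk u\<bar> * \<bar>det (gram (m u))\<bar> / a u ^ CARD('n)"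
    using a_pos[OF u] by (simp add: M K abs_det_gram_h[OF u])
  then have "a u ^ (CARD('n) + 2) * \<bar>det (gram (m u))\<bar> = \<bar>gk u\<bar> * \<bar>det (gram (m u))\<bar>"
    using a_pos[OF u] by (simp add: field_simps power_add power2_eq_square)
  moreover have "det (gram (m u)) \<noteq> 0" using inv_m[OF u] by (simp add: invertible_det_nz)
  ultimately show ?thesis by simp
qed

text \<open>Since c is constant on the whole patch, D W = c D E, and this is already tangent by
  Weingarten. Splitting along \<open>W\<close> therefore has zero transversal part.\<close>

lemma shape_proportional:
  assumes u: "u \<in> U" and "c \<noteq> 0" and W: "\<And>u. u \<in> U \<Longrightarrow> W u = c *\<^sub>R E u"
  shows "- tang_coeff (L u) (W u) (D W u x) = c *\<^sub>R S u x"
proof -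
  have "((\<lambda>u. c *\<^sub>R E u) has_derivative (\<lambda>x. c *\<^sub>R frechet_derivative E (at u) x)) (at u)"
    by (intro has_derivative_scaleR_right smooth_on_has_derivative[OF smooth_E u])
  then have "(W has_derivative (\<lambda>x. c *\<^sub>R frechet_derivative E (at u) x)) (at u)"
    by (rule has_derivative_transform_within_open[OF _ open_U u]) (simp add: W)
  then have "D W u x = c *\<^sub>R D E u x"
    by (simp add: D_def frechet_derivative_at[symmetric] W[OF u] bilinear_rmul[OF bilinear_\<Gamma>[OF f_V[OF u]]] algebra_simps)
  also have "\<dots> = L u (- c *\<^sub>R S u x) + 0 *\<^sub>R W u"
    by (simp add: weingarten[OF u] linear_scale[OF linear_L[OF u]] linear_neg[OF linear_L[OF u]])
  finally have "D W u x = L u (- c *\<^sub>R S u x) + 0 *\<^sub>R W u" .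
  from decomposition_unique(1)[OF linear_L[OF u] inj_L[OF u] W_transverse[OF u] this]
  show ?thesis by simp
qed

end

section \<open>Change of charts\<close>

lemma chart_inv_eq:
  assumes "chart_on X c" and "p \<in> fst c"
  shows "chart_inv c (snd c p) = p"
proof -
  have "fst c \<subseteq> topspace X" using assms(1) by (simp add: chart_on_def openin_subset)
  then have "inj_on (snd c) (fst c)"
    using assms(1) homeomorphic_imp_injective_map by (fastforce simp: chart_on_def Int_absorb1)
  then show ?thesis using assms(2) by (simp add: chart_inv_def inv_into_f_f)
qed

lemma open_chart_image:
  assumes c: "chart_on X c" and S: "openin X S"
  shows "open (snd c ` (fst c \<inter> S))"
proof -
  have "openin (subtopology X (fst c)) (fst c \<inter> S)"
    using S by (auto simp: openin_subtopology)
  moreover have "open_map (subtopology X (fst c)) (top_of_set (snd c ` fst c)) (snd c)"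
    using c homeomorphic_imp_open_map by (auto simp: chart_on_def)
  ultimately have "openin (top_of_set (snd c ` fst c)) (snd c ` (fst c \<inter> S))"
    by (auto simp: open_map_def)
  then show ?thesis using c openin_open_trans by (auto simp: chart_on_def)
qed

lemma openin_chart_preimage:
  assumes c: "chart_on X c" and B: "open B"
  shows "openin X {p \<in> fst c. snd c p \<in> B}"
proof -
  have sub: "fst c \<subseteq> topspace X" using c by (simp add: chart_on_def openin_subset)
  have "continuous_map (subtopology X (fst c)) (top_of_set (snd c ` fst c)) (snd c)"
    using c homeomorphic_imp_continuous_map by (auto simp: chart_on_def)
  moreover have "openin (top_of_set (snd c ` fst c)) (snd c ` fst c \<inter> B)" using B by blast
  ultimately have "openin (subtopology X (fst c)) {p \<in> topspace (subtopology X (fst c)). snd c p \<in> snd c ` fst c \<inter> B}"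
    unfolding continuous_map_def by blast
  moreover have "{p \<in> topspace (subtopology X (fst c)). snd c p \<in> snd c ` fst c \<inter> B} = {p \<in> fst c. snd c p \<in> B}"
    using sub by auto
  moreover have "openin X (fst c)" using c by (simp add: chart_on_def)
  ultimately show ?thesis using openin_trans_full by metis
qed

text \<open>The chain rule in charts. With one of F and G the identity it gives the behaviour of
  tangent maps under a change of chart in the source or in the target.\<close>

lemma tangent_map_compose:
  assumes N: "open N" "snd c p \<in> N"
    and near: "\<And>u. u \<in> N \<Longrightarrow> chart_inv d (snd d (F (chart_inv c u))) = F (chart_inv c u)"
    and p: "chart_inv c (snd c p) = p"
    and F: "(snd d \<circ> F \<circ> chart_inv c) differentiable (at (snd c p))"
    and G: "(snd e \<circ> G \<circ> chart_inv d) differentiable (at (snd d (F p)))"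
  shows "tangent_map c e (G \<circ> F) p x = tangent_map d e G (F p) (tangent_map c d F p x)"
proof -
  have dF: "((snd d \<circ> F \<circ> chart_inv c) has_derivative tangent_map c d F p) (at (snd c p))"
    using F by (simp add: tangent_map_def frechet_derivative_works)
  have dG: "((snd e \<circ> G \<circ> chart_inv d) has_derivative tangent_map d e G (F p)) (at ((snd d \<circ> F \<circ> chart_inv c) (snd c p)))"
    using G by (simp add: tangent_map_def frechet_derivative_works p)
  have "((snd e \<circ> (G \<circ> F) \<circ> chart_inv c) has_derivative tangent_map d e G (F p) \<circ> tangent_map c d F p) (at (snd c p))"
    by (rule has_derivative_transform_within_open[OF diff_chain_at[OF dF dG] N]) (simp add: near)
  then show ?thesis
    unfolding tangent_map_def[of c e] by (simp add: frechet_derivative_at[symmetric])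
qed

lemma tangent_map_transition:
  assumes M: "smooth_manifold M" and d: "d \<in> atlas M" "e \<in> atlas M" and q: "q \<in> fst d" "q \<in> fst e"
  shows "tangent_map e d id q (tangent_map d e id q w) = w"
    and "linear (tangent_map d e id q)"
proof -
  have cd: "chart_on (mtop M) d" and ce: "chart_on (mtop M) e" using M d by (auto simp: smooth_manifold_def)
  have op: "open (snd d ` (fst d \<inter> fst e))" "open (snd e ` (fst e \<inter> fst d))" "open (snd d ` fst d)"
    using open_chart_image[OF cd, of "fst e"] open_chart_image[OF ce, of "fst d"] cd ce by (auto simp: chart_on_def)
  have dif: "(snd e \<circ> id \<circ> chart_inv d) differentiable (at (snd d q))"
    "(snd d \<circ> id \<circ> chart_inv e) differentiable (at (snd e q))"
    using M d q by (auto simp: smooth_manifold_def intro!: smooth_on_differentiable)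
  show "linear (tangent_map d e id q)"
    using dif(1) has_derivative_linear frechet_derivative_works unfolding tangent_map_def by blast
  have "chart_inv e (snd e (id (chart_inv d u))) = id (chart_inv d u)" if "u \<in> snd d ` (fst d \<inter> fst e)" for u
    using that by (auto simp: chart_inv_eq[OF cd] chart_inv_eq[OF ce])
  from tangent_map_compose[OF op(1) _ this chart_inv_eq[OF cd q(1)] dif(1), of d id w]
  have "tangent_map e d id q (tangent_map d e id q w) = tangent_map d d (id \<circ> id) q w"
    using q dif by simp
  also have "((snd d \<circ> (id \<circ> id) \<circ> chart_inv d) has_derivative (\<lambda>x. x)) (at (snd d q))"
    by (rule has_derivative_transform_within_open[OF has_derivative_ident op(3)]) (use q in \<open>auto simp: chart_inv_eq[OF cd]\<close>)
  then have "tangent_map d d (id \<circ> id) q w = w"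
    unfolding tangent_map_def by (simp add: frechet_derivative_at[symmetric])
  finally show "tangent_map e d id q (tangent_map d e id q w) = w" .
qed

lemma chart_at_mem:
  assumes "smooth_manifold M" and "p \<in> points M"
  shows "chart_at M p \<in> atlas M \<and> p \<in> fst (chart_at M p)"
proof -
  have "(\<Union>c\<in>atlas M. fst c) = points M" using assms(1) by (simp add: smooth_manifold_def)
  then have "\<exists>c. c \<in> atlas M \<and> p \<in> fst c" using assms(2) by blast
  then show ?thesis unfolding chart_at_def by (rule someI_ex)
qed

text \<open>An injective linear map preserves and reflects the equation
  \<open>v = L y + r t\<close>, so both definite descriptions range over the same solutions.\<close>

lemma coeff_compose:
  assumes J: "linear J" "inj J"
  shows "tang_coeff (\<lambda>x. J (L x)) (J t) (J v) = tang_coeff L t v"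
    and "transv_coeff (\<lambda>x. J (L x)) (J t) (J v) = transv_coeff L t v"
proof -
  have "J v = J (L y) + r *\<^sub>R J t \<longleftrightarrow> v = L y + r *\<^sub>R t" for y r
    using inj_eq[OF J(2), of v "L y + r *\<^sub>R t"] by (simp add: linear_add[OF J(1)] linear_scale[OF J(1)])
  then show "tang_coeff (\<lambda>x. J (L x)) (J t) (J v) = tang_coeff L t v"
    and "transv_coeff (\<lambda>x. J (L x)) (J t) (J v) = transv_coeff L t v"
    unfolding tang_coeff_def transv_coeff_def by (simp_all only:)
qed

text \<open>The set where f takes its value at p and the complement of that set are both
  open.\<close>

lemma locally_constant_imp_constant:
  assumes X: "connected_space X" and loc: "\<And>p. p \<in> topspace X \<Longrightarrow> \<exists>N. openin X N \<and> p \<in> N \<and> (\<forall>q\<in>N. f q = f p)"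
    and p: "p \<in> topspace X" "q \<in> topspace X"
  shows "f p = f q"
proof -
  have op: "openin X {r \<in> topspace X. P (f r)}" for P
  proof (subst openin_subopen, intro ballI)
    fix r assume "r \<in> {r \<in> topspace X. P (f r)}"
    then have "r \<in> topspace X" and r: "P (f r)" by auto
    from loc[OF this(1)] obtain N where N: "openin X N" "r \<in> N" and f: "\<forall>q\<in>N. f q = f r"
      by (elim exE conjE)
    have "N \<subseteq> {r \<in> topspace X. P (f r)}"
    proof
      fix q assume q: "q \<in> N"
      have "P (f q)" using r by (subst bspec[OF f q])
      then show "q \<in> {r \<in> topspace X. P (f r)}" using q openin_subset[OF N(1)] by auto
    qed
    then show "\<exists>N. openin X N \<and> r \<in> N \<and> N \<subseteq> {r \<in> topspace X. P (f r)}"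
      using N by blast
  qed
  have "topspace X - {r \<in> topspace X. f r = f p} = {r \<in> topspace X. f r \<noteq> f p}" by auto
  then have "closedin X {r \<in> topspace X. f r = f p}"
    using op[of "\<lambda>y. y \<noteq> f p"] by (simp add: closedin_def)
  then have "{r \<in> topspace X. f r = f p} = {} \<or> {r \<in> topspace X. f r = f p} = topspace X"
    using X op[of "\<lambda>y. y = f p"] by (auto simp: connected_space_clopen_in)
  then have "q \<in> {r \<in> topspace X. f r = f p}" using p by blast
  then show ?thesis by simp
qed

section \<open>From charts to the manifold\<close>

locale equiaffine_hypersurface =
  fixes M :: "('a, 'n::finite option) manifold" and \<Sigma> :: "('b, 'n) manifold"
    and g :: "('a, 'n option) form2" and \<Gamma> :: "('a, 'n option) christoffel"
    and F :: "'b \<Rightarrow> 'a"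
    and \<nu> :: "('a, 'n option) chart \<Rightarrow> 'b \<Rightarrow> real ^ 'n option \<Rightarrow> real"
    and W E :: "('b, 'a, 'n option) along" and \<kappa> :: real
  assumes card: "2 \<le> CARD('n)"
    and M: "smooth_manifold M" and \<Sigma>: "smooth_manifold \<Sigma>" and connected: "connected_space (mtop \<Sigma>)"
    and metric: "pseudo_riemannian_metric M g" and LC: "levi_civita M g \<Gamma>"
    and curvature: "\<And>c p x y z. c \<in> atlas M \<Longrightarrow> p \<in> fst c \<Longrightarrow>
      curvature \<Gamma> c p x y z = \<kappa> *\<^sub>R (g c p y z *\<^sub>R x - g c p x z *\<^sub>R y)"
    and immersion: "immersion \<Sigma> M F" and coorientation: "coorientation \<Sigma> M F \<nu>"
    and nondegenerate: "nondegenerate_hypersurface \<Sigma> M \<Gamma> F"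
    and induced: "pseudo_riemannian_metric \<Sigma> (induced_metric M g F)"
    and W: "equiaffine_normal \<Sigma> M g \<Gamma> F \<nu> W"
    and E: "unimodular_orthogonal \<Sigma> M g F \<nu> E"
begin

abbreviation dom :: "('b, 'n) chart \<Rightarrow> ('a, 'n option) chart \<Rightarrow> (real ^ 'n) set" where
  "dom c d \<equiv> snd c ` (fst c \<inter> F -` fst d)"

abbreviation loc :: "('b, 'n) chart \<Rightarrow> ('a, 'n option) chart \<Rightarrow> real ^ 'n \<Rightarrow> real ^ 'n option" where
  "loc c d \<equiv> snd d \<circ> F \<circ> chart_inv c"

lemma chart_M: "d \<in> atlas M \<Longrightarrow> chart_on (mtop M) d"
  using M by (simp add: smooth_manifold_def)

lemma chart_\<Sigma>: "c \<in> atlas \<Sigma> \<Longrightarrow> chart_on (mtop \<Sigma>) c"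
  using \<Sigma> by (simp add: smooth_manifold_def)

lemmas inv_M = chart_inv_eq[OF chart_M]
lemmas inv_\<Sigma> = chart_inv_eq[OF chart_\<Sigma>]

lemma points_\<Sigma>: "c \<in> atlas \<Sigma> \<Longrightarrow> p \<in> fst c \<Longrightarrow> p \<in> points \<Sigma>"
  using \<Sigma> by (auto simp: smooth_manifold_def)

lemma openin_preimage:
  assumes "openin (mtop M) S" shows "openin (mtop \<Sigma>) {p \<in> points \<Sigma>. F p \<in> S}"
  using immersion assms by (simp add: immersion_def smooth_map_def continuous_map_def)

lemma open_preimage_image:
  assumes c: "c \<in> atlas \<Sigma>" and S: "openin (mtop M) S"
  shows "open (snd c ` (fst c \<inter> F -` S))"
proof -
  have "fst c \<inter> F -` S = fst c \<inter> {p \<in> points \<Sigma>. F p \<in> S}" using points_\<Sigma>[OF c] by auto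
  then show ?thesis using open_chart_image[OF chart_\<Sigma>[OF c] openin_preimage[OF S]] by simp
qed

lemma openin_chart_M: "d \<in> atlas M \<Longrightarrow> openin (mtop M) (fst d)"
  using chart_M by (simp add: chart_on_def)

lemma open_dom: "c \<in> atlas \<Sigma> \<Longrightarrow> d \<in> atlas M \<Longrightarrow> open (dom c d)"
  by (rule open_preimage_image[OF _ openin_chart_M])

lemma open_chart_range: "d \<in> atlas M \<Longrightarrow> open (snd d ` fst d)"
  using chart_M by (simp add: chart_on_def)

lemma smooth_loc: "c \<in> atlas \<Sigma> \<Longrightarrow> d \<in> atlas M \<Longrightarrow> smooth_on (dom c d) (loc c d)"
  using immersion by (simp add: immersion_def smooth_map_def)

lemma chart_at_\<Sigma>: "p \<in> points \<Sigma> \<Longrightarrow> chart_at \<Sigma> p \<in> atlas \<Sigma> \<and> p \<in> fst (chart_at \<Sigma> p)"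
  by (rule chart_at_mem[OF \<Sigma>])

lemma chart_at_M:
  assumes "p \<in> points \<Sigma>"
  shows "chart_at M (F p) \<in> atlas M \<and> F p \<in> fst (chart_at M (F p))"
proof -
  have "F p \<in> points M"
    using immersion assms by (auto simp: immersion_def smooth_map_def continuous_map_def)
  then show ?thesis by (rule chart_at_mem[OF M])
qed

lemma tangent_map_M:
  assumes c: "c \<in> atlas \<Sigma>" "p \<in> fst c" and d: "d \<in> atlas M" "e \<in> atlas M" and Fp: "F p \<in> fst d" "F p \<in> fst e"
  shows "tangent_map c e F p x = tangent_map d e id (F p) (tangent_map c d F p x)"
proof -
  have "tangent_map c e (id \<circ> F) p x = tangent_map d e id (F p) (tangent_map c d F p x)"
  proof (rule tangent_map_compose)
    show "open (dom c d)" by (rule open_dom[OF c(1) d(1)])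
    show "snd c p \<in> dom c d" using c Fp by auto
    show "chart_inv d (snd d (F (chart_inv c u))) = F (chart_inv c u)" if "u \<in> dom c d" for u
      using that by (auto simp: inv_\<Sigma>[OF c(1)] inv_M[OF d(1)])
    show "chart_inv c (snd c p) = p" by (rule inv_\<Sigma>[OF c])
    show "loc c d differentiable at (snd c p)"
      using smooth_on_differentiable[OF smooth_loc[OF c(1) d(1)]] c Fp by auto
    show "(snd e \<circ> id \<circ> chart_inv d) differentiable at (snd d (F p))"
      using M d Fp by (auto simp: smooth_manifold_def intro!: smooth_on_differentiable)
  qed
  then show ?thesis by simp
qed

lemma tangent_map_\<Sigma>:
  assumes c: "c \<in> atlas \<Sigma>" "p \<in> fst c" and c': "c' \<in> atlas \<Sigma>" "p \<in> fst c'" and d: "d \<in> atlas M" "F p \<in> fst d"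
  shows "tangent_map c d F p x = tangent_map c' d F p (tangent_map c c' id p x)"
proof -
  have "tangent_map c d (F \<circ> id) p x = tangent_map c' d F (id p) (tangent_map c c' id p x)"
  proof (rule tangent_map_compose)
    show "open (snd c ` (fst c \<inter> fst c'))"
      using open_chart_image[OF chart_\<Sigma>[OF c(1)], of "fst c'"] chart_\<Sigma>[OF c'(1)] by (simp add: chart_on_def)
    show "snd c p \<in> snd c ` (fst c \<inter> fst c')" using c c' by auto
    show "chart_inv c' (snd c' (id (chart_inv c u))) = id (chart_inv c u)" if "u \<in> snd c ` (fst c \<inter> fst c')" for u
      using that by (auto simp: inv_\<Sigma>[OF c(1)] inv_\<Sigma>[OF c'(1)])
    show "chart_inv c (snd c p) = p" by (rule inv_\<Sigma>[OF c])
    show "(snd c' \<circ> id \<circ> chart_inv c) differentiable at (snd c p)"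
      using \<Sigma> c c' by (auto simp: smooth_manifold_def intro!: smooth_on_differentiable)
    show "loc c' d differentiable at (snd c' (id p))"
      using smooth_on_differentiable[OF smooth_loc[OF c'(1) d(1)]] c' d by auto
  qed
  then show ?thesis by simp
qed

lemma inj_transition:
  assumes "d \<in> atlas M" "e \<in> atlas M" "q \<in> fst d" "q \<in> fst e"
  shows "inj (tangent_map d e id q)"
  using tangent_map_transition(1)[OF M assms] by (metis injI)

text \<open>The covariant derivative along \<open>F\<close> is a vector: the product rule produces a
  derivative of the transition Jacobian, and the inhomogeneous term in the transformation law of
  \<open>\<Gamma>\<close> cancels it.\<close>

lemma cov_along_M:
  assumes c: "c \<in> atlas \<Sigma>" "p \<in> fst c" and d: "d \<in> atlas M" "e \<in> atlas M" and Fp: "F p \<in> fst d" "F p \<in> fst e"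
    and Z: "(\<lambda>u. Z (chart_inv c u)) differentiable (at (snd c p))"
    and Z': "\<And>q. q \<in> fst c \<Longrightarrow> F q \<in> fst d \<Longrightarrow> F q \<in> fst e \<Longrightarrow> Z' q = tangent_map d e id (F q) (Z q)"
  shows "cov_along \<Gamma> F c e p x Z' = tangent_map d e id (F p) (cov_along \<Gamma> F c d p x Z)"
proof -
  let ?\<phi> = "snd e \<circ> id \<circ> chart_inv d" and ?f = "loc c d" and ?u = "snd c p"
  let ?A = "\<lambda>v. frechet_derivative ?\<phi> (at v)" and ?V = "snd d ` (fst d \<inter> fst e)"
  have V: "open ?V" using open_chart_image[OF chart_M[OF d(1)] openin_chart_M[OF d(2)]] .
  have sm: "smooth_on ?V ?\<phi>" using M d by (simp add: smooth_manifold_def)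
  have fu: "?f ?u = snd d (F p)" by (simp add: inv_\<Sigma>[OF c])
  have fV: "?f ?u \<in> ?V" using Fp unfolding fu by blast
  have A: "?A (snd d q) = tangent_map d e id q" for q by (simp add: tangent_map_def)
  have f: "(?f has_derivative tangent_map c d F p) (at ?u)"
    unfolding tangent_map_def using smooth_on_has_derivative[OF smooth_loc[OF c(1) d(1)]] c Fp by auto
  have dZ: "((\<lambda>u. Z (chart_inv c u)) has_derivative frechet_derivative (\<lambda>u. Z (chart_inv c u)) (at ?u)) (at ?u)"
    using Z by (simp add: frechet_derivative_works)
  have lin: "linear (?A v)" if "v \<in> ?V" for v
    using smooth_on_has_derivative[OF sm that] has_derivative_linear by blast
  have "((\<lambda>u. ?A (?f u) (Z (chart_inv c u))) has_derivative
     (\<lambda>h. frechet_derivative (\<lambda>v. ?A v (Z (chart_inv c ?u))) (at (?f ?u)) (tangent_map c d F p h)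
        + ?A (?f ?u) (frechet_derivative (\<lambda>u. Z (chart_inv c u)) (at ?u) h))) (at ?u)"
    by (rule has_derivative_linear_family[OF V fV lin
          smooth_on_differentiable[OF smooth_on_frechet_derivative[OF sm] fV] f dZ])
  then have "((\<lambda>u. Z' (chart_inv c u)) has_derivative
     (\<lambda>h. frechet_derivative (\<lambda>v. ?A v (Z (chart_inv c ?u))) (at (?f ?u)) (tangent_map c d F p h)
        + ?A (?f ?u) (frechet_derivative (\<lambda>u. Z (chart_inv c u)) (at ?u) h))) (at ?u)"
  proof (rule has_derivative_transform_within_open)
    show "open (snd c ` (fst c \<inter> F -` (fst d \<inter> fst e)))"
      by (rule open_preimage_image[OF c(1) openin_Int[OF openin_chart_M openin_chart_M]]) fact+
    show "?u \<in> snd c ` (fst c \<inter> F -` (fst d \<inter> fst e))" using c Fp by auto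
    show "?A (?f u) (Z (chart_inv c u)) = Z' (chart_inv c u)" if "u \<in> snd c ` (fst c \<inter> F -` (fst d \<inter> fst e))" for u
      using that by (auto simp: inv_\<Sigma>[OF c(1)] Z' A[simplified])
  qed
  then have dZ': "frechet_derivative (\<lambda>u. Z' (chart_inv c u)) (at ?u) x =
      frechet_derivative (\<lambda>v. ?A v (Z p)) (at (snd d (F p))) (tangent_map c d F p x)
        + tangent_map d e id (F p) (frechet_derivative (\<lambda>u. Z (chart_inv c u)) (at ?u) x)"
    by (simp add: frechet_derivative_at[symmetric] inv_\<Sigma>[OF c] A[simplified])
  \<comment> \<open>The same Jacobian is written in two ways, with base point v or
    \<open>chart_inv d v\<close>; they agree on the overlap of the charts, hence have the same
    derivative.\<close>
  have "frechet_derivative (\<lambda>v. ?A v (Z p)) (at (snd d (F p)))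
      = frechet_derivative (\<lambda>v. tangent_map d e id (chart_inv d v) (Z p)) (at (snd d (F p)))"
  proof (rule frechet_derivative_transform_within_open[OF _ V])
    show "(\<lambda>v. ?A v (Z p)) differentiable at (snd d (F p))"
      using smooth_on_differentiable[OF smooth_on_frechet_derivative[OF sm] fV] unfolding fu .
    show "snd d (F p) \<in> ?V" using Fp by auto
    show "?A v (Z p) = tangent_map d e id (chart_inv d v) (Z p)" if "v \<in> ?V" for v
      using that by (auto simp: tangent_map_def inv_M[OF d(1)])
  qed
  moreover have "\<Gamma> e (F p) (tangent_map d e id (F p) v) (tangent_map d e id (F p) w) =
          tangent_map d e id (F p) (\<Gamma> d (F p) v w)
          - frechet_derivative (\<lambda>u. tangent_map d e id (chart_inv d u) w) (at (snd d (F p))) v" for v w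
    using LC d Fp by (simp add: levi_civita_def affine_connection_def)
  ultimately show ?thesis
    using linear_add[OF tangent_map_transition(2)[OF M d Fp]]
    by (simp add: cov_along_def dZ' tangent_map_M[OF c d Fp] Z' c Fp)
qed

text \<open>Only the direction x transforms, by the chain rule: the components of Z refer to the
  ambient chart, which is kept.\<close>

lemma cov_along_\<Sigma>:
  assumes c: "c \<in> atlas \<Sigma>" "p \<in> fst c" and c': "c' \<in> atlas \<Sigma>" "p \<in> fst c'" and d: "d \<in> atlas M" "F p \<in> fst d"
    and Z: "(\<lambda>u. Z (chart_inv c' u)) differentiable (at (snd c' p))"
  shows "cov_along \<Gamma> F c d p x Z = cov_along \<Gamma> F c' d p (tangent_map c c' id p x) Z"
proof -
  let ?\<psi> = "snd c' \<circ> id \<circ> chart_inv c" and ?V = "snd c ` (fst c \<inter> fst c')"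
  have V: "open ?V"
    using open_chart_image[OF chart_\<Sigma>[OF c(1)], of "fst c'"] chart_\<Sigma>[OF c'(1)] by (simp add: chart_on_def)
  have sm: "smooth_on ?V ?\<psi>" using \<Sigma> c c' by (simp add: smooth_manifold_def)
  have uV: "snd c p \<in> ?V" using c c' by auto
  have 1: "(?\<psi> has_derivative tangent_map c c' id p) (at (snd c p))"
    unfolding tangent_map_def by (rule smooth_on_has_derivative[OF sm uV])
  have 2: "((\<lambda>u. Z (chart_inv c' u)) has_derivative frechet_derivative (\<lambda>u. Z (chart_inv c' u)) (at (snd c' p))) (at (?\<psi> (snd c p)))"
    using Z by (simp add: frechet_derivative_works inv_\<Sigma>[OF c])
  have "((\<lambda>u. Z (chart_inv c u)) has_derivative
      frechet_derivative (\<lambda>u. Z (chart_inv c' u)) (at (snd c' p)) \<circ> tangent_map c c' id p) (at (snd c p))"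
    by (rule has_derivative_transform_within_open[OF diff_chain_at[OF 1 2] V uV])
       (auto simp: inv_\<Sigma>[OF c(1)] inv_\<Sigma>[OF c'(1)])
  then show ?thesis
    by (simp add: cov_along_def frechet_derivative_at[symmetric] tangent_map_\<Sigma>[OF c c' d])
qed

lemma differentiable_pushforward:
  assumes c: "c \<in> atlas \<Sigma>" "p \<in> fst c" and d: "d \<in> atlas M" "F p \<in> fst d"
  shows "((\<lambda>u. tangent_map c d F (chart_inv c u) y) has_derivative
      frechet_derivative (\<lambda>u. frechet_derivative (loc c d) (at u) y) (at (snd c p))) (at (snd c p))"
proof (rule has_derivative_transform_within_open[OF _ open_dom[OF c(1) d(1)]])
  show u: "snd c p \<in> dom c d" using c d by auto
  show "((\<lambda>u. frechet_derivative (loc c d) (at u) y) has_derivative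
      frechet_derivative (\<lambda>u. frechet_derivative (loc c d) (at u) y) (at (snd c p))) (at (snd c p))"
    by (rule smooth_on_has_derivative[OF smooth_on_frechet_derivative[OF smooth_loc[OF c(1) d(1)]] u])
  show "frechet_derivative (loc c d) (at u) y = tangent_map c d F (chart_inv c u) y" if "u \<in> dom c d" for u
    using that by (auto simp: tangent_map_def inv_\<Sigma>[OF c(1)])
qed

lemma differentiable_along:
  assumes T: "field_along \<Sigma> M F T" and c: "c \<in> atlas \<Sigma>" "p \<in> fst c" and d: "d \<in> atlas M" "F p \<in> fst d"
  shows "(\<lambda>u. T d (chart_inv c u)) differentiable (at (snd c p))"
  using T c d by (auto simp: field_along_def intro!: smooth_on_differentiable[of "dom c d"])

lemma along_transition:
  assumes T: "field_along \<Sigma> M F T" and c: "c \<in> atlas \<Sigma>" "p \<in> fst c"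
    and d: "d \<in> atlas M" "e \<in> atlas M" and Fp: "F p \<in> fst d" "F p \<in> fst e"
  shows "T e p = tangent_map d e id (F p) (T d p)"
proof -
  have "\<forall>d\<in>atlas M. \<forall>e\<in>atlas M. \<forall>p\<in>points \<Sigma> \<inter> F -` (fst d \<inter> fst e).
      T e p = tangent_map d e id (F p) (T d p)"
    using T unfolding field_along_def by (rule conjunct2)
  moreover have "p \<in> points \<Sigma> \<inter> F -` (fst d \<inter> fst e)" using Fp points_\<Sigma>[OF c] by simp
  ultimately show ?thesis using d by blast
qed

text \<open>The definitions compute in \<open>chart_at M (F p)\<close>, which may jump with p. Here
  the same values are obtained in any fixed chart \<open>d\<close>, so that they can be compared at
  neighbouring points and differentiated.\<close>

lemma induced_any_chart:
  assumes T: "field_along \<Sigma> M F T" and c: "c \<in> atlas \<Sigma>" "p \<in> fst c" and d: "d \<in> atlas M" "F p \<in> fst d"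
  shows "induced_tensor M \<Gamma> F T c p x y =
      transv_coeff (tangent_map c d F p) (T d p) (cov_along \<Gamma> F c d p x (\<lambda>q. tangent_map c d F q y))" (is ?A)
    and "induced_connection M \<Gamma> F T c p x y =
      tang_coeff (tangent_map c d F p) (T d p) (cov_along \<Gamma> F c d p x (\<lambda>q. tangent_map c d F q y))" (is ?B)
    and "shape_operator M \<Gamma> F T c p x =
      - tang_coeff (tangent_map c d F p) (T d p) (cov_along \<Gamma> F c d p x (T d))" (is ?C)
    and "induced_metric M g F c p x y = g d (F p) (tangent_map c d F p x) (tangent_map c d F p y)" (is ?D)
proof -
  let ?e = "chart_at M (F p)"
  have e: "?e \<in> atlas M" "F p \<in> fst ?e" using chart_at_M[OF points_\<Sigma>[OF c]] by auto
  let ?J = "tangent_map d ?e id (F p)"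
  have J: "linear ?J" "inj ?J"
    using tangent_map_transition(2)[OF M d(1) e(1) d(2) e(2)] inj_transition[OF d(1) e(1) d(2) e(2)] by auto
  have L: "tangent_map c ?e F p = (\<lambda>x. ?J (tangent_map c d F p x))"
    using tangent_map_M[OF c d(1) e(1) d(2) e(2)] by blast
  have Te: "T ?e p = ?J (T d p)" by (rule along_transition[OF T c d(1) e(1) d(2) e(2)])
  have 1: "cov_along \<Gamma> F c ?e p x (\<lambda>q. tangent_map c ?e F q y) = ?J (cov_along \<Gamma> F c d p x (\<lambda>q. tangent_map c d F q y))"
    by (rule cov_along_M[OF c d(1) e(1) d(2) e(2) differentiableI[OF differentiable_pushforward[OF c d]]])
       (rule tangent_map_M[OF c(1) _ d(1) e(1)])
  have 2: "cov_along \<Gamma> F c ?e p x (T ?e) = ?J (cov_along \<Gamma> F c d p x (T d))"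
    by (rule cov_along_M[OF c d(1) e(1) d(2) e(2) differentiable_along[OF T c d]])
       (rule along_transition[OF T c(1) _ d(1) e(1)])
  show ?A ?B ?C
    unfolding induced_tensor_def induced_connection_def shape_operator_def Let_def L Te 1 2 coeff_compose[OF J]
    by (rule refl)+
  have "\<forall>c\<in>atlas M. \<forall>d\<in>atlas M. \<forall>p\<in>fst c \<inter> fst d. \<forall>v w.
      g c p v w = g d p (tangent_map c d id p v) (tangent_map c d id p w)"
    using metric unfolding pseudo_riemannian_metric_def by (elim conjE)
  then have "g d (F p) v w = g ?e (F p) (?J v) (?J w)" for v w
    using d e by blast
  then show ?D
    unfolding induced_metric_def Let_def L by (rule sym)
qed

lemma field_along_E: "field_along \<Sigma> M F E"
  using E by (simp add: unimodular_orthogonal_def)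

lemma field_along_W: "field_along \<Sigma> M F W"
  using W by (simp add: equiaffine_normal_def)

lemma ambient_patch:
  assumes c: "c \<in> atlas \<Sigma>" and d: "d \<in> atlas M"
  shows "metric_patch (dom c d) (snd d ` fst d) (loc c d) (\<lambda>v. g d (chart_inv d v)) (\<lambda>v. \<Gamma> d (chart_inv d v))"
proof
  show "open (dom c d)" by (rule open_dom[OF c d])
  show "open (snd d ` fst d)" by (rule open_chart_range[OF d])
  show "loc c d ` dom c d \<subseteq> snd d ` fst d" by (auto simp: inv_\<Sigma>[OF c])
  show "smooth_on (dom c d) (loc c d)" by (rule smooth_loc[OF c d])
  show "smooth_on (snd d ` fst d) (\<lambda>v. \<Gamma> d (chart_inv d v) x y)" for x y
    using LC d by (simp add: levi_civita_def affine_connection_def)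
  show "smooth_on (snd d ` fst d) (\<lambda>v. g d (chart_inv d v) x y)" for x y
    using metric d by (simp add: pseudo_riemannian_metric_def)
  fix v assume "v \<in> snd d ` fst d"
  then obtain q where q: "q \<in> fst d" and v: "v = snd d q" by auto
  have [simp]: "chart_inv d v = q" using inv_M[OF d q] by (simp add: v)
  have gq: "bilinear (g d q) \<and> (\<forall>v w. g d q v w = g d q w v) \<and> nondegenerate_form (g d q)"
    using metric d q unfolding pseudo_riemannian_metric_def by blast
  show "bilinear (\<Gamma> d (chart_inv d v))"
    using LC d q by (simp add: levi_civita_def affine_connection_def)
  show "bilinear (g d (chart_inv d v))" using gq by simp
  show "g d (chart_inv d v) x y = g d (chart_inv d v) y x" for x y
    unfolding \<open>chart_inv d v = q\<close> using gq by blast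
  have "torsion_free M \<Gamma>" using LC by (simp add: levi_civita_def)
  then show "\<Gamma> d (chart_inv d v) x y = \<Gamma> d (chart_inv d v) y x" for x y
    unfolding \<open>chart_inv d v = q\<close> torsion_free_def using d q by blast
  have "cov_deriv_form \<Gamma> g d q x y z = 0" for x y z
    using LC d q by (simp add: levi_civita_def)
  then show "frechet_derivative (\<lambda>v. g d (chart_inv d v) y z) (at v) x
     = g d (chart_inv d v) (\<Gamma> d (chart_inv d v) x y) z + g d (chart_inv d v) y (\<Gamma> d (chart_inv d v) x z)" for x y z
    by (simp add: cov_deriv_form_def v[symmetric] algebra_simps)
qed

lemma hypersurface_patch:
  assumes c: "c \<in> atlas \<Sigma>" and d: "d \<in> atlas M"
  shows "hypersurface_patch (dom c d) (snd d ` fst d) (loc c d) (\<lambda>v. g d (chart_inv d v)) (\<lambda>v. \<Gamma> d (chart_inv d v))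
    (\<lambda>u. E d (chart_inv c u)) \<kappa>"
proof -
  interpret metric_patch "dom c d" "snd d ` fst d" "loc c d" "\<lambda>v. g d (chart_inv d v)" "\<lambda>v. \<Gamma> d (chart_inv d v)"
    by (rule ambient_patch[OF c d])
  show ?thesis
  proof
    show "DIM(real ^ 'n option) = Suc DIM(real ^ 'n)"
      by (simp add: UNIV_option_conv card_image)
    show "R v x y z = \<kappa> *\<^sub>R (g d (chart_inv d v) y z *\<^sub>R x - g d (chart_inv d v) x z *\<^sub>R y)"
      if "v \<in> snd d ` fst d" for v x y z
    proof -
      obtain q where q: "q \<in> fst d" and v: "v = snd d q" using \<open>v \<in> snd d ` fst d\<close> by auto
      have "R v x y z = curvature \<Gamma> d q x y z"
        by (simp add: R_def curvature_def v inv_M[OF d q])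
      then show ?thesis using curvature[OF d q] by (simp add: v inv_M[OF d q])
    qed
    show "smooth_on (dom c d) (\<lambda>u. E d (chart_inv c u))"
      using field_along_E c d by (simp add: field_along_def)
    fix u assume "u \<in> dom c d"
    then obtain p where p: "p \<in> fst c" "F p \<in> fst d" and u: "u = snd c p" by auto
    have [simp]: "chart_inv c u = p" "loc c d u = snd d (F p)" "chart_inv d (snd d (F p)) = F p"
      by (simp_all add: u inv_\<Sigma>[OF c p(1)] inv_M[OF d p(2)])
    have L: "frechet_derivative (loc c d) (at u) = tangent_map c d F p" by (simp add: tangent_map_def u)
    show "inj (frechet_derivative (loc c d) (at u))"
      unfolding L using immersion c d p by (simp add: immersion_def)
    have Ep: "(\<forall>x. g d (F p) (E d p) (tangent_map c d F p x) = 0) \<and> \<bar>g d (F p) (E d p) (E d p)\<bar> = 1"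
      using E c d p by (simp add: unimodular_orthogonal_def)
    show "g d (chart_inv d (loc c d u)) (E d (chart_inv c u)) (frechet_derivative (loc c d) (at u) x) = 0" for x
      unfolding L using Ep by (simp del: o_apply)
    show "\<bar>g d (chart_inv d (loc c d u)) (E d (chart_inv c u)) (E d (chart_inv c u))\<bar> = 1"
      using Ep by (simp del: o_apply)
  qed
qed

lemma cov_along_eq_D:
  assumes c: "c \<in> atlas \<Sigma>" "p \<in> fst c" and d: "d \<in> atlas M" "F p \<in> fst d"
  shows "cov_along \<Gamma> F c d p x Z =
    metric_patch.D (loc c d) (\<lambda>v. \<Gamma> d (chart_inv d v)) (\<lambda>u. Z (chart_inv c u)) (snd c p) x"
  unfolding metric_patch.D_def[OF ambient_patch[OF c(1) d(1)]]
  by (simp add: cov_along_def tangent_map_def inv_\<Sigma>[OF c] inv_M[OF d])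

lemma cov_along_pushforward:
  assumes c: "c \<in> atlas \<Sigma>" "p \<in> fst c" and d: "d \<in> atlas M" "F p \<in> fst d"
  shows "cov_along \<Gamma> F c d p x (\<lambda>q. tangent_map c d F q y) =
    metric_patch.D (loc c d) (\<lambda>v. \<Gamma> d (chart_inv d v)) (\<lambda>u. frechet_derivative (loc c d) (at u) y) (snd c p) x"
  unfolding metric_patch.D_def[OF ambient_patch[OF c(1) d(1)]] cov_along_def
    frechet_derivative_at[OF differentiable_pushforward[OF c d], symmetric]
  by (simp add: tangent_map_def inv_\<Sigma>[OF c] inv_M[OF d])

lemma patch_tensors:
  assumes c: "c \<in> atlas \<Sigma>" "p \<in> fst c" and d: "d \<in> atlas M" "F p \<in> fst d"
  shows "hypersurface_patch.h (loc c d) (\<lambda>v. \<Gamma> d (chart_inv d v)) (\<lambda>u. E d (chart_inv c u)) (snd c p)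
      = induced_tensor M \<Gamma> F E c p"
    and "hypersurface_patch.S (loc c d) (\<lambda>v. \<Gamma> d (chart_inv d v)) (\<lambda>u. E d (chart_inv c u)) (snd c p)
      = shape_operator M \<Gamma> F E c p"
    and "hypersurface_patch.m (loc c d) (\<lambda>v. g d (chart_inv d v)) (snd c p) = induced_metric M g F c p"
proof -
  interpret hypersurface_patch "dom c d" "snd d ` fst d" "loc c d" "\<lambda>v. g d (chart_inv d v)"
    "\<lambda>v. \<Gamma> d (chart_inv d v)" "\<lambda>u. E d (chart_inv c u)" \<kappa>
    by (rule hypersurface_patch[OF c(1) d(1)])
  have L: "frechet_derivative (loc c d) (at (snd c p)) = tangent_map c d F p" by (simp add: tangent_map_def)
  note ind = induced_any_chart[OF field_along_E c d]
  show "h (snd c p) = induced_tensor M \<Gamma> F E c p"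
    by (intro ext) (simp only: h_def L ind(1) cov_along_pushforward[OF c d] inv_\<Sigma>[OF c])
  show "S (snd c p) = shape_operator M \<Gamma> F E c p"
    by (intro ext) (simp only: S_def L ind(3) cov_along_eq_D[OF c d] inv_\<Sigma>[OF c])
  show "m (snd c p) = induced_metric M g F c p"
    by (intro ext) (simp only: m_def L ind(4) o_apply inv_\<Sigma>[OF c] inv_M[OF d])
qed

lemma hypersurface_coords:
  assumes c: "c \<in> atlas \<Sigma>" and d: "d \<in> atlas M"
  shows "hypersurface_coords (dom c d) (snd d ` fst d) (loc c d) (\<lambda>v. g d (chart_inv d v)) (\<lambda>v. \<Gamma> d (chart_inv d v))
    (\<lambda>u. E d (chart_inv c u)) \<kappa>"
proof -
  interpret hypersurface_patch "dom c d" "snd d ` fst d" "loc c d" "\<lambda>v. g d (chart_inv d v)"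
    "\<lambda>v. \<Gamma> d (chart_inv d v)" "\<lambda>u. E d (chart_inv c u)" \<kappa>
    by (rule hypersurface_patch[OF c d])
  show ?thesis
  proof
    fix u assume "u \<in> dom c d"
    then obtain p where p: "p \<in> fst c" "F p \<in> fst d" and u: "u = snd c p" by auto
    let ?e = "chart_at M (F p)"
    have e: "?e \<in> atlas M" "F p \<in> fst ?e" using chart_at_M[OF points_\<Sigma>[OF c p(1)]] by auto
    \<comment> \<open>The nondegeneracy hypothesis asks for transversality in the chosen chart
      \<open>?e\<close>, not in \<open>d\<close>; hence the second patch.\<close>
    have "E ?e p \<notin> range (tangent_map c ?e F p)"
      using hypersurface_patch.E_transverse[OF hypersurface_patch[OF c e(1)], of u] p e
      by (auto simp: u inv_\<Sigma>[OF c p(1)] tangent_map_def)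
    then show "nondegenerate_form (h u)"
      unfolding u patch_tensors(1)[OF c p(1) d p(2)]
      using nondegenerate c p unfolding nondegenerate_hypersurface_def by blast
    show "nondegenerate_form (m u)"
      unfolding u patch_tensors(3)[OF c p(1) d p(2)]
      using induced c p unfolding pseudo_riemannian_metric_def by blast
  qed
qed

lemma equiaffine_coords:
  assumes c: "c \<in> atlas \<Sigma>" and d: "d \<in> atlas M"
  shows "equiaffine_coords (dom c d) (snd d ` fst d) (loc c d) (\<lambda>v. g d (chart_inv d v)) (\<lambda>v. \<Gamma> d (chart_inv d v))
    (\<lambda>u. E d (chart_inv c u)) \<kappa> (\<lambda>u. W d (chart_inv c u))"
proof -
  interpret hypersurface_coords "dom c d" "snd d ` fst d" "loc c d" "\<lambda>v. g d (chart_inv d v)"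
    "\<lambda>v. \<Gamma> d (chart_inv d v)" "\<lambda>u. E d (chart_inv c u)" \<kappa>
    by (rule hypersurface_coords[OF c d])
  show ?thesis
  proof
    show "2 \<le> CARD('n)" by (rule card)
    show "smooth_on (dom c d) (\<lambda>u. W d (chart_inv c u))"
      using field_along_W c d by (simp add: field_along_def)
    fix u assume uU: "u \<in> dom c d"
    then obtain p where p: "p \<in> fst c" "F p \<in> fst d" and u: "u = snd c p" by auto
    have cp: "chart_inv c u = p" by (simp add: u inv_\<Sigma>[OF c p(1)])
    have pts: "p \<in> points \<Sigma> \<inter> F -` fst d" using points_\<Sigma>[OF c p(1)] p by simp
    let ?t = "transv_coeff (L u) (E d (chart_inv c u)) (W d (chart_inv c u))"
    have "\<forall>d\<in>atlas M. \<forall>p\<in>points \<Sigma> \<inter> F -` fst d. linear (\<nu> d p) \<and> (\<exists>v. \<nu> d p v \<noteq> 0)"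
      using coorientation unfolding coorientation_def by (elim conjE)
    moreover have co: "\<forall>c\<in>atlas \<Sigma>. \<forall>d\<in>atlas M. \<forall>p\<in>fst c \<inter> F -` fst d. \<forall>x. \<nu> d p (tangent_map c d F p x) = 0"
      using coorientation unfolding coorientation_def by (elim conjE)
    ultimately have lin: "linear (\<nu> d p)" using d pts by blast
    have ker: "\<nu> d p (tangent_map c d F p x) = 0" for x
      using co c d p by blast
    have pos: "0 < \<nu> d p (W d p)" "0 < \<nu> d p (E d p)"
      using W E d pts by (auto simp: equiaffine_normal_def unimodular_orthogonal_def cooriented_def)
    \<comment> \<open>The conormal vanishes on tangent vectors, so it sees only the multiple of
      \<open>E\<close> in \<open>W\<close>; both its values are positive.\<close>
    have "\<nu> d p (W d p) = \<nu> d p (L u (tang_coeff (L u) (E d p) (W d p)) + transv_coeff (L u) (E d p) (W d p) *\<^sub>R E d p)"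
      using decomp[OF uU, of "W d p"] unfolding cp by simp
    also have "\<dots> = transv_coeff (L u) (E d p) (W d p) * \<nu> d p (E d p)"
      using ker by (simp add: linear_add[OF lin] linear_scale[OF lin] u tangent_map_def)
    finally show "0 < ?t" using pos unfolding cp by (simp add: zero_less_mult_iff)
  qed
qed

lemma patch_equiaffine:
  assumes c: "c \<in> atlas \<Sigma>" "p \<in> fst c" and d: "d \<in> atlas M" "F p \<in> fst d"
  shows "equiaffine_coords.k (loc c d) (\<lambda>v. \<Gamma> d (chart_inv d v)) (\<lambda>u. W d (chart_inv c u)) (snd c p)
      = induced_tensor M \<Gamma> F W c p"
    and "equiaffine_coords.conW (loc c d) (\<lambda>v. \<Gamma> d (chart_inv d v)) (\<lambda>u. W d (chart_inv c u)) (snd c p)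
      = induced_connection M \<Gamma> F W c p"
proof -
  interpret equiaffine_coords "dom c d" "snd d ` fst d" "loc c d" "\<lambda>v. g d (chart_inv d v)"
    "\<lambda>v. \<Gamma> d (chart_inv d v)" "\<lambda>u. E d (chart_inv c u)" \<kappa> "\<lambda>u. W d (chart_inv c u)"
    by (rule equiaffine_coords[OF c(1) d(1)])
  have L: "frechet_derivative (loc c d) (at (snd c p)) = tangent_map c d F p" by (simp add: tangent_map_def)
  note ind = induced_any_chart[OF field_along_W c d]
  show "k (snd c p) = induced_tensor M \<Gamma> F W c p"
    by (intro ext) (simp only: k_def L ind(1) cov_along_pushforward[OF c d] inv_\<Sigma>[OF c])
  show "conW (snd c p) = induced_connection M \<Gamma> F W c p"
    by (intro ext) (simp only: conW_def L ind(2) cov_along_pushforward[OF c d] inv_\<Sigma>[OF c])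
qed

text \<open>The shape operators in two charts are conjugate by the transition Jacobian.\<close>

lemma gauss_kronecker_chart:
  assumes c: "c \<in> atlas \<Sigma>" "p \<in> fst c"
  shows "gauss_kronecker \<Sigma> M \<Gamma> F E p = det (matrix (shape_operator M \<Gamma> F E c p))"
proof -
  let ?c = "chart_at \<Sigma> p" and ?d = "chart_at M (F p)"
  have p: "p \<in> points \<Sigma>" by (rule points_\<Sigma>[OF c])
  have c': "?c \<in> atlas \<Sigma>" "p \<in> fst ?c" using chart_at_\<Sigma>[OF p] by auto
  have d: "?d \<in> atlas M" "F p \<in> fst ?d" using chart_at_M[OF p] by auto
  let ?J = "tangent_map c ?c id p" and ?S = "shape_operator M \<Gamma> F E c p" and ?S' = "shape_operator M \<Gamma> F E ?c p"
  interpret P: hypersurface_patch "dom c ?d" "snd ?d ` fst ?d" "loc c ?d" "\<lambda>v. g ?d (chart_inv ?d v)"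
    "\<lambda>v. \<Gamma> ?d (chart_inv ?d v)" "\<lambda>u. E ?d (chart_inv c u)" \<kappa>
    by (rule hypersurface_patch[OF c(1) d(1)])
  interpret P': hypersurface_patch "dom ?c ?d" "snd ?d ` fst ?d" "loc ?c ?d" "\<lambda>v. g ?d (chart_inv ?d v)"
    "\<lambda>v. \<Gamma> ?d (chart_inv ?d v)" "\<lambda>u. E ?d (chart_inv ?c u)" \<kappa>
    by (rule hypersurface_patch[OF c'(1) d(1)])
  have u: "snd c p \<in> dom c ?d" "snd ?c p \<in> dom ?c ?d" using c c' d by auto
  have linJ: "linear ?J" by (rule tangent_map_transition(2)[OF \<Sigma> c(1) c'(1) c(2) c'(2)])
  have linS: "linear ?S" "linear ?S'"
    using P.linear_S[OF u(1)] P'.linear_S[OF u(2)] patch_tensors(2)[OF c d] patch_tensors(2)[OF c' d] by simp_all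
  have L: "frechet_derivative (loc c ?d) (at (snd c p)) = tangent_map c ?d F p"
    "frechet_derivative (loc ?c ?d) (at (snd ?c p)) = tangent_map ?c ?d F p"
    by (simp_all add: tangent_map_def)
  have DE: "cov_along \<Gamma> F c ?d p x (E ?d) = - tangent_map c ?d F p (?S x)"
    "cov_along \<Gamma> F ?c ?d p x (E ?d) = - tangent_map ?c ?d F p (?S' x)" for x
    using P.weingarten[OF u(1), of x] P'.weingarten[OF u(2), of x]
    unfolding patch_tensors(2)[OF c d] patch_tensors(2)[OF c' d] L cov_along_eq_D[OF c d] cov_along_eq_D[OF c' d]
    by simp_all
  have "?S' (?J x) = ?J (?S x)" for x
  proof -
    have "tangent_map ?c ?d F p (?S' (?J x)) = - cov_along \<Gamma> F ?c ?d p (?J x) (E ?d)"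
      by (simp add: DE)
    also have "\<dots> = - cov_along \<Gamma> F c ?d p x (E ?d)"
      using cov_along_\<Sigma>[OF c c' d differentiable_along[OF field_along_E c' d]] by simp
    also have "\<dots> = tangent_map ?c ?d F p (?J (?S x))"
      using tangent_map_\<Sigma>[OF c c' d] by (simp add: DE)
    finally show ?thesis using P'.inj_L[OF u(2)] unfolding L by (simp add: inj_eq)
  qed
  then have "?S' \<circ> ?J = ?J \<circ> ?S" by auto
  then have "matrix ?S' ** matrix ?J = matrix ?J ** matrix ?S"
    using matrix_compose[OF linJ linS(2)] matrix_compose[OF linS(1) linJ] by simp
  then have "det (matrix ?S') * det (matrix ?J) = det (matrix ?S) * det (matrix ?J)"
    by (metis det_mul mult.commute)
  moreover have "det (matrix ?J) \<noteq> 0"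
  proof -
    have "inj ?J" using tangent_map_transition(1)[OF \<Sigma> c(1) c'(1) c(2) c'(2)] by (metis injI)
    then show ?thesis using det_nz_iff_inj[OF linJ] by blast
  qed
  ultimately show ?thesis by (simp add: gauss_kronecker_def)
qed

text \<open>The interface between coordinates and the manifold, phrased in global notions so that
  both implications can be argued without the locales. The clause on K' carries both directions; the
  last clause asks for proportionality on the whole patch because \<open>W\<close> gets
  differentiated.\<close>

lemma patch_decomposition:
  assumes c: "c \<in> atlas \<Sigma>" and d: "d \<in> atlas M"
  obtains a :: "real ^ 'n \<Rightarrow> real" and Z :: "real ^ 'n \<Rightarrow> real ^ 'n" and K :: "real ^ 'n \<Rightarrow> real"
  where "\<And>p. p \<in> fst c \<Longrightarrow> F p \<in> fst d \<Longrightarrow>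
      W d p = tangent_map c d F p (Z (snd c p)) + a (snd c p) *\<^sub>R E d p"
    and "\<And>u. u \<in> dom c d \<Longrightarrow> 0 < a u" and "\<And>u. u \<in> dom c d \<Longrightarrow> a u ^ (CARD('n) + 2) = \<bar>K u\<bar>"
    and "\<And>p r. p \<in> fst c \<Longrightarrow> F p \<in> fst d \<Longrightarrow> W d p = r *\<^sub>R E d p \<Longrightarrow> Z (snd c p) = 0"
    and "\<And>p. p \<in> fst c \<Longrightarrow> F p \<in> fst d \<Longrightarrow> K (snd c p) = gauss_kronecker \<Sigma> M \<Gamma> F E p"
    and "\<And>u. u \<in> dom c d \<Longrightarrow> \<exists>K'. (K has_derivative K') (at u) \<and> (K' = (\<lambda>x. 0) \<longleftrightarrow> Z u = 0)"
    and "\<And>p r x. p \<in> fst c \<Longrightarrow> F p \<in> fst d \<Longrightarrow> r \<noteq> 0 \<Longrightarrow>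
      (\<And>q. q \<in> fst c \<Longrightarrow> F q \<in> fst d \<Longrightarrow> W d q = r *\<^sub>R E d q) \<Longrightarrow>
      shape_operator M \<Gamma> F W c p x = r *\<^sub>R shape_operator M \<Gamma> F E c p x"
proof -
  interpret equiaffine_coords "dom c d" "snd d ` fst d" "loc c d" "\<lambda>v. g d (chart_inv d v)"
    "\<lambda>v. \<Gamma> d (chart_inv d v)" "\<lambda>u. E d (chart_inv c u)" \<kappa> "\<lambda>u. W d (chart_inv c u)"
    by (rule equiaffine_coords[OF c d])
  have inU: "snd c p \<in> dom c d" if "p \<in> fst c" "F p \<in> fst d" for p using that by auto
  have L: "frechet_derivative (loc c d) (at (snd c p)) = tangent_map c d F p" for p by (simp add: tangent_map_def)
  have Weq: "W d p = tangent_map c d F p (Z (snd c p)) + a (snd c p) *\<^sub>R E d p" if "p \<in> fst c" "F p \<in> fst d" for p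
    using W_eq[OF inU[OF that]] unfolding L inv_\<Sigma>[OF c that(1)] .
  show thesis
  proof (rule that[of Z a gk])
    show "W d p = tangent_map c d F p (Z (snd c p)) + a (snd c p) *\<^sub>R E d p" if "p \<in> fst c" "F p \<in> fst d" for p
      by (rule Weq[OF that])
    show "0 < a u" if "u \<in> dom c d" for u by (rule a_pos[OF that])
    show "a u ^ (CARD('n) + 2) = \<bar>gk u\<bar>" if uU: "u \<in> dom c d" for u
    proof (rule a_power[OF uU])
      fix y
      obtain p where p: "p \<in> fst c" "F p \<in> fst d" and u: "u = snd c p" using uU by auto
      have "abs_vol g d (F p) (case_option (W d p) (\<lambda>k. tangent_map c d F p (y k))) = abs_vol (induced_tensor M \<Gamma> F W) c p y"
        using W c d p by (simp add: equiaffine_normal_def)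
      then show "sqrt \<bar>det (gram (g d (chart_inv d (loc c d u))))\<bar> *
          \<bar>det (\<chi> i j. (case j of None \<Rightarrow> W d (chart_inv c u) | Some l \<Rightarrow> frechet_derivative (loc c d) (at u) (y l)) $ i)\<bar>
          = sqrt \<bar>det (gram (k u))\<bar> * \<bar>det (\<chi> i j. y j $ i)\<bar>"
        unfolding abs_vol_def u L patch_equiaffine(1)[OF c p(1) d p(2)] o_apply inv_\<Sigma>[OF c p(1)] inv_M[OF d p(2)] .
    qed
    show "Z (snd c p) = 0" if p: "p \<in> fst c" "F p \<in> fst d" and r: "W d p = r *\<^sub>R E d p" for p r
    proof -
      have "W d p = tangent_map c d F p 0 + r *\<^sub>R E d p"
        using r linear_0[OF linear_L[OF inU[OF p]]] unfolding L by simp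
      from decomposition_unique(1)[OF linear_L[OF inU[OF p]] inj_L[OF inU[OF p]] E_transverse[OF inU[OF p]],
          unfolded L inv_\<Sigma>[OF c p(1)], OF this]
      show ?thesis by (simp only: Z_def L inv_\<Sigma>[OF c p(1)])
    qed
    show "gk (snd c p) = gauss_kronecker \<Sigma> M \<Gamma> F E p" if p: "p \<in> fst c" "F p \<in> fst d" for p
      unfolding gk_def patch_tensors(2)[OF c p(1) d p(2)] gauss_kronecker_chart[OF c p(1)] by (rule refl)
    show "\<exists>K'. (gk has_derivative K') (at u) \<and> (K' = (\<lambda>x. 0) \<longleftrightarrow> Z u = 0)" if uU: "u \<in> dom c d" for u
    proof -
      obtain p where p: "p \<in> fst c" "F p \<in> fst d" and u: "u = snd c p" using uU by auto
      \<comment> \<open>\<open>k\<close> and \<open>induced_tensor\<close> agree at all points of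
        the patch, not merely at u, so their derivatives agree as well.\<close>
      have nk: "nabla_k u x y z = cov_deriv_form (induced_connection M \<Gamma> F W) (induced_tensor M \<Gamma> F W) c p x y z" for x y z
      proof -
        have "frechet_derivative (\<lambda>u. k u y z) (at u) = frechet_derivative (\<lambda>u. induced_tensor M \<Gamma> F W c (chart_inv c u) y z) (at u)"
        proof (rule frechet_derivative_transform_within_open[OF _ open_U uU])
          show "(\<lambda>u. k u y z) differentiable at u"
            by (rule differentiableI[OF has_derivative_k[OF uU]])
          fix v assume "v \<in> dom c d"
          then obtain q where q: "q \<in> fst c" "F q \<in> fst d" and v: "v = snd c q" by auto
          show "k v y z = induced_tensor M \<Gamma> F W c (chart_inv c v) y z"
            unfolding v patch_equiaffine(1)[OF c q(1) d q(2)] inv_\<Sigma>[OF c q(1)] by (rule refl)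
        qed
        then show ?thesis
          unfolding nabla_k_def cov_deriv_form_def u patch_equiaffine[OF c p(1) d p(2)] by simp
      qed
      have "aligned \<Sigma> (induced_connection M \<Gamma> F W) (induced_tensor M \<Gamma> F W)"
        using W by (simp add: equiaffine_normal_def)
      then have "real CARD('n) * metric_trace (k u) (\<lambda>x y. nabla_k u x y (axis i 1))
          = metric_trace (k u) (nabla_k u (axis i 1))" for i
        unfolding aligned_def metric_trace_def nk[unfolded u] u patch_equiaffine(1)[OF c p(1) d p(2)] using c p by blast
      from has_derivative_gk_Z[OF uU this] have
        der: "(gk has_derivative (\<lambda>x. - (real CARD('n) + 2) * gk u * h u (Z u) x / a u)) (at u)" .
      \<comment> \<open>The scalar factors are nonzero and \<open>h\<close> is nondegenerate, so the
        differential vanishes only together with \<open>Z u\<close>.\<close>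
      have "(\<lambda>x. - (real CARD('n) + 2) * gk u * h u (Z u) x / a u) = (\<lambda>x. 0) \<longleftrightarrow> (\<forall>x. h u (Z u) x = 0)"
        using gk_nonzero[OF uU] a_pos[OF uU] by (auto simp: fun_eq_iff add_eq_0_iff)
      also have "\<dots> \<longleftrightarrow> Z u = 0"
        using nondeg_h[OF uU] bilinear_lzero[OF bilinear_h[OF uU]] by (auto simp: nondegenerate_form_def)
      finally show ?thesis using der by blast
    qed
    show "shape_operator M \<Gamma> F W c p x = r *\<^sub>R shape_operator M \<Gamma> F E c p x"
      if p: "p \<in> fst c" "F p \<in> fst d" and r: "r \<noteq> 0"
        and parallel: "\<And>q. q \<in> fst c \<Longrightarrow> F q \<in> fst d \<Longrightarrow> W d q = r *\<^sub>R E d q" for p r x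
    proof -
      have "W d (chart_inv c u) = r *\<^sub>R E d (chart_inv c u)" if "u \<in> dom c d" for u
        using that parallel by (auto simp: inv_\<Sigma>[OF c])
      from shape_proportional[OF inU[OF p] r this]
      show ?thesis
        unfolding L inv_\<Sigma>[OF c p(1)] patch_tensors(2)[OF c p(1) d p(2)]
          induced_any_chart(3)[OF field_along_W c p(1) d p(2)] cov_along_eq_D[OF c p(1) d p(2)] .
    qed
  qed
qed

section \<open>The two implications\<close>

text \<open>The factor r may vary with p. Proportionality forces Z = 0, so the differential of the
  Gauss-Kronecker curvature vanishes throughout each patch, and the curvature is locally
  constant.\<close>

lemma proportional_imp_constant:
  assumes parallel: "\<And>p. p \<in> points \<Sigma> \<Longrightarrow> \<exists>r. \<forall>d\<in>atlas M. F p \<in> fst d \<longrightarrow> W d p = r *\<^sub>R E d p"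
    and pq: "p \<in> points \<Sigma>" "q \<in> points \<Sigma>"
  shows "gauss_kronecker \<Sigma> M \<Gamma> F E p = gauss_kronecker \<Sigma> M \<Gamma> F E q"
proof (rule locally_constant_imp_constant[OF connected _ pq])
  fix p assume p: "p \<in> points \<Sigma>"
  let ?c = "chart_at \<Sigma> p" and ?d = "chart_at M (F p)"
  have c: "?c \<in> atlas \<Sigma>" "p \<in> fst ?c" using chart_at_\<Sigma>[OF p] by auto
  have d: "?d \<in> atlas M" "F p \<in> fst ?d" using chart_at_M[OF p] by auto
  obtain Z :: "real ^ 'n \<Rightarrow> real ^ 'n" and K where Z: "\<And>p r. p \<in> fst ?c \<Longrightarrow> F p \<in> fst ?d \<Longrightarrow> W ?d p = r *\<^sub>R E ?d p \<Longrightarrow> Z (snd ?c p) = 0"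
    and K: "\<And>p. p \<in> fst ?c \<Longrightarrow> F p \<in> fst ?d \<Longrightarrow> K (snd ?c p) = gauss_kronecker \<Sigma> M \<Gamma> F E p"
    and der: "\<And>u. u \<in> dom ?c ?d \<Longrightarrow> \<exists>K'. (K has_derivative K') (at u) \<and> (K' = (\<lambda>x. 0) \<longleftrightarrow> Z u = 0)"
  proof (rule patch_decomposition[OF c(1) d(1)], goal_cases)
    case (1 a Z K)
    show thesis by (rule that[of Z K]) (fact 1)+
  qed
  have der0: "(K has_derivative (\<lambda>x. 0)) (at u)" if u: "u \<in> dom ?c ?d" for u
  proof -
    obtain q where q: "q \<in> fst ?c" "F q \<in> fst ?d" and uq: "u = snd ?c q" using u by auto
    have "Z u = 0" using parallel[OF points_\<Sigma>[OF c(1) q(1)]] Z[OF q] d(1) q(2) unfolding uq by blast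
    then show ?thesis using der[OF u] by auto
  qed
  \<comment> \<open>The domain of the patch may be disconnected; a ball inside it is connected, as
    needed for a vanishing derivative to imply constancy.\<close>
  have "snd ?c p \<in> dom ?c ?d" using c d by auto
  then obtain r where r: "0 < r" "ball (snd ?c p) r \<subseteq> dom ?c ?d"
    using open_dom[OF c(1) d(1)] open_contains_ball by blast
  let ?N = "{q \<in> fst ?c. snd ?c q \<in> ball (snd ?c p) r}"
  show "\<exists>N. openin (mtop \<Sigma>) N \<and> p \<in> N \<and> (\<forall>q\<in>N. gauss_kronecker \<Sigma> M \<Gamma> F E q = gauss_kronecker \<Sigma> M \<Gamma> F E p)"
  proof (intro exI[of _ ?N] conjI ballI)
    show "openin (mtop \<Sigma>) ?N" by (rule openin_chart_preimage[OF chart_\<Sigma>[OF c(1)] open_ball])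
    show "p \<in> ?N" using c r by simp
    fix q assume q: "q \<in> ?N"
    \<comment> \<open>The ball lies in the image of points that F maps into \<open>?d\<close>;
      injectivity of the coordinate map shows that q is one of them.\<close>
    have "F q \<in> fst ?d"
    proof -
      have "snd ?c q \<in> dom ?c ?d" using q r(2) by blast
      then obtain q' where "q' \<in> fst ?c" "F q' \<in> fst ?d" "snd ?c q = snd ?c q'" by auto
      then show ?thesis using inv_\<Sigma>[OF c(1), of q] inv_\<Sigma>[OF c(1), of q'] q by simp
    qed
    have "K (snd ?c q) = K (snd ?c p)"
    proof (rule has_derivative_zero_unique_connected[OF open_ball[of "snd ?c p" r] connected_ball])
      show "(K has_derivative (\<lambda>x. 0)) (at u)" if "u \<in> ball (snd ?c p) r" for u
        using der0 r(2) that by blast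
      show "snd ?c q \<in> ball (snd ?c p) r" "snd ?c p \<in> ball (snd ?c p) r" using q r(1) by auto
    qed
    then show "gauss_kronecker \<Sigma> M \<Gamma> F E q = gauss_kronecker \<Sigma> M \<Gamma> F E p"
      using K[of q] K[of p] q c d \<open>F q \<in> fst ?d\<close> by simp
  qed
qed

text \<open>No gluing is required: in every pair of charts \<open>a\<close> is the positive solution
  of a^(n+2) = |K0|, so the same explicit r serves all patches and all points.\<close>

lemma constant_imp_proportional:
  assumes K0: "\<And>p. p \<in> points \<Sigma> \<Longrightarrow> gauss_kronecker \<Sigma> M \<Gamma> F E p = K0"
  defines "r \<equiv> root (CARD('n) + 2) \<bar>K0\<bar>"
  assumes p: "p \<in> points \<Sigma>"
  shows "d \<in> atlas M \<Longrightarrow> F p \<in> fst d \<Longrightarrow> W d p = r *\<^sub>R E d p"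
    and "mean_curvature \<Sigma> M \<Gamma> F W p = r * mean_curvature \<Sigma> M \<Gamma> F E p"
proof -
  have main: "W d p = r *\<^sub>R E d p \<and> 0 < r \<and> shape_operator M \<Gamma> F W c p = (\<lambda>x. r *\<^sub>R shape_operator M \<Gamma> F E c p x)"
    if c: "c \<in> atlas \<Sigma>" "p \<in> fst c" and d: "d \<in> atlas M" "F p \<in> fst d" for c d
  proof -
    obtain a Z K where
      Weq: "\<And>p. p \<in> fst c \<Longrightarrow> F p \<in> fst d \<Longrightarrow> W d p = tangent_map c d F p (Z (snd c p)) + a (snd c p) *\<^sub>R E d p"
      and apos: "\<And>u. u \<in> dom c d \<Longrightarrow> 0 < a u" and apow: "\<And>u. u \<in> dom c d \<Longrightarrow> a u ^ (CARD('n) + 2) = \<bar>K u\<bar>"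
      and K: "\<And>p. p \<in> fst c \<Longrightarrow> F p \<in> fst d \<Longrightarrow> K (snd c p) = gauss_kronecker \<Sigma> M \<Gamma> F E p"
      and der: "\<And>u. u \<in> dom c d \<Longrightarrow> \<exists>K'. (K has_derivative K') (at u) \<and> (K' = (\<lambda>x. 0) \<longleftrightarrow> Z u = 0)"
      and sh: "\<And>p r x. p \<in> fst c \<Longrightarrow> F p \<in> fst d \<Longrightarrow> r \<noteq> 0 \<Longrightarrow>
        (\<And>q. q \<in> fst c \<Longrightarrow> F q \<in> fst d \<Longrightarrow> W d q = r *\<^sub>R E d q) \<Longrightarrow>
        shape_operator M \<Gamma> F W c p x = r *\<^sub>R shape_operator M \<Gamma> F E c p x"
    proof (rule patch_decomposition[OF c(1) d(1)], goal_cases)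
    case (1 a Z K)
    show thesis by (rule that[of Z a K]) (fact 1)+
  qed
    have Kc: "K u = K0" if "u \<in> dom c d" for u
      using that by (auto simp: K K0 points_\<Sigma>[OF c(1)])
    have Z0: "Z u = 0" if u: "u \<in> dom c d" for u
    proof -
      obtain K' where K': "(K has_derivative K') (at u)" "K' = (\<lambda>x. 0) \<longleftrightarrow> Z u = 0" using der[OF u] by blast
      have "(K has_derivative (\<lambda>x. 0)) (at u)"
        by (rule has_derivative_transform_within_open[OF has_derivative_const[of K0] open_dom[OF c(1) d(1)] u]) (simp add: Kc)
      then show ?thesis using K' has_derivative_unique by blast
    qed
    \<comment> \<open>Positivity of \<open>a\<close>, that is co-orientation, selects the
      root.\<close>
    have a: "a u = r" if u: "u \<in> dom c d" for u
      using real_root_power_cancel[of "CARD('n) + 2" "a u"] apos[OF u] apow[OF u] by (simp add: r_def Kc[OF u])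
    have parallel: "W d q = r *\<^sub>R E d q" if q: "q \<in> fst c" "F q \<in> fst d" for q
    proof -
      have u: "snd c q \<in> dom c d" using q by auto
      have "linear (tangent_map c d F q)"
        using metric_patch.linear_L[OF ambient_patch[OF c(1) d(1)] u] by (simp add: tangent_map_def)
      then show ?thesis using Weq[OF q] by (simp add: Z0[OF u] a[OF u] linear_0)
    qed
    have "snd c p \<in> dom c d" using c d by auto
    then have "0 < r" using apos a by metis
    then show ?thesis using parallel sh[OF c(2) d(2) _ parallel] c d by blast
  qed
  have c: "chart_at \<Sigma> p \<in> atlas \<Sigma>" "p \<in> fst (chart_at \<Sigma> p)" using chart_at_\<Sigma>[OF p] by auto
  show "W d p = r *\<^sub>R E d p" if "d \<in> atlas M" "F p \<in> fst d" using main[OF c that] by blast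
  have "shape_operator M \<Gamma> F W (chart_at \<Sigma> p) p = (\<lambda>x. r *\<^sub>R shape_operator M \<Gamma> F E (chart_at \<Sigma> p) p x)"
    using main[OF c] chart_at_M[OF p] by blast
  then show "mean_curvature \<Sigma> M \<Gamma> F W p = r * mean_curvature \<Sigma> M \<Gamma> F E p"
    by (simp add: mean_curvature_def trace_def matrix_def sum_distrib_left)
qed

end

theorem theorem4p2:
  fixes M :: "('a, 'n::finite option) manifold" and \<Sigma> :: "('b, 'n) manifold"
    and g :: "('a, 'n option) form2" and \<Gamma> :: "('a, 'n option) christoffel"
    and F :: "'b \<Rightarrow> 'a"
    and \<nu> :: "('a, 'n option) chart \<Rightarrow> 'b \<Rightarrow> real ^ 'n option \<Rightarrow> real"
    and W E :: "('b, 'a, 'n option) along"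
  assumes "2 \<le> CARD('n)"
    and "smooth_manifold M" and "smooth_manifold \<Sigma>" and "connected_space (mtop \<Sigma>)"
    and "pseudo_riemannian_metric M g" and "levi_civita M g \<Gamma>" and "constant_curvature M g \<Gamma>"
    and "immersion \<Sigma> M F" and "coorientation \<Sigma> M F \<nu>"
    and "nondegenerate_hypersurface \<Sigma> M \<Gamma> F"
    and "pseudo_riemannian_metric \<Sigma> (induced_metric M g F)"
    and "equiaffine_normal \<Sigma> M g \<Gamma> F \<nu> W"
    and "unimodular_orthogonal \<Sigma> M g F \<nu> E"
  shows "((\<forall>p\<in>points \<Sigma>. \<exists>r. \<forall>d\<in>atlas M. F p \<in> fst d \<longrightarrow> W d p = r *\<^sub>R E d p) \<longleftrightarrow>
           (\<exists>K. \<forall>p\<in>points \<Sigma>. gauss_kronecker \<Sigma> M \<Gamma> F E p = K)) \<and>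
         ((\<exists>K. \<forall>p\<in>points \<Sigma>. gauss_kronecker \<Sigma> M \<Gamma> F E p = K) \<longrightarrow>
           (\<exists>r. \<forall>p\<in>points \<Sigma>. \<forall>d\<in>atlas M. F p \<in> fst d \<longrightarrow> W d p = r *\<^sub>R E d p) \<and>
           (\<exists>r. \<forall>p\<in>points \<Sigma>.
              mean_curvature \<Sigma> M \<Gamma> F W p = r * mean_curvature \<Sigma> M \<Gamma> F E p))"
proof -
  obtain \<kappa> where \<kappa>: "\<And>c p x y z. c \<in> atlas M \<Longrightarrow> p \<in> fst c \<Longrightarrow>
      curvature \<Gamma> c p x y z = \<kappa> *\<^sub>R (g c p y z *\<^sub>R x - g c p x z *\<^sub>R y)"
    using \<open>constant_curvature M g \<Gamma>\<close> unfolding constant_curvature_def by blast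
  interpret equiaffine_hypersurface M \<Sigma> g \<Gamma> F \<nu> W E \<kappa>
    by (rule equiaffine_hypersurface.intro) (fact assms \<kappa>)+
  let ?constant = "\<exists>K. \<forall>p\<in>points \<Sigma>. gauss_kronecker \<Sigma> M \<Gamma> F E p = K"
  let ?multiple = "\<lambda>r. \<forall>p\<in>points \<Sigma>. \<forall>d\<in>atlas M. F p \<in> fst d \<longrightarrow> W d p = r *\<^sub>R E d p"
  have 1: "?constant" if pr: "\<forall>p\<in>points \<Sigma>. \<exists>r. \<forall>d\<in>atlas M. F p \<in> fst d \<longrightarrow> W d p = r *\<^sub>R E d p"
  \<comment> \<open>The constant is taken to be the value at some point, so the empty hypersurface
    is treated apart.\<close>
  proof (cases "points \<Sigma> = {}")
    case False
    then obtain q where q: "q \<in> points \<Sigma>" by blast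
    have "gauss_kronecker \<Sigma> M \<Gamma> F E p = gauss_kronecker \<Sigma> M \<Gamma> F E q" if "p \<in> points \<Sigma>" for p
      by (rule proportional_imp_constant[OF _ that q]) (use pr in blast)
    then show ?thesis by blast
  qed simp
  have 2: "\<exists>r. ?multiple r \<and>
      (\<forall>p\<in>points \<Sigma>. mean_curvature \<Sigma> M \<Gamma> F W p = r * mean_curvature \<Sigma> M \<Gamma> F E p)" if ?constant
  proof -
    from that obtain K where "\<forall>p\<in>points \<Sigma>. gauss_kronecker \<Sigma> M \<Gamma> F E p = K" by (rule exE)
    note K = bspec[OF this]
    let ?r = "root (CARD('n) + 2) \<bar>K\<bar>"
    have "?multiple ?r"
      by (intro ballI impI) (rule constant_imp_proportional(1)[OF K])
    moreover have "\<forall>p\<in>points \<Sigma>. mean_curvature \<Sigma> M \<Gamma> F W p = ?r * mean_curvature \<Sigma> M \<Gamma> F E p"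
      by (intro ballI) (rule constant_imp_proportional(2)[OF K])
    ultimately show ?thesis by (intro exI conjI)
  qed
  show ?thesis
  proof (intro conjI iffI impI)
    assume ?constant
    from 2[OF this] obtain r where r: "?multiple r"
      and H: "\<forall>p\<in>points \<Sigma>. mean_curvature \<Sigma> M \<Gamma> F W p = r * mean_curvature \<Sigma> M \<Gamma> F E p"
      by (elim exE conjE)
    show "\<exists>r. ?multiple r" by (rule exI[of _ r]) (rule r)
    show "\<exists>r. \<forall>p\<in>points \<Sigma>. mean_curvature \<Sigma> M \<Gamma> F W p = r * mean_curvature \<Sigma> M \<Gamma> F E p"
      by (rule exI[of _ r]) (rule H)
    show "\<forall>p\<in>points \<Sigma>. \<exists>r. \<forall>d\<in>atlas M. F p \<in> fst d \<longrightarrow> W d p = r *\<^sub>R E d p"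
      by (rule ballI, rule exI[of _ r], rule bspec[OF r])
  qed (rule 1)
qed

end
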